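(* Let $\varepsilon>0$ and assume the following. (1) $\hat{\mathbb P}=\sum_{j\in[J]}p_j\delta_{\hat z_j}$ for some $J\in\mathbb N$, with $p_j>0$ and $\hat z_j\in\mathcal Z$. (2) $c(z,\hat z)$ is lower semicontinuous in $(z,\hat z)$ and convex in $z$; $\ell(\theta,z)=\max_{i\in[I]}\ell_i(\theta,z)$ for some $I\in\mathbb N$, where each $\ell_i(\theta,z)$ is proper, convex and lower semicontinuous in $\theta$ and each $-\ell_i(\theta,z)$ is proper, convex and lower semicontinuous in $z$; $\mathcal Z=\{z\in\mathbb R^d:f_k(z)\le0\ \forall k\in[K]\}$ and $\Theta=\{\theta\in\mathbb R^m:g_l(\theta)\le 0\ \forall l\in[L]\}$ with all $f_k$ and $g_l$ proper, convex and lower semicontinuous. (3) For every $j\in[J]$, $\hat z_j\in\mathrm{rint}(\mathrm{dom}(c(\cdot,\hat z_j)))$ and $\hat z_j$ is a Slater point of $\mathcal Z$; and $\Theta$ admits a Slater point. (4) For any $\mathbb Q\in\mathbb B_\varepsilon(\hat{\mathbb P})$ and $\bar\theta\in\Theta$ there is a neighborhood $\mathcal U$ of $\bar\theta$ such that the family $\ell^-(\theta,z)=-\min\{0,\ell(\theta,z)\}$, $\theta\in\mathcal U$, is uniformly $\mathbb Q$-integrable in $z$. (5) There exists $\theta\in\Theta$ with $\sup_{\mathbb Q\in\mathbb B_\varepsilon(\hat{\mathbb P})}\mathbb E_{Z\sim\mathbb Q}[\ell(\theta,Z)]<+\infty$. (6) At least one of the following holds: (a) $\mathbb E_{Z\sim\mathbb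 Q}[\ell(\theta,Z)]$ is inf-compact in $\theta\in\Theta$ for some $\mathbb Q\in\mathbb B_\varepsilon(\hat{\mathbb P})$ (all its sublevel sets in $\Theta$ are compact); (b) $\mathcal Z$ is compact; (c) $c(z,\hat z)$ grows superlinearly with $z$. Then the dual DRO problem $\sup_{\mathbb Q\in\mathbb B_\varepsilon(\hat{\mathbb P})}\inf_{\theta\in\Theta}\mathbb E_{Z\sim\mathbb Q}[\ell(\theta,Z)]$ has the same supremum as the finite convex program $$\begin{array}{cll}\max&-\sum_{i\in[I]}\sum_{j\in[J]}q_{ij}\,\ell_i^{*1}(\alpha_{ij}/q_{ij},\hat z_j+\xi_{ij}/q_{ij})-\sum_{l\in[L]}\nu_l\,g_l^*(\beta_l/\nu_l)\\ \text{s.t.}&q_{ij},\nu_l\in\mathbb R_+,\ \xi_{ij}\in\mathbb R^d,\ \alpha_{ij},\beta_l\in\mathbb R^m&\forall i\in[I],j\in[J],l\in[L]\\ &q_{ij}f_k(\hat z_j+\xi_{ij}/q_{ij})\le0&\forall i\in[I],j\in[J],k\in[K]\\ &\sum_{i\in[I]}q_{ij}=p_j&\forall j\in[J]\\ &\sum_{i\in[I]}\sum_{j\in[J]}\alpha_{ij}+\sum_{l\in[L]}\beta_l=0\\ &\sum_{i\in[I]}\sum_{j\in[J]}q_{ij}\,c(\hat z_j+\xi_{ij}/q_{ij},\hat z_j)\le\varepsilon,\end{array}$$ where $\ell_i^{*1}(\alpha,z)$ denotes the conjugate of $\ell_i(\theta,z)$ with respect to $\theta$ for fixed $z$.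
   Context: $[n]=\{1,\dots,n\}$. $\Theta\subseteq\mathbb R^m$ and $\mathcal Z\subseteq\mathbb R^d$ are non-empty and closed. $\mathcal P(\mathcal Z)$ is the set of probability distributions on $\mathcal Z$ and $\hat{\mathbb P}\in\mathcal P(\mathcal Z)$ the reference distribution; $\delta_z$ is the Dirac measure at $z$. The cost $c:\mathcal Z\times\mathcal Z\to[0,+\infty]$ satisfies $c(z,\hat z)=0$ iff $z=\hat z$; when its domain or perspective is taken, $c(\cdot,\hat z)$ is regarded as an extended-real-valued function on $\mathbb R^d$ (equal to $+\infty$ where it is not defined). $d_c(\mathbb Q,\hat{\mathbb P})=\inf_{\pi}\mathbb E_{(Z,\hat Z)\sim\pi}[c(Z,\hat Z)]$ over all couplings $\pi$ of $\mathbb Q$ and $\hat{\mathbb P}$, and $\mathbb B_\varepsilon(\hat{\mathbb P})=\{\mathbb Q\in\mathcal P(\mathcal Z):d_c(\mathbb Q,\hat{\mathbb P})\le\varepsilon\}$. "$c(z,\hat z)$ grows superlinearly with $z$" means $c(z,\hat z)/\|z\|\to\infty$ as $\|z\|\to\infty$ for fixed $\hat z$. Slater point: for a set $\mathcal X=\{x:h_m(x)\le0\ \forall m\in[M]\}$ given by such a representation, a Slater point is any $x^s\in\mathcal X$ with $x^s\in\mathrm{rint}(\mathrm{dom}(h_m))$ for all $m\in[M]$ and $h_m(x^s)<0$ for all $m$ such that $h_m$ is nonlinear. Here $\mathrm{dom}(h)=\{x:h(x)<\infty\}$ and $\mathrm{rint}$ is the relative interior. Conjugates: $f^*(y)=\sup_x\langle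 y,x\rangle-f(x)$. Perspective convention: for proper convex lower semicontinuous $f$ and $\lambda\ge 0$, $\lambda f(x/\lambda)$ denotes the perspective function, equal to $\lambda f(x/\lambda)$ in the usual sense if $\lambda>0$ and to $\delta^*_{\mathrm{dom}(f^* )}(x)=\sup_{y\in\mathrm{dom}(f^* )}\langle x,y\rangle$ if $\lambda=0$. Accordingly $q f_k(\hat z_j+\xi/q)$, $q\,c(\hat z_j+\xi/q,\hat z_j)$ and $q\,\ell_i^{*1}(\alpha/q,\hat z_j+\xi/q)$ are the perspectives of $\xi\mapsto f_k(\hat z_j+\xi)$, $\xi\mapsto c(\hat z_j+\xi,\hat z_j)$ and $(\alpha,\xi)\mapsto \ell_i^{*1}(\alpha,\hat z_j+\xi)$, respectively. *)

theory Defs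
  imports "HOL-Probability.Probability"
begin

section \<open>Extended-real-valued convex functions\<close>

definition effective_dom :: "('a \<Rightarrow> ereal) \<Rightarrow> 'a set" where
  "effective_dom f = {x. f x < \<infinity>}"

definition proper_fun :: "('a \<Rightarrow> ereal) \<Rightarrow> bool" where
  "proper_fun f \<longleftrightarrow> (\<forall>x. f x > -\<infinity>) \<and> (\<exists>x. f x < \<infinity>)"

text \<open>Convexity is stated through the epigraph, so that no sum \<open>\<infinity> - \<infinity>\<close> has to be evaluated.\<close>

definition convex_fun :: "('a::real_vector \<Rightarrow> ereal) \<Rightarrow> bool" where
  "convex_fun f \<longleftrightarrow> convex {(x, t::real). f x \<le> ereal t}"

definition lsc_on :: "'a::topological_space set \<Rightarrow> ('a \<Rightarrow> 'b::complete_lattice) \<Rightarrow> bool" where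
  "lsc_on S f \<longleftrightarrow> (\<forall>x\<in>S. f x \<le> Liminf (at x within S) f)"

definition proper_convex_lsc :: "('a::real_normed_vector \<Rightarrow> ereal) \<Rightarrow> bool" where
  "proper_convex_lsc f \<longleftrightarrow> proper_fun f \<and> convex_fun f \<and> lsc_on UNIV f"

definition conjugate :: "('a::real_inner \<Rightarrow> ereal) \<Rightarrow> 'a \<Rightarrow> ereal" where
  "conjugate f y = (SUP x. ereal (y \<bullet> x) - f x)"

text \<open>
  The value at \<open>r = 0\<close> is the support function of the domain of the conjugate. The function is
  meant for \<open>r \<ge> 0\<close> only.
\<close>

definition perspective :: "('a::real_inner \<Rightarrow> ereal) \<Rightarrow> real \<Rightarrow> 'a \<Rightarrow> ereal" where
  "perspective f r x =
     (if r > 0 then ereal r * f (x /\<^sub>R r)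
      else (SUP y\<in>effective_dom (conjugate f). ereal (x \<bullet> y)))"

text \<open>
  A constraint function is linear, in the sense used for Slater points, if it is affine and finite
  on the whole space.
\<close>

definition linear_constraint :: "('a::real_inner \<Rightarrow> ereal) \<Rightarrow> bool" where
  "linear_constraint h \<longleftrightarrow> (\<exists>a b. \<forall>x. h x = ereal (a \<bullet> x + b))"

definition slater_point :: "nat \<Rightarrow> (nat \<Rightarrow> 'a::euclidean_space \<Rightarrow> ereal) \<Rightarrow> 'a \<Rightarrow> bool" where
  "slater_point M h x \<longleftrightarrow>
     (\<forall>m\<in>{1..M}. h m x \<le> 0 \<and> x \<in> rel_interior (effective_dom (h m)) \<and>
        (\<not> linear_constraint (h m) \<longrightarrow> h m x < 0))"

section \<open>Distributions and optimal transport\<close>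

abbreviation borel_on :: "'a::topological_space set \<Rightarrow> 'a measure" where
  "borel_on Z \<equiv> restrict_space borel Z"

definition distributions :: "'a::topological_space set \<Rightarrow> 'a measure set" where
  "distributions Z = space (prob_algebra (borel_on Z))"

definition couplings :: "'a::topological_space set \<Rightarrow> 'a measure \<Rightarrow> 'a measure \<Rightarrow> ('a \<times> 'a) measure set" where
  "couplings Z Q P =
     {\<pi> \<in> space (prob_algebra (borel_on Z \<Otimes>\<^sub>M borel_on Z)).
        distr \<pi> (borel_on Z) fst = Q \<and> distr \<pi> (borel_on Z) snd = P}"

definition transport_discrepancy ::
    "'a::topological_space set \<Rightarrow> ('a \<Rightarrow> 'a \<Rightarrow> ennreal) \<Rightarrow> 'a measure \<Rightarrow> 'a measure \<Rightarrow> ennreal" where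
  "transport_discrepancy Z c Q P = (INF \<pi>\<in>couplings Z Q P. \<integral>\<^sup>+ (z, zh). c z zh \<partial>\<pi>)"

definition ambiguity_set ::
    "'a::topological_space set \<Rightarrow> ('a \<Rightarrow> 'a \<Rightarrow> ennreal) \<Rightarrow> real \<Rightarrow> 'a measure \<Rightarrow> 'a measure set" where
  "ambiguity_set Z c \<epsilon> P = {Q \<in> distributions Z. transport_discrepancy Z c Q P \<le> ennreal \<epsilon>}"

text \<open>The section \<open>c(\<cdot>, zh)\<close>, extended by \<open>\<infinity>\<close> outside \<open>Z\<close>.\<close>

definition cost_section :: "'a set \<Rightarrow> ('a \<Rightarrow> 'a \<Rightarrow> ennreal) \<Rightarrow> 'a \<Rightarrow> 'a \<Rightarrow> ereal" where
  "cost_section Z c zh z = (if z \<in> Z then enn2ereal (c z zh) else \<infinity>)"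

text \<open>
  The expectation is the difference of the integrals of the positive and the negative part
  (\<open>e2ennreal\<close> maps negative numbers to \<open>0\<close>); it equals \<open>\<infinity>\<close> if both are infinite.
\<close>

definition expect :: "'a measure \<Rightarrow> ('a \<Rightarrow> ereal) \<Rightarrow> ereal" where
  "expect Q f = enn2ereal (\<integral>\<^sup>+ z. e2ennreal (f z) \<partial>Q) - enn2ereal (\<integral>\<^sup>+ z. e2ennreal (- f z) \<partial>Q)"

definition uniformly_integrable_family :: "'a measure \<Rightarrow> 'i set \<Rightarrow> ('i \<Rightarrow> 'a \<Rightarrow> ennreal) \<Rightarrow> bool" where
  "uniformly_integrable_family Q T \<phi> \<longleftrightarrow>
     ((\<lambda>b::real. SUP t\<in>T. \<integral>\<^sup>+ z. \<phi> t z * indicator {z. \<phi> t z > ennreal b} z \<partial>Q) \<longlongrightarrow> 0) at_top"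

section \<open>The finite convex program\<close>

definition program_feasible ::
    "nat \<Rightarrow> nat \<Rightarrow> nat \<Rightarrow> nat \<Rightarrow> (real^'d) set \<Rightarrow> (real^'d \<Rightarrow> real^'d \<Rightarrow> ennreal) \<Rightarrow> real \<Rightarrow>
     (nat \<Rightarrow> real) \<Rightarrow> (nat \<Rightarrow> real^'d) \<Rightarrow> (nat \<Rightarrow> real^'d \<Rightarrow> ereal) \<Rightarrow>
     (nat \<Rightarrow> nat \<Rightarrow> real) \<Rightarrow> (nat \<Rightarrow> real) \<Rightarrow> (nat \<Rightarrow> nat \<Rightarrow> real^'d) \<Rightarrow>
     (nat \<Rightarrow> nat \<Rightarrow> real^'m) \<Rightarrow> (nat \<Rightarrow> real^'m) \<Rightarrow> bool" where
  "program_feasible I J K L Z c \<epsilon> p zh f q \<nu> \<xi> \<alpha> \<beta> \<longleftrightarrow>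
     (\<forall>i\<in>{1..I}. \<forall>j\<in>{1..J}. q i j \<ge> 0) \<and>
     (\<forall>l\<in>{1..L}. \<nu> l \<ge> 0) \<and>
     (\<forall>i\<in>{1..I}. \<forall>j\<in>{1..J}. \<forall>k\<in>{1..K}.
        perspective (\<lambda>x. f k (zh j + x)) (q i j) (\<xi> i j) \<le> 0) \<and>
     (\<forall>j\<in>{1..J}. (\<Sum>i=1..I. q i j) = p j) \<and>
     (\<Sum>i=1..I. \<Sum>j=1..J. \<alpha> i j) + (\<Sum>l=1..L. \<beta> l) = 0 \<and>
     (\<Sum>i=1..I. \<Sum>j=1..J. perspective (\<lambda>x. cost_section Z c (zh j) (zh j + x)) (q i j) (\<xi> i j))
       \<le> ereal \<epsilon>"

definition program_objective ::
    "nat \<Rightarrow> nat \<Rightarrow> nat \<Rightarrow> (nat \<Rightarrow> real^'d) \<Rightarrow> (nat \<Rightarrow> real^'m \<Rightarrow> real^'d \<Rightarrow> ereal) \<Rightarrow>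
     (nat \<Rightarrow> real^'m \<Rightarrow> ereal) \<Rightarrow> (nat \<Rightarrow> nat \<Rightarrow> real) \<Rightarrow> (nat \<Rightarrow> real) \<Rightarrow>
     (nat \<Rightarrow> nat \<Rightarrow> real^'d) \<Rightarrow> (nat \<Rightarrow> nat \<Rightarrow> real^'m) \<Rightarrow> (nat \<Rightarrow> real^'m) \<Rightarrow> ereal" where
  "program_objective I J L zh li g q \<nu> \<xi> \<alpha> \<beta> =
     - (\<Sum>i=1..I. \<Sum>j=1..J.
          perspective (\<lambda>(a, x). conjugate (\<lambda>\<theta>. li i \<theta> (zh j + x)) a) (q i j) (\<alpha> i j, \<xi> i j))
     - (\<Sum>l=1..L. perspective (conjugate (g l)) (\<nu> l) (\<beta> l))"

end

theory Submission
  imports Defs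
begin

text \<open>
  Perspectives of closed convex functions are suprema over affine minorants (Fenchel--Moreau), so
  they are jointly convex and closed, and Jensen's inequality for them is immediate. Let \<open>K \<theta> x\<close> be
  the negated sum of the perspectives of \<open>- \<ell>\<^sub>i(\<theta>, zh\<^sub>j + \<cdot>)\<close> at \<open>x = (q, \<xi>)\<close>. For fixed \<open>x\<close>, Lagrange
  duality in \<open>\<theta>\<close>, valid because of the Slater point of \<open>\<Theta>\<close>, turns the infimum of \<open>K \<theta> x\<close> over \<open>\<Theta>\<close>
  into the maximum over \<open>\<alpha>\<close>, \<open>\<beta>\<close> and \<open>\<nu>\<close>, so the program has the value \<open>sup\<^sub>x inf\<^sub>\<theta> K \<theta> x\<close>. The
  costs vanish only at the atoms and hence grow at least linearly, which makes the set of feasible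
  \<open>x\<close> compact; a minimax theorem exchanges \<open>sup\<close> and \<open>inf\<close>.

  Given a coupling with \<open>P\<close>, conditioning on the atom and on the index attaining the maximal loss
  yields a feasible \<open>x\<close> for which \<open>K \<theta> x\<close> dominates the expected loss, so the dual DRO value is at most
  the program value. Conversely, a feasible \<open>x\<close> with \<open>\<xi>\<^sub>i\<^sub>j = 0\<close> whenever \<open>q\<^sub>i\<^sub>j = 0\<close> is a discrete
  distribution. Compactness of \<open>Z\<close> or superlinear growth forces this property. In the inf-compact case
  \<open>x\<close> is perturbed towards the atoms and its distribution is mixed with a little of the
  distribution \<open>Q\<close> of the regularity condition: the expectation under \<open>Q\<close> grows linearly in \<open>\<theta>\<close>, which
  compensates the effect of the perturbation uniformly in \<open>\<theta>\<close>.
\<close>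

section \<open>Affine minorants and perspective functions\<close>

text \<open>The index attaining the maximal loss depends on \<theta>, and so does the point obtained
  by conditioning a coupling. Hence one distribution does not directly yield one point that serves
  every \<theta>. The minimax theorem enters by contradiction: it supplies a single \<theta> that
  would defeat all feasible points, and conditioning is then done for this \<theta> only. The
  opposite inequality meets another obstacle. A point with weight 0 and nonzero displacement
  describes mass escaping to infinity: it acts on cost and loss through recession functions, but is
  no distribution. Moving towards the atoms makes the weights positive, at an expense controlled
  only by an affine function of \<theta>, which is not uniformly small on an unbounded \<Theta>.
  Linear growth, a consequence of convexity and inf-compactness, is of exactly the order needed to
  absorb it.\<close>

definition affine_minorant :: "('a::real_inner \<Rightarrow> ereal) \<Rightarrow> 'a \<Rightarrow> real \<Rightarrow> bool" where
  "affine_minorant f y b \<longleftrightarrow> (\<forall>u. ereal (y \<bullet> u - b) \<le> f u)"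

text \<open>Tests an extended real through the real numbers above it, so that bounds by
  \<open>f u\<close> become statements about points of the epigraph.\<close>

lemma ereal_le_iff_reals: "ereal a \<le> z \<longleftrightarrow> (\<forall>t. z \<le> ereal t \<longrightarrow> a \<le> t)"
proof (cases z)
  case MInf
  then show ?thesis by (auto intro!: exI[of _ "a - 1"])
qed auto

text \<open>The affine minorants of \<open>f\<close> are the points of the epigraph of the
  conjugate; later arguments handle these real pairs instead of conjugate values.\<close>

lemma conjugate_le_iff:
  "conjugate f y \<le> ereal b \<longleftrightarrow> affine_minorant f y b"
proof -
  have "ereal (y \<bullet> u) - f u \<le> ereal b \<longleftrightarrow> ereal (y \<bullet> u - b) \<le> f u" for u
    by (cases "f u") auto
  then show ?thesis
    unfolding conjugate_def affine_minorant_def by (simp add: SUP_le_iff)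
qed

lemma effective_dom_conjugate:
  assumes "proper_fun f"
  shows "y \<in> effective_dom (conjugate f) \<longleftrightarrow> (\<exists>b. affine_minorant f y b)"
proof
  assume "y \<in> effective_dom (conjugate f)"
  then have lt: "conjugate f y < \<infinity>" by (simp add: effective_dom_def)
  obtain x where x: "f x < \<infinity>" "f x > -\<infinity>" using assms by (auto simp: proper_fun_def)
  have "ereal (y \<bullet> x) - f x \<le> conjugate f y"
    unfolding conjugate_def by (rule SUP_upper) simp
  then have "conjugate f y \<noteq> -\<infinity>" using x by (cases "f x") auto
  then obtain b where "conjugate f y = ereal b" using lt by (cases "conjugate f y") auto
  then show "\<exists>b. affine_minorant f y b" using conjugate_le_iff[of f y b] by auto
next
  assume "\<exists>b. affine_minorant f y b"
  then obtain b where "conjugate f y \<le> ereal b" using conjugate_le_iff by blast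
  then have "conjugate f y < \<infinity>" by (rule le_less_trans) simp
  then show "y \<in> effective_dom (conjugate f)" by (simp add: effective_dom_def)
qed

section \<open>Closed epigraphs and their separation from points\<close>

lemma lsc_on_UNIV_iff:
  fixes f :: "'a::topological_space \<Rightarrow> ereal"
  shows "lsc_on UNIV f \<longleftrightarrow> (\<forall>w. closed {x. f x \<le> w})"
proof
  assume L: "lsc_on UNIV f"
  show "\<forall>w. closed {x. f x \<le> w}"
  proof
    fix w
    have "open {x. w < f x}"
    proof (subst open_subopen, intro ballI)
      fix x assume "x \<in> {x. w < f x}"
      then have wx: "w < f x" by simp
      have "f x \<le> Liminf (at x) f" using L by (simp add: lsc_on_def)
      then have "eventually (\<lambda>y. w < f y) (at x)" using wx le_Liminf_iff by blast
      then obtain T where "open T" "x \<in> T" "\<forall>y\<in>T. y \<noteq> x \<longrightarrow> w < f y"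
        unfolding eventually_at_topological by auto
      then show "\<exists>T. open T \<and> x \<in> T \<and> T \<subseteq> {x. w < f x}"
        using wx by (intro exI[of _ T]) auto
    qed
    moreover have "- {x. f x \<le> w} = {x. w < f x}" by auto
    ultimately show "closed {x. f x \<le> w}" by (simp add: closed_def)
  qed
next
  assume C: "\<forall>w. closed {x. f x \<le> w}"
  show "lsc_on UNIV f"
    unfolding lsc_on_def
  proof (intro ballI)
    fix x :: 'a
    show "f x \<le> Liminf (at x) f"
      unfolding le_Liminf_iff
    proof (intro allI impI)
      fix w assume "w < f x"
      moreover have "open (- {x. f x \<le> w})" using C by (simp add: open_Compl)
      ultimately show "eventually (\<lambda>y. w < f y) (at x)"
        unfolding eventually_at_topological
        by (intro exI[of _ "- {x. f x \<le> w}"]) auto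
    qed
  qed
qed

lemma closed_epigraph:
  fixes f :: "'a::topological_space \<Rightarrow> ereal"
  assumes "lsc_on UNIV f"
  shows "closed {(x, t::real). f x \<le> ereal t}"
proof -
  have "open (- {(x, t::real). f x \<le> ereal t})"
  proof (subst open_subopen, intro ballI)
    fix p assume p: "p \<in> - {(x, t::real). f x \<le> ereal t}"
    obtain x t where [simp]: "p = (x, t)" by (cases p)
    have "ereal t < f x" using p by auto
    \<comment> \<open>A level strictly between \<open>t\<close> and \<open>f x\<close> yields a box
      neighbourhood of the point that misses the epigraph.\<close>
    then obtain s where s: "t < s" "ereal s < f x"
      using ereal_dense2[of "ereal t" "f x"] by auto
    have "open ((- {x. f x \<le> ereal s}) \<times> {..<s})"
      using assms unfolding lsc_on_UNIV_iff by (intro open_Times) (auto simp: open_Compl)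
    moreover have "(- {x. f x \<le> ereal s}) \<times> {..<s} \<subseteq> - {(x, t::real). f x \<le> ereal t}"
      by (auto simp: not_le intro: order.trans[OF less_imp_le])
        (meson ereal_less_eq(3) less_imp_le order_trans not_le)
    moreover have "p \<in> (- {x. f x \<le> ereal s}) \<times> {..<s}" using s by auto
    ultimately show "\<exists>T. open T \<and> p \<in> T \<and> T \<subseteq> - {(x, t::real). f x \<le> ereal t}" by blast
  qed
  then show ?thesis by (simp add: closed_def)
qed

lemma proper_convex_lsc_not_MInf: "proper_convex_lsc f \<Longrightarrow> f x \<noteq> -\<infinity>"
  unfolding proper_convex_lsc_def proper_fun_def by force

lemma convex_fun_ineq:
  assumes "convex_fun f" "f x \<le> ereal a" "f y \<le> ereal b" "0 \<le> u" "0 \<le> v" "u + v = 1"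
  shows "f (u *\<^sub>R x + v *\<^sub>R y) \<le> ereal (u * a + v * b)"
proof -
  have "(x, a) \<in> {(x, t). f x \<le> ereal t}" "(y, b) \<in> {(x, t). f x \<le> ereal t}"
    using assms by auto
  then have "u *\<^sub>R (x, a) + v *\<^sub>R (y, b) \<in> {(x, t). f x \<le> ereal t}"
    using assms unfolding convex_fun_def by (intro convexD)
  then show ?thesis by simp
qed

text \<open>Strict separation of a point from a closed convex set. The vertical component
  \<open>s\<close> of the normal cannot be negative because the epigraph is unbounded upwards;
  \<open>s = 0\<close>, a vertical hyperplane, can occur if \<open>f x\<close> is infinite.\<close>

lemma epigraph_separation:
  fixes f :: "'a::euclidean_space \<Rightarrow> ereal"
  assumes f: "proper_convex_lsc f" and x: "ereal w < f x"
  shows "\<exists>a s \<beta>. s \<ge> 0 \<and> a \<bullet> x + s * w < \<beta> \<and> (\<forall>u t. f u \<le> ereal t \<longrightarrow> \<beta> < a \<bullet> u + s * t)"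
proof -
  let ?E = "{(x, t::real). f x \<le> ereal t}"
  have "convex ?E" "closed ?E" "(x, w) \<notin> ?E"
    using f x closed_epigraph[of f] by (auto simp: proper_convex_lsc_def convex_fun_def)
  from separating_hyperplane_closed_point[OF this] obtain A \<beta> where
    A: "A \<bullet> (x, w) < \<beta>" "\<forall>e\<in>?E. A \<bullet> e > \<beta>" by blast
  obtain a s where [simp]: "A = (a, s)" by (cases A)
  have 1: "a \<bullet> x + s * w < \<beta>" using A by simp
  have 2: "\<beta> < a \<bullet> u + s * t" if "f u \<le> ereal t" for u t
    using A(2) that by fastforce
  have "s \<ge> 0"
  proof (rule ccontr)
    assume "\<not> s \<ge> 0"
    then have s: "s < 0" by simp
    obtain u t where ut: "f u \<le> ereal t"
    proof -
      obtain u where "f u < \<infinity>" using f by (auto simp: proper_convex_lsc_def proper_fun_def)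
      then show thesis using that[of u "real_of_ereal (f u)"] proper_convex_lsc_not_MInf[OF f, of u]
        by (cases "f u") auto
    qed
    \<comment> \<open>As \<open>s\<close> is negative, a height of at least
      \<open>(\<beta> - a \<bullet> u) / s\<close> brings \<open>a \<bullet> u + s * r\<close> down
      to \<open>\<beta>\<close> or below.\<close>
    define r where "r = max t ((\<beta> - a \<bullet> u) / s)"
    have "f u \<le> ereal r" using ut by (simp add: r_def order_trans[OF ut])
    from 2[OF this] have "\<beta> < a \<bullet> u + s * r" .
    moreover have "s * r \<le> s * ((\<beta> - a \<bullet> u) / s)"
      using s by (intro mult_left_mono_neg) (auto simp: r_def)
    ultimately show False using s by simp
  qed
  then show ?thesis using 1 2 by blast
qed

text \<open>A hyperplane that is not vertical is the graph of an affine function, obtained by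
  dividing by \<open>s\<close>.\<close>

lemma separation_minorant:
  fixes f :: "'a::euclidean_space \<Rightarrow> ereal"
  assumes f: "proper_convex_lsc f" and s: "s > 0" "a \<bullet> x + s * w < \<beta>"
    and E: "\<And>u t. f u \<le> ereal t \<Longrightarrow> \<beta> < a \<bullet> u + s * t"
  shows "\<exists>y b. affine_minorant f y b \<and> w < y \<bullet> x - b"
proof -
  have eq: "(- a /\<^sub>R s) \<bullet> u - (- \<beta> / s) = (\<beta> - a \<bullet> u) / s" for u
    by (simp add: divide_inverse right_diff_distrib mult.commute)
  have "ereal ((- a /\<^sub>R s) \<bullet> u - (- \<beta> / s)) \<le> f u" for u
  proof (cases "f u")
    case (real r)
    then have "\<beta> < a \<bullet> u + s * r" using E[of u r] by simp
    then have "(\<beta> - a \<bullet> u) / s \<le> r" using s(1) by (simp add: pos_divide_le_eq algebra_simps)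
    then show ?thesis using real eq by simp
  qed (use proper_convex_lsc_not_MInf[OF f] in auto)
  then have "affine_minorant f (- a /\<^sub>R s) (- \<beta> / s)" by (simp add: affine_minorant_def)
  moreover have "w < (- a /\<^sub>R s) \<bullet> x - (- \<beta> / s)"
    unfolding eq using s by (simp add: pos_less_divide_eq algebra_simps)
  ultimately show ?thesis by blast
qed

text \<open>Over a point of the domain the hyperplane cannot be vertical: with \<open>s = 0\<close>
  it would not separate \<open>(x, w)\<close> from the epigraph point
  \<open>(x, f x)\<close>.\<close>

lemma proper_convex_lsc_minorant_gt:
  fixes f :: "'a::euclidean_space \<Rightarrow> ereal"
  assumes f: "proper_convex_lsc f" and x: "ereal w < f x" "f x < \<infinity>"
  shows "\<exists>y b. affine_minorant f y b \<and> w < y \<bullet> x - b"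
proof -
  obtain a s \<beta> where s: "s \<ge> 0" "a \<bullet> x + s * w < \<beta>"
    and E: "\<And>u t. f u \<le> ereal t \<Longrightarrow> \<beta> < a \<bullet> u + s * t"
    using epigraph_separation[OF f x(1)] by blast
  obtain t where t: "f x = ereal t"
    using x(2) proper_convex_lsc_not_MInf[OF f, of x] by (cases "f x") auto
  have "s * w < s * t" using E[of x t] s(2) t by simp
  then have "s > 0" using s(1) by (cases "s = 0") auto
  then show ?thesis using separation_minorant[OF f _ s(2) E] by blast
qed

lemma proper_convex_lsc_has_minorant:
  fixes f :: "'a::euclidean_space \<Rightarrow> ereal"
  assumes "proper_convex_lsc f"
  obtains y b where "affine_minorant f y b"
proof -
  obtain x where x: "f x < \<infinity>" "f x > -\<infinity>"
    using assms by (auto simp: proper_convex_lsc_def proper_fun_def)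
  then have "ereal (real_of_ereal (f x) - 1) < f x" by (cases "f x") auto
  from proper_convex_lsc_minorant_gt[OF assms this x(1)] show thesis using that by blast
qed

text \<open>Fenchel--Moreau.\<close>

lemma le_iff_affine_minorants:
  fixes f :: "'a::euclidean_space \<Rightarrow> ereal"
  assumes f: "proper_convex_lsc f"
  shows "f x \<le> ereal w \<longleftrightarrow> (\<forall>y b. affine_minorant f y b \<longrightarrow> y \<bullet> x - b \<le> w)"
proof
  assume "f x \<le> ereal w"
  then show "\<forall>y b. affine_minorant f y b \<longrightarrow> y \<bullet> x - b \<le> w"
    unfolding affine_minorant_def by (metis ereal_less_eq(3) order_trans)
next
  assume M: "\<forall>y b. affine_minorant f y b \<longrightarrow> y \<bullet> x - b \<le> w"
  show "f x \<le> ereal w"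
  proof (rule ccontr)
    assume "\<not> f x \<le> ereal w"
    then have w: "ereal w < f x" by simp
    show False
    proof (cases "f x < \<infinity>")
      case True
      then show False using proper_convex_lsc_minorant_gt[OF f w] M by force
    next
      case False
      obtain a s \<beta> where s: "s \<ge> 0" "a \<bullet> x + s * w < \<beta>"
        and E: "\<And>u t. f u \<le> ereal t \<Longrightarrow> \<beta> < a \<bullet> u + s * t"
        using epigraph_separation[OF f w] by blast
      obtain y0 b0 where m0: "affine_minorant f y0 b0"
        using proper_convex_lsc_has_minorant[OF f] by blast
      note NM = proper_convex_lsc_not_MInf[OF f]
      show False
      proof (cases "s = 0")
        case True
        \<comment> \<open>Vertical hyperplane: \<open>\<beta> - a \<bullet> u\<close> is negative on
          the domain of \<open>f\<close> and positive at \<open>x\<close>. Adding multiples of it to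
          a fixed minorant keeps a minorant and makes the value at \<open>x\<close> arbitrarily
          large.\<close>
        have "affine_minorant f (y0 - k *\<^sub>R a) (b0 - k * \<beta>)" if "k \<ge> 0" for k
          unfolding affine_minorant_def
        proof
          fix u
          show "ereal ((y0 - k *\<^sub>R a) \<bullet> u - (b0 - k * \<beta>)) \<le> f u"
          proof (cases "f u")
            case (real r)
            have "\<beta> < a \<bullet> u" using E[of u r] real True by simp
            then have "k * (\<beta> - a \<bullet> u) \<le> 0" using that by (simp add: mult_nonneg_nonpos)
            moreover have "y0 \<bullet> u - b0 \<le> r"
              using m0 real unfolding affine_minorant_def by (metis ereal_less_eq(3))
            ultimately show ?thesis using real by (simp add: algebra_simps)
          qed (use NM in auto)
        qed
        then have K: "(y0 - k *\<^sub>R a) \<bullet> x - (b0 - k * \<beta>) \<le> w" if "k \<ge> 0" for k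
          using M that by blast
        define d where "d = \<beta> - a \<bullet> x"
        have d: "d > 0" using s True by (simp add: d_def)
        define k where "k = (\<bar>w - (y0 \<bullet> x - b0)\<bar> + 1) / d"
        have "k \<ge> 0" using d by (simp add: k_def)
        from K[OF this] have "y0 \<bullet> x - b0 + k * d \<le> w" by (simp add: d_def algebra_simps)
        then show False using d by (simp add: k_def)
      next
        case False
        then have "s > 0" using s by simp
        then show False using separation_minorant[OF f _ s(2) E] M by force
      qed
    qed
  qed
qed

text \<open>One formula covers both branches of the definition. For \<open>r > 0\<close> it is
  Fenchel--Moreau scaled by \<open>r\<close>; for \<open>r = 0\<close> the slopes of minorants are
  exactly the domain of the conjugate and the offset \<open>b\<close> drops out.\<close>

lemma perspective_le_iff:
  fixes f :: "'a::euclidean_space \<Rightarrow> ereal"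
  assumes f: "proper_convex_lsc f" and r: "r \<ge> 0"
  shows "perspective f r x \<le> ereal w \<longleftrightarrow>
    (\<forall>y b. affine_minorant f y b \<longrightarrow> y \<bullet> x - r * b \<le> w)"
proof (cases "r > 0")
  case True
  have "ereal r * f (x /\<^sub>R r) \<le> ereal w \<longleftrightarrow> f (x /\<^sub>R r) \<le> ereal (w / r)"
    using True by (cases "f (x /\<^sub>R r)") (auto simp: field_simps)
  also have "\<dots> \<longleftrightarrow> (\<forall>y b. affine_minorant f y b \<longrightarrow> y \<bullet> (x /\<^sub>R r) - b \<le> w / r)"
    by (rule le_iff_affine_minorants[OF f])
  also have "\<dots> \<longleftrightarrow> (\<forall>y b. affine_minorant f y b \<longrightarrow> y \<bullet> x - r * b \<le> w)"
  proof -
    have "y \<bullet> (x /\<^sub>R r) - b \<le> w / r \<longleftrightarrow> y \<bullet> x - r * b \<le> w" for y b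
  proof -
    have "r * (y \<bullet> (x /\<^sub>R r) - b) = y \<bullet> x - r * b" "r * (w / r) = w"
      using True by (simp_all add: field_simps)
    then show ?thesis using mult_le_cancel_left_pos[OF True] by metis
    qed
    then show ?thesis by simp
  qed
  finally show ?thesis using True by (simp add: perspective_def)
next
  case False
  then have [simp]: "r = 0" using r by simp
  have "proper_fun f" using f by (simp add: proper_convex_lsc_def)
  from effective_dom_conjugate[OF this] show ?thesis
    by (auto simp: perspective_def SUP_le_iff inner_commute)
qed

lemma perspective_not_MInf:
  fixes f :: "'a::euclidean_space \<Rightarrow> ereal"
  assumes f: "proper_convex_lsc f" and r: "r \<ge> 0"
  shows "perspective f r x \<noteq> -\<infinity>"
proof
  assume A: "perspective f r x = -\<infinity>"
  obtain y b where m: "affine_minorant f y b" using proper_convex_lsc_has_minorant[OF f] .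
  have "perspective f r x \<le> ereal (y \<bullet> x - r * b - 1)" using A by simp
  then show False using perspective_le_iff[OF f r] m by force
qed

text \<open>For each minorant the test in \<open>perspective_le_iff\<close> is linear in
  \<open>(r, x, w)\<close>, so tests add up; together with \<open>perspective_scale_le\<close> this
  is joint sublinearity in \<open>(r, x)\<close>.\<close>

lemma perspective_add_le:
  fixes f :: "'a::euclidean_space \<Rightarrow> ereal"
  assumes f: "proper_convex_lsc f" and "r \<ge> 0" "s \<ge> 0"
    and "perspective f r x \<le> ereal a" "perspective f s y \<le> ereal b"
  shows "perspective f (r + s) (x + y) \<le> ereal (a + b)"
  using assms
  by (simp add: perspective_le_iff) (smt (verit) inner_add_right distrib_right)

lemma perspective_scale_le:
  fixes f :: "'a::euclidean_space \<Rightarrow> ereal"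
  assumes f: "proper_convex_lsc f" and r: "r \<ge> 0" and k: "k \<ge> 0"
    and le: "perspective f r x \<le> ereal a"
  shows "perspective f (k * r) (k *\<^sub>R x) \<le> ereal (k * a)"
proof -
  have kr: "k * r \<ge> 0" using r k by simp
  have "y \<bullet> (k *\<^sub>R x) - k * r * b \<le> k * a" if "affine_minorant f y b" for y b
  proof -
    have "y \<bullet> x - r * b \<le> a" using le that perspective_le_iff[OF f r] by blast
    then have "k * (y \<bullet> x - r * b) \<le> k * a" using k by (rule mult_left_mono)
    then show ?thesis by (simp add: algebra_simps)
  qed
  then show ?thesis unfolding perspective_le_iff[OF f kr] by blast
qed

lemma perspective_one:
  "perspective f 1 x = f x"
  by (simp add: perspective_def one_ereal_def[symmetric])

lemma perspective_zero_zero: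
  fixes f :: "'a::euclidean_space \<Rightarrow> ereal"
  assumes f: "proper_convex_lsc f"
  shows "perspective f 0 0 = 0"
proof -
  have "proper_fun f" using f by (simp add: proper_convex_lsc_def)
  obtain y b where "affine_minorant f y b" using proper_convex_lsc_has_minorant[OF f] .
  then have "effective_dom (conjugate f) \<noteq> {}"
    using effective_dom_conjugate[OF \<open>proper_fun f\<close>] by blast
  then show ?thesis by (simp add: perspective_def zero_ereal_def[symmetric])
qed

text \<open>The perspective at \<open>r = 0\<close> is the recession function: a multiple of it,
  added to the perspective at 1, bounds \<open>f\<close> along a ray.\<close>

lemma recession_le:
  fixes f :: "'a::euclidean_space \<Rightarrow> ereal"
  assumes f: "proper_convex_lsc f" and "f x \<le> ereal a" "perspective f 0 d \<le> ereal b" "s \<ge> 0"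
  shows "f (x + s *\<^sub>R d) \<le> ereal (a + s * b)"
proof -
  have "perspective f (s * 0) (s *\<^sub>R d) \<le> ereal (s * b)"
    using perspective_scale_le[OF f _ assms(4) assms(3)] by simp
  then have "perspective f (1 + 0) (x + s *\<^sub>R d) \<le> ereal (a + s * b)"
    using assms by (intro perspective_add_le) (auto simp: perspective_one)
  then show ?thesis by (simp add: perspective_one)
qed

lemma closed_perspective_le:
  fixes f :: "'a::euclidean_space \<Rightarrow> ereal"
  assumes f: "proper_convex_lsc f"
  shows "closed {(r, x). r \<ge> 0 \<and> perspective f r x \<le> ereal w}"
proof -
  have "{(r, x). r \<ge> 0 \<and> perspective f r x \<le> ereal w} =
    ({0..} \<times> UNIV) \<inter> (\<Inter>(y, b)\<in>{(y, b). affine_minorant f y b}. {(r, x). y \<bullet> x - r * b \<le> w})"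
    using perspective_le_iff[OF f] by auto
  moreover have "closed {(r::real, x). y \<bullet> x - r * b \<le> w}" for y :: 'a and b
    unfolding case_prod_beta by (intro closed_Collect_le continuous_intros)
  ultimately show ?thesis by (auto intro!: closed_Int closed_INT closed_Times)
qed

text \<open>For a conjugate the tests run over epigraph points of \<open>g\<close> instead of
  minorants. For \<open>r > 0\<close> this is the definition of the conjugate; for
  \<open>r = 0\<close> Fenchel--Moreau identifies the minorants of \<open>conjugate g\<close> with
  the epigraph points of \<open>g\<close>.\<close>

lemma perspective_conjugate_le_iff:
  fixes g :: "'a::euclidean_space \<Rightarrow> ereal"
  assumes g: "proper_convex_lsc g" and r: "r \<ge> 0"
  shows "perspective (conjugate g) r x \<le> ereal w \<longleftrightarrow>
    (\<forall>u t. g u \<le> ereal t \<longrightarrow> u \<bullet> x - r * t \<le> w)"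
proof (cases "r > 0")
  case True
  have "ereal r * conjugate g (x /\<^sub>R r) \<le> ereal w \<longleftrightarrow> conjugate g (x /\<^sub>R r) \<le> ereal (w / r)"
    using True by (cases "conjugate g (x /\<^sub>R r)") (auto simp: field_simps)
  also have "\<dots> \<longleftrightarrow> (\<forall>u. ereal ((x /\<^sub>R r) \<bullet> u - w / r) \<le> g u)"
    by (simp add: conjugate_le_iff affine_minorant_def)
  also have "\<dots> \<longleftrightarrow> (\<forall>u t. g u \<le> ereal t \<longrightarrow> (x /\<^sub>R r) \<bullet> u - w / r \<le> t)"
    by (subst ereal_le_iff_reals) blast
  also have "\<dots> \<longleftrightarrow> (\<forall>u t. g u \<le> ereal t \<longrightarrow> u \<bullet> x - r * t \<le> w)"
  proof -
    have "(x /\<^sub>R r) \<bullet> u - w / r \<le> t \<longleftrightarrow> u \<bullet> x - r * t \<le> w" for u t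
  proof -
    have "r * ((x /\<^sub>R r) \<bullet> u - w / r) = u \<bullet> x - w"
      using True by (simp add: field_simps inner_commute)
    then show ?thesis using mult_le_cancel_left_pos[OF True, of "(x /\<^sub>R r) \<bullet> u - w / r" t] by simp argo
    qed
    then show ?thesis by simp
  qed
  finally show ?thesis using True by (simp add: perspective_def)
next
  case False
  then have [simp]: "r = 0" using r by simp
  have "proper_fun g" using g by (simp add: proper_convex_lsc_def)
  have conj_gt: "conjugate g y \<noteq> -\<infinity>" for y
  proof -
    obtain x where x: "g x < \<infinity>" "g x > -\<infinity>" using \<open>proper_fun g\<close> by (auto simp: proper_fun_def)
    have "ereal (y \<bullet> x) - g x \<le> conjugate g y"
      unfolding conjugate_def by (rule SUP_upper) simp
    then show ?thesis using x by (cases "g x") auto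
  qed
  obtain y0 b0 where "affine_minorant g y0 b0" using proper_convex_lsc_has_minorant[OF g] .
  then have "conjugate g y0 \<le> ereal b0" by (simp add: conjugate_le_iff)
  then have "conjugate g y0 < \<infinity>" by (rule le_less_trans) simp
  then have pc: "proper_fun (conjugate g)"
    using conj_gt unfolding proper_fun_def by (metis MInfty_neq_PInfty(1) ereal_MInfty_lessI)
  have "affine_minorant (conjugate g) u t \<longleftrightarrow> g u \<le> ereal t" for u t
  proof -
    have "affine_minorant (conjugate g) u t \<longleftrightarrow> (\<forall>y b. conjugate g y \<le> ereal b \<longrightarrow> u \<bullet> y - t \<le> b)"
      unfolding affine_minorant_def by (subst ereal_le_iff_reals) blast
    also have "\<dots> \<longleftrightarrow> (\<forall>y b. affine_minorant g y b \<longrightarrow> y \<bullet> u - b \<le> t)"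
      unfolding conjugate_le_iff by (simp add: inner_commute algebra_simps)
    also have "\<dots> \<longleftrightarrow> g u \<le> ereal t" by (rule le_iff_affine_minorants[OF g, symmetric])
    finally show ?thesis .
  qed
  then have "u \<in> effective_dom (conjugate (conjugate g)) \<longleftrightarrow> (\<exists>t. g u \<le> ereal t)" for u
    by (simp add: effective_dom_conjugate[OF pc])
  then show ?thesis by (auto simp: perspective_def SUP_le_iff inner_commute)
qed

section \<open>A minimax theorem\<close>

text \<open>Separates \<open>A\<close> from the open negative quadrant. Unboundedness of the
  quadrant makes the normal nonnegative, its corner at 0 makes the level nonnegative, and the normal
  is finally scaled to total weight 1.\<close>

lemma two_alternative:
  fixes A :: "(real \<times> real) set"
  assumes "convex A" and no: "\<And>s t. (s, t) \<in> A \<Longrightarrow> s < 0 \<Longrightarrow> \<not> t < 0"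
  shows "\<exists>m n. 0 \<le> m \<and> 0 \<le> n \<and> m + n = 1 \<and> (\<forall>s t. (s, t) \<in> A \<longrightarrow> 0 \<le> m * s + n * t)"
proof (cases "A = {}")
  case True
  then show ?thesis by (intro exI[of _ 1] exI[of _ 0]) auto
next
  case False
  define B :: "(real \<times> real) set" where "B = {..<0} \<times> {..<0}"
  have "convex B" by (auto simp: B_def intro!: convex_Times)
  moreover have "(-1, -1) \<in> B" by (simp add: B_def)
  then have "B \<noteq> {}" by blast
  moreover have "B \<inter> A = {}" using no by (auto simp: B_def)
  ultimately obtain a \<beta> where a: "a \<noteq> 0" and B: "\<forall>x\<in>B. a \<bullet> x \<le> \<beta>" and A: "\<forall>x\<in>A. \<beta> \<le> a \<bullet> x"
    using separating_hyperplane_sets[of B A] \<open>convex A\<close> False by blast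
  obtain m n where [simp]: "a = (m, n)" by (cases a)
  have B': "m * s + n * t \<le> \<beta>" if "s < 0" "t < 0" for s t
    using B that by (auto simp: B_def)
  have bound: "0 \<le> k" if "\<And>s. s < 0 \<Longrightarrow> k * s + l \<le> \<beta>" for k l
  proof (rule ccontr)
    assume "\<not> 0 \<le> k"
    then have k: "k < 0" by simp
    define s where "s = (\<bar>\<beta> - l\<bar> + 1) / k"
    have "s < 0" using k by (simp add: s_def divide_pos_neg)
    from that[OF this] show False using k by (simp add: s_def)
  qed
  have m: "0 \<le> m" using bound[of m "n * - 1"] B'[of _ "-1"] by simp
  have n: "0 \<le> n" using bound[of n "m * - 1"] B'[of "-1"] by (simp add: add.commute)
  have "0 \<le> \<beta>"
  proof (rule ccontr)
    assume b: "\<not> 0 \<le> \<beta>"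
    \<comment> \<open>With this \<open>e\<close> the functional takes at \<open>(-e, -e)\<close> a
      value of at least \<open>\<beta> / 2\<close>, which exceeds a negative
      \<open>\<beta>\<close>.\<close>
    define e where "e = - \<beta> / (2 * (m + n + 1))"
    have "e > 0" using b m n by (simp add: e_def divide_neg_pos)
    then have "- ((m + n) * e) \<le> \<beta>" using B'[of "-e" "-e"] by (simp add: algebra_simps)
    moreover have "(m + n) * e \<le> (m + n + 1) * e" using \<open>e > 0\<close> by simp
    moreover have "(m + n + 1) * e = - \<beta> / 2" using m n by (simp add: e_def field_simps)
    ultimately show False using b by linarith
  qed
  have mn: "m + n > 0" using a m n by (auto simp: zero_prod_def less_le)
  show ?thesis
  proof (rule exI[of _ "m / (m + n)"], rule exI[of _ "n / (m + n)"], intro conjI allI impI)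
    show "0 \<le> m / (m + n) * s + n / (m + n) * t" if "(s, t) \<in> A" for s t
    proof -
      have "0 \<le> m * s + n * t" using A that \<open>0 \<le> \<beta>\<close> by fastforce
      then have "0 \<le> (m * s + n * t) / (m + n)" using mn by simp
      then show ?thesis by (simp add: add_divide_distrib)
    qed
  qed (use m n mn in \<open>simp_all add: add_divide_distrib[symmetric]\<close>)
qed

text \<open>The payoff is \<open>- G\<close>, which is concave-like in \<open>x\<close> and convex in \<open>t\<close>.\<close>

locale convex_game =
  fixes T :: "'t::real_vector set" and G :: "'t \<Rightarrow> 'x \<Rightarrow> ereal" and D :: "'x set"
  assumes T: "convex T"
    and not_MInf: "\<And>t x. t \<in> T \<Longrightarrow> x \<in> D \<Longrightarrow> G t x \<noteq> -\<infinity>"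
    and PInf: "\<And>s t x. s \<in> T \<Longrightarrow> t \<in> T \<Longrightarrow> x \<in> D \<Longrightarrow> G s x = \<infinity> \<Longrightarrow> G t x = \<infinity>"
    and concave: "\<And>s t x u v a b. s \<in> T \<Longrightarrow> t \<in> T \<Longrightarrow> x \<in> D \<Longrightarrow> 0 \<le> u \<Longrightarrow> 0 \<le> v \<Longrightarrow> u + v = 1 \<Longrightarrow>
      ereal a \<le> G s x \<Longrightarrow> ereal b \<le> G t x \<Longrightarrow> ereal (u * a + v * b) \<le> G (u *\<^sub>R s + v *\<^sub>R t) x"
    and convexlike: "\<And>x y u v. x \<in> D \<Longrightarrow> y \<in> D \<Longrightarrow> 0 \<le> u \<Longrightarrow> 0 \<le> v \<Longrightarrow> u + v = 1 \<Longrightarrow>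
      \<exists>z\<in>D. \<forall>t\<in>T. \<forall>a b. G t x \<le> ereal a \<longrightarrow> G t y \<le> ereal b \<longrightarrow> G t z \<le> ereal (u * a + v * b)"
begin

text \<open>The points on which one strategy \<open>t\<close> fails form a game again; this drives
  the induction over finitely many strategies.\<close>

lemma sublevel:
  assumes t: "t \<in> T"
  shows "convex_game T G {x\<in>D. G t x < ereal w}"
proof
  fix x y and u v :: real
  assume xy: "x \<in> {x\<in>D. G t x < ereal w}" "y \<in> {x\<in>D. G t x < ereal w}"
    and uv: "0 \<le> u" "0 \<le> v" "u + v = 1"
  obtain z where z: "z \<in> D" "\<forall>t\<in>T. \<forall>a b. G t x \<le> ereal a \<longrightarrow> G t y \<le> ereal b \<longrightarrow> G t z \<le> ereal (u * a + v * b)"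
    using convexlike[of x y u v] xy uv by auto
  obtain a b where ab: "G t x = ereal a" "G t y = ereal b" "a < w" "b < w"
    using xy not_MInf[OF t] by (cases "G t x"; cases "G t y") auto
  have "G t z \<le> ereal (u * a + v * b)" using z(2) ab t by simp
  also have "u * a + v * b < w" using uv ab convex_bound_lt by blast
  then have "ereal (u * a + v * b) < ereal w" by simp
  finally show "\<exists>z\<in>{x\<in>D. G t x < ereal w}. \<forall>t\<in>T. \<forall>a b. G t x \<le> ereal a \<longrightarrow> G t y \<le> ereal b \<longrightarrow>
      G t z \<le> ereal (u * a + v * b)"
    using z by blast
qed (rule T, erule not_MInf, simp, rule PInf, assumption+, simp, assumption, rule concave, simp_all)

text \<open>The pairs of real upper bounds for \<open>G s x - w\<close> and \<open>G t x - w\<close>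
  form a convex set that avoids the open negative quadrant. The separating weights \<open>m\<close>,
  \<open>n\<close> are the mixing weights of the two strategies, by concavity in
  \<open>t\<close>.\<close>

lemma two_point:
  assumes st: "s \<in> T" "t \<in> T"
    and cover: "\<And>x. x \<in> D \<Longrightarrow> ereal w \<le> G s x \<or> ereal w \<le> G t x"
  shows "\<exists>r\<in>T. \<forall>x\<in>D. ereal w \<le> G r x"
proof -
  define A where "A = {(a, b). \<exists>x\<in>D. G s x \<le> ereal (w + a) \<and> G t x \<le> ereal (w + b)}"
  have "convex A"
    unfolding convex_def
  proof (intro ballI allI impI)
    fix p q u v assume pq: "p \<in> A" "q \<in> A" and uv: "0 \<le> (u::real)" "0 \<le> v" "u + v = 1"
    obtain a b a' b' where [simp]: "p = (a, b)" "q = (a', b')" by (cases p, cases q)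
    obtain x y where x: "x \<in> D" "G s x \<le> ereal (w + a)" "G t x \<le> ereal (w + b)"
      and y: "y \<in> D" "G s y \<le> ereal (w + a')" "G t y \<le> ereal (w + b')"
      using pq by (auto simp: A_def)
    obtain z where z: "z \<in> D" "\<forall>t\<in>T. \<forall>a b. G t x \<le> ereal a \<longrightarrow> G t y \<le> ereal b \<longrightarrow> G t z \<le> ereal (u * a + v * b)"
      using convexlike[OF x(1) y(1) uv] by blast
    have eq: "u * (w + c) + v * (w + d) = w + (u * c + v * d)" for c d
    proof -
      have "u * (w + c) + v * (w + d) = (u + v) * w + (u * c + v * d)" by (simp add: algebra_simps)
      then show ?thesis using uv by simp
    qed
    have "G s z \<le> ereal (w + (u * a + v * a'))" "G t z \<le> ereal (w + (u * b + v * b'))"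
      using z(2)[rule_format, OF st(1) x(2) y(2)] z(2)[rule_format, OF st(2) x(3) y(3)]
      by (simp_all only: eq)
    then show "u *\<^sub>R p + v *\<^sub>R q \<in> A" using z(1) by (auto simp: A_def)
  qed
  moreover have "\<not> b < 0" if ab: "(a, b) \<in> A" "a < 0" for a b
  proof
    assume b: "b < 0"
    obtain x where x: "x \<in> D" "G s x \<le> ereal (w + a)" "G t x \<le> ereal (w + b)"
      using ab by (auto simp: A_def)
    have "G s x < ereal w" "G t x < ereal w"
      using x ab b by (auto intro: le_less_trans)
    then show False using cover[OF x(1)] leD by blast
  qed
  ultimately obtain m n where mn: "0 \<le> m" "0 \<le> n" "m + n = 1"
    and sep: "\<forall>a b. (a, b) \<in> A \<longrightarrow> 0 \<le> m * a + n * b"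
    using two_alternative[of A] by blast
  have "m *\<^sub>R s + n *\<^sub>R t \<in> T" using T st mn by (simp add: convexD)
  then show ?thesis
  proof (rule bexI[rotated], intro ballI)
    fix x assume x: "x \<in> D"
    show "ereal w \<le> G (m *\<^sub>R s + n *\<^sub>R t) x"
    proof (cases "G s x = \<infinity>")
      case True
      then have "G (m *\<^sub>R s + n *\<^sub>R t) x = \<infinity>"
        using PInf[OF st(1) \<open>m *\<^sub>R s + n *\<^sub>R t \<in> T\<close> x] by blast
      then show ?thesis by simp
    next
      case False
      then have "G t x \<noteq> \<infinity>" using PInf st x by blast
      then obtain a b where ab: "G s x = ereal a" "G t x = ereal b"
        using False not_MInf[OF st(1) x] not_MInf[OF st(2) x]
        by (cases "G s x"; cases "G t x") auto
      then have "(a - w, b - w) \<in> A" using x by (auto simp: A_def intro!: bexI[of _ x])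
      from sep[rule_format, OF this] have "(m + n) * w \<le> m * a + n * b" by (simp add: algebra_simps)
      then have "w \<le> m * a + n * b" using mn by simp
      then have "ereal w \<le> ereal (m * a + n * b)" by simp
      also have "\<dots> \<le> G (m *\<^sub>R s + n *\<^sub>R t) x"
        using concave[OF st x mn] ab by simp
      finally show ?thesis .
    qed
  qed
qed

end

text \<open>On the set where \<open>t\<close> fails, the induction hypothesis replaces the remaining
  strategies by a single \<open>r\<close>; only \<open>t\<close> and \<open>r\<close> are left to be
  merged.\<close>

lemma convex_game_finite:
  assumes "finite F" "F \<subseteq> T" "T \<noteq> {}" "convex_game T G D"
    and "\<And>x. x \<in> D \<Longrightarrow> \<exists>t\<in>F. ereal w \<le> G t x"
  shows "\<exists>r\<in>T. \<forall>x\<in>D. ereal w \<le> G r x"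
  using assms
proof (induction F arbitrary: D rule: finite_induct)
  case empty
  then show ?case by auto
next
  case (insert t F)
  interpret convex_game T G D by (rule insert.prems(3))
  have t: "t \<in> T" using insert by auto
  have "\<exists>r\<in>T. \<forall>x\<in>{x\<in>D. G t x < ereal w}. ereal w \<le> G r x"
  proof (rule insert.IH)
    show "convex_game T G {x \<in> D. G t x < ereal w}" using sublevel[OF t] .
    fix x assume "x \<in> {x \<in> D. G t x < ereal w}"
    then show "\<exists>t\<in>F. ereal w \<le> G t x" using insert.prems(4)[of x] by auto
  qed (use insert in auto)
  then obtain r where r: "r \<in> T" "\<forall>x\<in>D. G t x < ereal w \<longrightarrow> ereal w \<le> G r x" by auto
  have "ereal w \<le> G t x \<or> ereal w \<le> G r x" if "x \<in> D" for x
    using r(2) that by (cases "G t x < ereal w") auto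
  from two_point[OF t r(1) this] show ?case .
qed

text \<open>The closed sublevel sets at level \<open>w\<close> have no common point in the compact
  \<open>D\<close>, hence finitely many of them already have none. This reduces the claim to a
  finite set of strategies.\<close>

theorem minimax:
  fixes G :: "'t::real_vector \<Rightarrow> 'x::topological_space \<Rightarrow> ereal"
  assumes game: "convex_game T G D" and "T \<noteq> {}" and D: "compact D"
    and closed: "\<And>t w. t \<in> T \<Longrightarrow> closed {x\<in>D. G t x \<le> ereal w}"
    and lt: "\<And>x. x \<in> D \<Longrightarrow> \<exists>t\<in>T. ereal w < G t x"
  shows "\<exists>r\<in>T. \<forall>x\<in>D. ereal w \<le> G r x"
proof -
  define S where "S = (\<lambda>t. {x\<in>D. G t x \<le> ereal w})"
  have "D \<inter> (\<Inter>t\<in>T. S t) = {}"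
  proof (rule ccontr)
    assume "D \<inter> (\<Inter>t\<in>T. S t) \<noteq> {}"
    then obtain x where x: "x \<in> D" "\<forall>t\<in>T. G t x \<le> ereal w" by (auto simp: S_def)
    obtain t where "t \<in> T" "ereal w < G t x" using lt[OF x(1)] by blast
    then show False using x(2) leD by blast
  qed
  moreover have "closed (S t)" if "t \<in> T" for t unfolding S_def using that by (rule closed)
  ultimately obtain F where F: "finite F" "F \<subseteq> T" "D \<inter> (\<Inter>t\<in>F. S t) = {}"
    using compact_imp_fip_image[OF D, of T S] by blast
  show ?thesis
  proof (rule convex_game_finite[OF F(1,2) \<open>T \<noteq> {}\<close> game])
    fix x assume "x \<in> D"
    then obtain t where "t \<in> F" "\<not> G t x \<le> ereal w" using F(3) by (auto simp: S_def)
    then show "\<exists>t\<in>F. ereal w \<le> G t x" using linear by blast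
  qed
qed

section \<open>Lagrange multipliers and a sum rule\<close>

text \<open>For convex sets in Euclidean spaces these are the relative interior points.\<close>

definition relint_point :: "'a::real_vector set \<Rightarrow> 'a \<Rightarrow> bool" where
  "relint_point C x \<longleftrightarrow> x \<in> C \<and> (\<forall>y\<in>C. \<exists>e>0. x + e *\<^sub>R (x - y) \<in> C)"

lemma relint_point_shrink:
  assumes "convex C" "x \<in> C" "x + e *\<^sub>R d \<in> C" "0 < e" "0 \<le> k" "k \<le> e"
  shows "x + k *\<^sub>R d \<in> C"
proof -
  have "(1 - k / e) *\<^sub>R x + (k / e) *\<^sub>R (x + e *\<^sub>R d) \<in> C"
    using assms by (intro convexD) auto
  moreover have "(1 - k / e) *\<^sub>R x + (k / e) *\<^sub>R (x + e *\<^sub>R d) = x + k *\<^sub>R d"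
    using assms by (simp add: algebra_simps)
  ultimately show ?thesis by simp
qed

lemma relint_point_Int:
  assumes "convex C" "convex D" "relint_point C x" "relint_point D x"
  shows "relint_point (C \<inter> D) x"
  unfolding relint_point_def
proof (intro conjI ballI)
  show "x \<in> C \<inter> D" using assms by (auto simp: relint_point_def)
  fix y assume "y \<in> C \<inter> D"
  then obtain e e' where e: "e > 0" "x + e *\<^sub>R (x - y) \<in> C" "e' > 0" "x + e' *\<^sub>R (x - y) \<in> D"
    using assms unfolding relint_point_def by blast
  have "x + min e e' *\<^sub>R (x - y) \<in> C \<inter> D"
    using relint_point_shrink[OF assms(1) _ e(2,1), of "min e e'"]
      relint_point_shrink[OF assms(2) _ e(4,3), of "min e e'"] e assms
    by (auto simp: relint_point_def)
  then show "\<exists>e>0. x + e *\<^sub>R (x - y) \<in> C \<inter> D" using e by (intro exI[of _ "min e e'"]) auto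
qed

lemma relint_point_INT:
  assumes "finite S" "\<And>k. k \<in> S \<Longrightarrow> convex (C k) \<and> relint_point (C k) x"
  shows "relint_point (\<Inter>k\<in>S. C k) x"
  using assms
proof (induction S rule: finite_induct)
  case empty
  then show ?case by (auto simp: relint_point_def intro: exI[of _ 1])
next
  case (insert k S)
  then have "relint_point (C k \<inter> (\<Inter>k\<in>S. C k)) x"
    by (intro relint_point_Int convex_INT) auto
  then show ?case by simp
qed

lemma relint_point_rel_interior:
  fixes C :: "'a::euclidean_space set"
  assumes "convex C" "x \<in> rel_interior C"
  shows "relint_point C x"
  unfolding relint_point_def
proof (intro conjI ballI)
  show "x \<in> C" using assms rel_interior_subset by blast
  fix y assume "y \<in> C"
  then obtain e where "e > 1" "(1 - e) *\<^sub>R y + e *\<^sub>R x \<in> C"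
    using convex_rel_interior_iff[of C x] assms \<open>x \<in> C\<close> by blast
  then show "\<exists>e>0. x + e *\<^sub>R (x - y) \<in> C"
    by (intro exI[of _ "e - 1"]) (simp add: algebra_simps)
qed

text \<open>The weights may have any sign, so that values at reflected points are determined as
  well.\<close>

definition affine_fun :: "('a::real_vector \<Rightarrow> real) \<Rightarrow> bool" where
  "affine_fun a \<longleftrightarrow> (\<forall>x y u v. u + v = 1 \<longrightarrow> a (u *\<^sub>R x + v *\<^sub>R y) = u * a x + v * a y)"

lemma affine_funD: "affine_fun a \<Longrightarrow> u + v = 1 \<Longrightarrow> a (u *\<^sub>R x + v *\<^sub>R y) = u * a x + v * a y"
  by (simp add: affine_fun_def)

lemma affine_fun_reflect:
  assumes "affine_fun a"
  shows "a (x + e *\<^sub>R (x - y)) = a x + e * (a x - a y)"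
proof -
  have "a ((1 + e) *\<^sub>R x + (- e) *\<^sub>R y) = (1 + e) * a x + (- e) * a y"
    by (rule affine_funD[OF assms]) simp
  moreover have "(1 + e) *\<^sub>R x + (- e) *\<^sub>R y = x + e *\<^sub>R (x - y)" by (simp add: algebra_simps)
  ultimately show ?thesis by (simp add: algebra_simps)
qed

lemma affine_fun_convex_on: "affine_fun a \<Longrightarrow> convex C \<Longrightarrow> convex_on C a"
  by (auto simp: convex_on_def affine_fun_def)

lemma affine_fun_cmul: "affine_fun a \<Longrightarrow> affine_fun (\<lambda>x. k * a x)"
  by (simp add: affine_fun_def algebra_simps)

lemma affine_fun_sum: "(\<And>l. l \<in> S \<Longrightarrow> affine_fun (a l)) \<Longrightarrow> affine_fun (\<lambda>x. \<Sum>l\<in>S. a l x)"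
  by (simp add: affine_fun_def sum.distrib sum_distrib_left)

lemma convex_affine_zero: "affine_fun a \<Longrightarrow> convex {x. a x = 0}"
  by (auto simp: convex_def affine_fun_def)

lemma relint_point_affine_zero:
  "affine_fun a \<Longrightarrow> a x = 0 \<Longrightarrow> relint_point {x. a x = 0} x"
  by (auto simp: relint_point_def affine_fun_reflect intro: exI[of _ 1])

lemma convex_on_sublevel:
  assumes "convex_on C g"
  shows "convex {x \<in> C. g x \<le> w}"
  unfolding convex_def
proof (intro ballI allI impI)
  fix x y u v assume x: "x \<in> {x \<in> C. g x \<le> w}" "y \<in> {x \<in> C. g x \<le> w}"
    and uv: "0 \<le> (u::real)" "0 \<le> v" "u + v = 1"
  have "g (u *\<^sub>R x + v *\<^sub>R y) \<le> u * g x + v * g y"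
    using assms x uv by (auto simp: convex_on_def)
  also have "\<dots> \<le> w" using x uv convex_bound_le by blast
  finally show "u *\<^sub>R x + v *\<^sub>R y \<in> {x \<in> C. g x \<le> w}"
    using assms x uv by (auto simp: convex_on_def convexD)
qed

lemma convex_on_combination:
  assumes "convex_on C f" "\<And>l. l \<in> S \<Longrightarrow> convex_on C (g l) \<and> 0 \<le> k l"
  shows "convex_on C (\<lambda>x. f x + (\<Sum>l\<in>S. k l * g l x))"
proof -
  have C: "convex C" using assms(1) by (simp add: convex_on_def)
  have "convex_on C (\<lambda>x. \<Sum>l\<in>S. k l * g l x)"
  proof (cases "finite S")
    case True
    then show ?thesis using assms(2)
    proof (induction S rule: finite_induct)
      case (insert l S)
      then show ?case by (auto intro!: convex_on_add convex_on_cmul)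
    qed (use C in \<open>simp add: convex_on_def\<close>)
  qed (use C in \<open>simp add: convex_on_def\<close>)
  with assms(1) show ?thesis by (intro convex_on_add)
qed

text \<open>
  An equality constraint: the slopes of \<open>f\<close> between points with \<open>a < 0\<close> and points with \<open>a > 0\<close>
  leave room for a multiplier.
\<close>

lemma equality_multiplier:
  assumes f: "convex_on C f" and a: "affine_fun a" and s: "relint_point C s" "a s = 0"
    and lb: "\<And>x. x \<in> C \<Longrightarrow> a x = 0 \<Longrightarrow> v \<le> f x"
  shows "\<exists>m::real. \<forall>x\<in>C. v \<le> f x + m * a x"
proof (cases "\<forall>x\<in>C. a x = 0")
  case True
  then show ?thesis using lb by (intro exI[of _ 0]) auto
next
  case False
  have sC: "s \<in> C" using s by (simp add: relint_point_def)
  obtain y where y: "y \<in> C" "a y \<noteq> 0" using False by blast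
  \<comment> \<open>Reflecting \<open>y\<close> through \<open>s\<close> gives a point of
    \<open>C\<close> where \<open>a\<close> has the opposite sign, so both signs occur.\<close>
  obtain e where e: "e > 0" "s + e *\<^sub>R (s - y) \<in> C" using s(1) y(1) unfolding relint_point_def by blast
  have ae: "a (s + e *\<^sub>R (s - y)) = - e * a y" using affine_fun_reflect[OF a] s by simp
  have "(\<exists>x\<in>C. a x > 0) \<and> (\<exists>x\<in>C. a x < 0)"
  proof (cases "a y > 0")
    case True
    then have "- e * a y < 0" using e by simp
    then show ?thesis using True y e ae by metis
  next
    case False
    then have "a y < 0" using y by simp
    then have "- e * a y > 0" using e by (simp add: mult_pos_neg)
    then show ?thesis using \<open>a y < 0\<close> y e ae by metis
  qed
  then obtain x0 x1 where x0: "x0 \<in> C" "a x0 > 0" and x1: "x1 \<in> C" "a x1 < 0" by blast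
  have key: "(v - f x) / a x \<le> (f z - v) / (- a z)" if x: "x \<in> C" "a x > 0" and z: "z \<in> C" "a z < 0" for x z
  proof -
    \<comment> \<open>The segment from \<open>x\<close> to \<open>z\<close> meets the set
      \<open>a = 0\<close> at the weights \<open>u\<close> and \<open>w\<close> below; the bound
      \<open>lb\<close> at that point yields the comparison of slopes.\<close>
    define d where "d = a x - a z"
    have d: "d > 0" using x z by (simp add: d_def)
    define u where "u = - a z / d"
    define w where "w = a x / d"
    have uw: "u \<ge> 0" "w \<ge> 0" using d x z by (simp_all add: u_def w_def divide_nonpos_pos)
    have "u + w = (a x - a z) / d" unfolding u_def w_def by (simp add: diff_divide_distrib)
    then have uw1: "u + w = 1" using d by (simp add: d_def)
    have "a (u *\<^sub>R x + w *\<^sub>R z) = u * a x + w * a z" using affine_funD[OF a uw1] .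
    also have "\<dots> = 0" by (simp add: u_def w_def)
    finally have "v \<le> f (u *\<^sub>R x + w *\<^sub>R z)"
      using lb x z uw uw1 f by (auto simp: convex_on_def convexD)
    also have "\<dots> \<le> u * f x + w * f z" using f x z uw uw1 by (auto simp: convex_on_def)
    finally have "(u + w) * v \<le> u * f x + w * f z" using uw1 by simp
    then have "0 \<le> u * (f x - v) + w * (f z - v)" by (simp add: algebra_simps)
    then have "0 \<le> d * (u * (f x - v) + w * (f z - v))" using d by simp
    also have "\<dots> = (d * u) * (f x - v) + (d * w) * (f z - v)" by (simp add: algebra_simps)
    also have "d * u = - a z" using d by (simp add: u_def)
    also have "d * w = a x" using d by (simp add: w_def)
    finally have "(v - f x) * (- a z) \<le> (f z - v) * a x" by (simp add: algebra_simps)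
    moreover have "0 < - a z" using z by simp
    ultimately show ?thesis
      using x by (simp only: pos_divide_le_eq pos_le_divide_eq times_divide_eq_left)
  qed
  \<comment> \<open>Any number between the quotients over \<open>a > 0\<close> and those over
    \<open>a < 0\<close> is a multiplier; the supremum of the former is finite because
    \<open>x1\<close> bounds them.\<close>
  define m where "m = (SUP x\<in>{x\<in>C. a x > 0}. (v - f x) / a x)"
  have bdd: "bdd_above ((\<lambda>x. (v - f x) / a x) ` {x\<in>C. a x > 0})"
    using key x1 by (intro bdd_aboveI2[where M="(f x1 - v) / (- a x1)"]) auto
  show ?thesis
  proof (intro exI[of _ m] ballI)
    fix x assume x: "x \<in> C"
    consider "a x = 0" | "a x > 0" | "a x < 0" by linarith
    then show "v \<le> f x + m * a x"
    proof cases
      case 1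
      then show ?thesis using lb x by simp
    next
      case 2
      then have "(v - f x) / a x \<le> m" unfolding m_def using x by (intro cSUP_upper bdd) auto
      then show ?thesis using 2 by (simp add: pos_divide_le_eq)
    next
      case 3
      have "m \<le> (f x - v) / (- a x)"
        unfolding m_def using x0 key[OF _ _ x 3] by (intro cSUP_least) auto
      then show ?thesis using 3 by (simp add: field_simps)
    qed
  qed
qed

text \<open>Restricting \<open>C\<close> to one hyperplane through \<open>s\<close> keeps
  \<open>s\<close> relatively interior, so the other constraints are dualised there. The remaining
  constraint is then dualised on \<open>C\<close> with the resulting Lagrangian as
  objective.\<close>

lemma equality_multipliers:
  assumes "finite B" "convex_on C f" "relint_point C s"
    and "\<And>b. b \<in> B \<Longrightarrow> affine_fun (a b) \<and> a b s = 0"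
    and "\<And>x. x \<in> C \<Longrightarrow> \<forall>b\<in>B. a b x = 0 \<Longrightarrow> v \<le> f x"
  shows "\<exists>m::_ \<Rightarrow> real. \<forall>x\<in>C. v \<le> f x + (\<Sum>b\<in>B. m b * a b x)"
  using assms
proof (induction B arbitrary: C rule: finite_induct)
  case empty
  then show ?case by auto
next
  case (insert b B)
  define C' where "C' = C \<inter> {x. a b x = 0}"
  have ab: "affine_fun (a b)" "a b s = 0" using insert.prems(3) by auto
  have C: "convex C" using insert.prems by (simp add: convex_on_def)
  have "\<exists>m. \<forall>x\<in>C'. v \<le> f x + (\<Sum>b\<in>B. m b * a b x)"
  proof (rule insert.IH)
    show "convex_on C' f"
      by (rule convex_on_subset[OF insert.prems(1)]) (auto simp: C'_def C ab intro!: convex_Int convex_affine_zero)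
    show "relint_point C' s" unfolding C'_def
      by (intro relint_point_Int C convex_affine_zero relint_point_affine_zero ab insert.prems)
  qed (use insert.prems in \<open>auto simp: C'_def\<close>)
  then obtain m where m: "\<forall>x\<in>C'. v \<le> f x + (\<Sum>b\<in>B. m b * a b x)" by blast
  have aff: "affine_fun (\<lambda>x. \<Sum>b\<in>B. m b * a b x)"
    using insert.prems by (intro affine_fun_sum affine_fun_cmul) auto
  have "\<exists>k. \<forall>x\<in>C. v \<le> (f x + (\<Sum>b\<in>B. m b * a b x)) + k * a b x"
    using m by (intro equality_multiplier[OF _ ab(1) insert.prems(2) ab(2)] convex_on_add
        insert.prems affine_fun_convex_on aff C) (auto simp: C'_def)
  then obtain k where k: "\<forall>x\<in>C. v \<le> (f x + (\<Sum>b\<in>B. m b * a b x)) + k * a b x" by blast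
  have "(\<Sum>b'\<in>B. (m(b := k)) b' * a b' x) = (\<Sum>b'\<in>B. m b' * a b' x)" for x
    using insert.hyps by (intro sum.cong) auto
  then show ?case using k insert.hyps by (intro exI[of _ "m(b := k)"]) (auto simp: algebra_simps)
qed

text \<open>The upward closure of the joint range of \<open>f\<close> and \<open>g\<close> is
  convex, which reduces the claim to the alternative in the plane.\<close>

lemma convex_two_alternative:
  assumes f: "convex_on C f" and g: "convex_on C g" and no: "\<And>x. x \<in> C \<Longrightarrow> f x < 0 \<Longrightarrow> 0 \<le> g x"
  shows "\<exists>m n. 0 \<le> m \<and> 0 \<le> n \<and> m + n = 1 \<and> (\<forall>x\<in>C. 0 \<le> m * f x + n * g x)"
proof -
  define A where "A = {(p, q). \<exists>x\<in>C. f x \<le> p \<and> g x \<le> q}"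
  have "convex A"
    unfolding convex_def
  proof (intro ballI allI impI)
    fix p q u w assume pq: "p \<in> A" "q \<in> A" and uw: "0 \<le> (u::real)" "0 \<le> w" "u + w = 1"
    obtain a b a' b' where [simp]: "p = (a, b)" "q = (a', b')" by (cases p, cases q)
    obtain x y where x: "x \<in> C" "f x \<le> a" "g x \<le> b" and y: "y \<in> C" "f y \<le> a'" "g y \<le> b'"
      using pq by (auto simp: A_def)
    have bound: "h (u *\<^sub>R x + w *\<^sub>R y) \<le> u * c + w * d"
      if "convex_on C h" "h x \<le> c" "h y \<le> d" for h :: "'a \<Rightarrow> real" and c d
    proof -
      have "h (u *\<^sub>R x + w *\<^sub>R y) \<le> u * h x + w * h y" using that(1) x y uw by (auto simp: convex_on_def)
      also have "\<dots> \<le> u * c + w * d" using that uw by (intro add_mono mult_left_mono) auto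
      finally show ?thesis .
    qed
    have "u *\<^sub>R x + w *\<^sub>R y \<in> C" using f x y uw by (auto simp: convex_on_def convexD)
    then show "u *\<^sub>R p + w *\<^sub>R q \<in> A"
      using bound[OF f x(2) y(2)] bound[OF g x(3) y(3)] by (auto simp: A_def)
  qed
  moreover have "\<not> q < 0" if "(p, q) \<in> A" "p < 0" for p q
    using that no by (fastforce simp: A_def)
  ultimately obtain m n where mn: "0 \<le> m" "0 \<le> n" "m + n = 1"
    and sep: "\<forall>p q. (p, q) \<in> A \<longrightarrow> 0 \<le> m * p + n * q"
    using two_alternative[of A] by blast
  have "(f x, g x) \<in> A" if "x \<in> C" for x using that by (auto simp: A_def)
  then show ?thesis using mn sep by blast
qed

text \<open>The strict inequality at \<open>s\<close> rules out a zero weight on the objective, so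
  the alternative can be divided by that weight.\<close>

lemma strict_multiplier:
  assumes f: "convex_on C f" and g: "convex_on C g" and s: "s \<in> C" "g s < 0"
    and lb: "\<And>x. x \<in> C \<Longrightarrow> g x \<le> 0 \<Longrightarrow> v \<le> f x"
  shows "\<exists>m\<ge>0. \<forall>x\<in>C. v \<le> f x + m * g x"
proof -
  have "convex_on C (\<lambda>x. f x + - v)"
    by (intro convex_on_add f convex_on_const[THEN iffD2] convex_on_imp_convex[OF f])
  moreover have "0 \<le> f x + - v" if "x \<in> C" "g x < 0" for x using lb that by force
  ultimately obtain m n where mn: "0 \<le> m" "0 \<le> n" "m + n = 1"
    and sep: "\<forall>x\<in>C. 0 \<le> m * g x + n * (f x + - v)"
    using convex_two_alternative[OF g] by blast
  have "n \<noteq> 0"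
  proof
    assume "n = 0"
    then show False using sep s mn by fastforce
  qed
  then have n: "n > 0" using mn by simp
  show ?thesis
  proof (intro exI[of _ "m / n"] conjI ballI)
    fix x assume "x \<in> C"
    then have "0 \<le> m * g x + n * (f x + - v)" using sep by blast
    then show "v \<le> f x + m / n * g x" using n by (simp add: field_simps)
  qed (use mn n in simp)
qed

lemma strict_multipliers:
  assumes "finite S" "convex_on C f" "s \<in> C" "\<And>l. l \<in> S \<Longrightarrow> convex_on C (g l) \<and> g l s < 0"
    and "\<And>x. x \<in> C \<Longrightarrow> \<forall>l\<in>S. g l x \<le> 0 \<Longrightarrow> v \<le> f x"
  shows "\<exists>m::_ \<Rightarrow> real. (\<forall>l\<in>S. 0 \<le> m l) \<and> (\<forall>x\<in>C. v \<le> f x + (\<Sum>l\<in>S. m l * g l x))"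
  using assms
proof (induction S arbitrary: C rule: finite_induct)
  case empty
  then show ?case by auto
next
  case (insert l S)
  define C' where "C' = {x\<in>C. g l x \<le> 0}"
  have gl: "convex_on C (g l)" "g l s < 0" using insert.prems(3) by auto
  have C': "convex C'" unfolding C'_def by (rule convex_on_sublevel[OF gl(1)])
  have sub: "C' \<subseteq> C" by (auto simp: C'_def)
  have "\<exists>m. (\<forall>l\<in>S. 0 \<le> m l) \<and> (\<forall>x\<in>C'. v \<le> f x + (\<Sum>l\<in>S. m l * g l x))"
  proof (rule insert.IH)
    show "convex_on C' f" by (rule convex_on_subset[OF insert.prems(1) sub C'])
    show "convex_on C' (g k) \<and> g k s < 0" if "k \<in> S" for k
      using insert.prems(3)[of k] that convex_on_subset[OF _ sub C'] by auto
  qed (use insert.prems gl in \<open>auto simp: C'_def less_imp_le\<close>)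
  then obtain m where m0: "\<forall>l\<in>S. 0 \<le> m l" and m: "\<forall>x\<in>C'. v \<le> f x + (\<Sum>l\<in>S. m l * g l x)" by blast
  have "\<exists>k\<ge>0. \<forall>x\<in>C. v \<le> (f x + (\<Sum>l\<in>S. m l * g l x)) + k * g l x"
    using m m0 insert.prems
    by (intro strict_multiplier[OF _ gl(1) _ gl(2)] convex_on_combination) (auto simp: C'_def)
  then obtain k where k: "k \<ge> 0" "\<forall>x\<in>C. v \<le> (f x + (\<Sum>l\<in>S. m l * g l x)) + k * g l x" by blast
  have "(\<Sum>l'\<in>S. (m(l := k)) l' * g l' x) = (\<Sum>l'\<in>S. m l' * g l' x)" for x
    using insert.hyps by (intro sum.cong) auto
  then show ?case using k m0 insert.hyps by (intro exI[of _ "m(l := k)"]) (auto simp: algebra_simps)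
qed

text \<open>The induction hypothesis, applied where \<open>a l\<close> is negative, merges the other
  functions into one; the alternative for two functions finishes. Not all weights vanish: if
  \<open>l\<close> receives weight 0, then \<open>n = 1\<close> and a positive weight survives from
  the induction hypothesis.\<close>

lemma gordan:
  assumes "finite S" "S \<noteq> {}" "convex C" "\<And>l. l \<in> S \<Longrightarrow> affine_fun (a l)"
    and "\<And>x. x \<in> C \<Longrightarrow> \<exists>l\<in>S. 0 \<le> a l x"
  shows "\<exists>m::_ \<Rightarrow> real. (\<forall>l\<in>S. 0 \<le> m l) \<and> (\<exists>l\<in>S. 0 < m l) \<and> (\<forall>x\<in>C. 0 \<le> (\<Sum>l\<in>S. m l * a l x))"
  using assms
proof (induction S arbitrary: C rule: finite_ne_induct)
  case (singleton l)
  then show ?case by (intro exI[of _ "\<lambda>_. 1"]) auto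
next
  case (insert l S)
  define C' where "C' = {x\<in>C. a l x < 0}"
  have al: "affine_fun (a l)" using insert.prems by auto
  have "convex C'"
    unfolding convex_def C'_def
  proof (intro ballI allI impI)
    fix x y u v assume xy: "x \<in> {x\<in>C. a l x < 0}" "y \<in> {x\<in>C. a l x < 0}"
      and uv: "0 \<le> (u::real)" "0 \<le> v" "u + v = 1"
    have "u * a l x + v * a l y < 0" using convex_bound_lt xy uv by blast
    then show "u *\<^sub>R x + v *\<^sub>R y \<in> {x\<in>C. a l x < 0}"
      using affine_funD[OF al uv(3)] xy uv insert.prems(1) by (auto simp: convexD)
  qed
  then have "\<exists>m. (\<forall>l\<in>S. 0 \<le> m l) \<and> (\<exists>l\<in>S. 0 < m l) \<and> (\<forall>x\<in>C'. 0 \<le> (\<Sum>l\<in>S. m l * a l x))"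
  proof (rule insert.IH)
    fix x assume "x \<in> C'"
    then show "\<exists>l\<in>S. 0 \<le> a l x" using insert.prems(3)[of x] by (auto simp: C'_def)
  qed (use insert.prems in auto)
  then obtain m where m: "\<forall>l\<in>S. 0 \<le> m l" "\<exists>l\<in>S. 0 < m l" "\<forall>x\<in>C'. 0 \<le> (\<Sum>l\<in>S. m l * a l x)" by blast
  define b where "b = (\<lambda>x. \<Sum>l\<in>S. m l * a l x)"
  have b: "affine_fun b"
    unfolding b_def using insert.prems by (intro affine_fun_sum affine_fun_cmul) auto
  have "0 \<le> b x" if "x \<in> C" "a l x < 0" for x
    using that m(3) by (simp add: C'_def b_def)
  then obtain r n where rn: "0 \<le> r" "0 \<le> n" "r + n = 1"
    and sep: "\<forall>x\<in>C. 0 \<le> r * a l x + n * b x"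
    using convex_two_alternative[OF affine_fun_convex_on[OF al insert.prems(1)]
        affine_fun_convex_on[OF b insert.prems(1)]] by blast
  define k where "k = (\<lambda>i. if i = l then r else n * m i)"
  have "(\<Sum>i\<in>insert l S. k i * a i x) = r * a l x + n * b x" for x
  proof -
    have "(\<Sum>i\<in>S. k i * a i x) = (\<Sum>i\<in>S. n * (m i * a i x))"
      using insert.hyps by (intro sum.cong) (auto simp: k_def)
    then show ?thesis using insert.hyps by (simp add: k_def b_def sum_distrib_left)
  qed
  moreover have "\<exists>i\<in>insert l S. 0 < k i"
  proof (cases "r > 0")
    case True
    then show ?thesis by (auto simp: k_def)
  next
    case False
    then have "n > 0" using rn by simp
    moreover obtain i where "i \<in> S" "0 < m i" using m by blast
    ultimately show ?thesis using insert.hyps by (intro bexI[of _ i]) (auto simp: k_def)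
  qed
  ultimately show ?case using sep m(1) rn
    by (intro exI[of _ k]) (auto simp: k_def)
qed

text \<open>An affine function attaining its minimum over \<open>C\<close> at a relatively interior
  point is constant on \<open>C\<close>, since reflection through that point reverses the
  sign.\<close>

lemma affine_fun_zero_at_relint:
  assumes a: "affine_fun a" and s: "relint_point C s" "a s \<le> 0" and C: "\<And>x. x \<in> C \<Longrightarrow> 0 \<le> a x" and x: "x \<in> C"
  shows "a x = 0"
proof -
  have as: "a s = 0" using s C[of s] by (simp add: relint_point_def)
  obtain e where e: "e > 0" "s + e *\<^sub>R (s - x) \<in> C" using s(1) x unfolding relint_point_def by blast
  have "0 \<le> - e * a x" using C[OF e(2)] affine_fun_reflect[OF a] as by simp
  then have "a x \<le> 0" using e by (simp add: mult_le_0_iff)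
  then show ?thesis using C[OF x] by simp
qed

text \<open>
  Affine constraints need not be strict at \<open>s\<close>. If no point of \<open>C\<close> satisfies all of them
  strictly, then Gordan's alternative makes a positive combination of them vanish on \<open>C\<close>, so one
  of them may be treated as an equality whose multiplier can be made nonnegative afterwards.
\<close>

lemma affine_multipliers:
  assumes "finite S" "convex_on C f" "relint_point C s"
    and "\<And>l. l \<in> S \<Longrightarrow> affine_fun (a l) \<and> a l s \<le> 0"
    and "\<And>x. x \<in> C \<Longrightarrow> \<forall>l\<in>S. a l x \<le> 0 \<Longrightarrow> v \<le> f x"
  shows "\<exists>m::_ \<Rightarrow> real. (\<forall>l\<in>S. 0 \<le> m l) \<and> (\<forall>x\<in>C. v \<le> f x + (\<Sum>l\<in>S. m l * a l x))"
  using assms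
proof (induction S arbitrary: C rule: finite_psubset_induct)
  case (psubset S)
  have C: "convex C" using psubset.prems by (simp add: convex_on_def)
  show ?case
  proof (cases "\<exists>x\<in>C. \<forall>l\<in>S. a l x < 0")
    case True
    then obtain x where "x \<in> C" "\<forall>l\<in>S. a l x < 0" by blast
    then show ?thesis
      using psubset.prems affine_fun_convex_on[OF _ C]
      by (intro strict_multipliers[OF psubset.hyps psubset.prems(1), of x]) auto
  next
    case False
    have "S \<noteq> {}" using False psubset.prems(2) by (auto simp: relint_point_def)
    have "\<exists>m::_ \<Rightarrow> real. (\<forall>l\<in>S. 0 \<le> m l) \<and> (\<exists>l\<in>S. 0 < m l) \<and> (\<forall>x\<in>C. 0 \<le> (\<Sum>l\<in>S. m l * a l x))"
      using False psubset.prems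
      by (intro gordan[OF psubset.hyps \<open>S \<noteq> {}\<close> C]) (auto simp: not_less)
    then obtain n i where n: "\<forall>l\<in>S. 0 \<le> n l" "i \<in> S" "0 < n i"
      "\<forall>x\<in>C. 0 \<le> (\<Sum>l\<in>S. n l * a l x)" by blast
    have aff: "affine_fun (\<lambda>x. \<Sum>l\<in>S. n l * a l x)"
      using psubset.prems by (intro affine_fun_sum affine_fun_cmul) auto
    have s0: "(\<Sum>l\<in>S. n l * a l s) \<le> 0"
      using n(1) psubset.prems(3) by (intro sum_nonpos) (auto simp: mult_nonneg_nonpos)
    have zero: "(\<Sum>l\<in>S. n l * a l x) = 0" if "x \<in> C" for x
      using affine_fun_zero_at_relint[OF aff psubset.prems(2) s0] n(4) that by blast
    \<comment> \<open>The terms are nonpositive and their weighted sum vanishes on \<open>C\<close>,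
      so each term vanishes; \<open>n i > 0\<close> then forces \<open>a i x = 0\<close>.\<close>
    have ai0: "a i x = 0" if "x \<in> C" "\<forall>l\<in>S. a l x \<le> 0" for x
    proof -
      have "\<forall>l\<in>S. - (n l * a l x) = 0"
        using zero[OF that(1)] n(1) that(2) psubset.hyps
        by (subst sum_nonneg_eq_0_iff[symmetric]) (auto simp: sum_negf mult_nonneg_nonpos)
      then show ?thesis using n(2,3) by auto
    qed
    have ai: "affine_fun (a i)" "a i s = 0"
      using psubset.prems n ai0[of s] by (auto simp: relint_point_def)
    define C' where "C' = C \<inter> {x. a i x = 0}"
    have conv': "convex_on C' f"
      by (rule convex_on_subset[OF psubset.prems(1)]) (auto simp: C'_def C ai intro!: convex_Int convex_affine_zero)
    have ri': "relint_point C' s" unfolding C'_def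
      by (intro relint_point_Int C convex_affine_zero relint_point_affine_zero ai psubset.prems)
    have "\<exists>m. (\<forall>l\<in>S - {i}. 0 \<le> m l) \<and> (\<forall>x\<in>C'. v \<le> f x + (\<Sum>l\<in>S - {i}. m l * a l x))"
    proof (rule psubset.IH[OF _ conv' ri'])
      fix x assume x: "x \<in> C'" "\<forall>l\<in>S - {i}. a l x \<le> 0"
      then have "\<forall>l\<in>S. a l x \<le> 0" by (auto simp: C'_def)
      then show "v \<le> f x" using x psubset.prems by (auto simp: C'_def)
    qed (use n psubset.prems in auto)
    then obtain m where m: "\<forall>l\<in>S - {i}. 0 \<le> m l"
      "\<forall>x\<in>C'. v \<le> f x + (\<Sum>l\<in>S - {i}. m l * a l x)" by blast
    have aff': "affine_fun (\<lambda>x. \<Sum>l\<in>S - {i}. m l * a l x)"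
      using psubset.prems by (intro affine_fun_sum affine_fun_cmul) auto
    have "\<exists>k. \<forall>x\<in>C. v \<le> (f x + (\<Sum>l\<in>S - {i}. m l * a l x)) + k * a i x"
      using m by (intro equality_multiplier[OF _ ai(1) psubset.prems(2) ai(2)] convex_on_add
          psubset.prems affine_fun_convex_on aff' C) (auto simp: C'_def)
    then obtain k where k: "\<forall>x\<in>C. v \<le> (f x + (\<Sum>l\<in>S - {i}. m l * a l x)) + k * a i x" by blast
    \<comment> \<open>Adding \<open>K\<close> times the combination that vanishes on
      \<open>C\<close> leaves the Lagrangian unchanged and lifts the free multiplier
      \<open>k\<close> to a nonnegative one.\<close>
    define K where "K = \<bar>k\<bar> / n i"
    have K: "K \<ge> 0" "k + K * n i \<ge> 0" using n(3) by (auto simp: K_def)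
    define m' where "m' = (\<lambda>l. (if l = i then k else m l) + K * n l)"
    have m'0: "\<forall>l\<in>S. 0 \<le> m' l" using m(1) K n(1) by (auto simp: m'_def)
    have "(\<Sum>l\<in>S. m' l * a l x) = (\<Sum>l\<in>S - {i}. m l * a l x) + k * a i x" if "x \<in> C" for x
    proof -
      have "(\<Sum>l\<in>S. m' l * a l x) = (\<Sum>l\<in>S. (if l = i then k else m l) * a l x) + K * (\<Sum>l\<in>S. n l * a l x)"
        by (simp add: m'_def algebra_simps sum.distrib sum_distrib_left)
      also have "\<dots> = (\<Sum>l\<in>S. (if l = i then k else m l) * a l x)" using zero[OF that] by simp
      also have "\<dots> = k * a i x + (\<Sum>l\<in>S - {i}. (if l = i then k else m l) * a l x)"
        using n(2) psubset.hyps by (simp add: sum.remove)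
      also have "(\<Sum>l\<in>S - {i}. (if l = i then k else m l) * a l x) = (\<Sum>l\<in>S - {i}. m l * a l x)"
        by (intro sum.cong) auto
      finally show ?thesis by simp
    qed
    then show ?thesis using m'0 k by (intro exI[of _ m']) (auto simp: algebra_simps)
  qed
qed

text \<open>The order matters. The constraints strict at \<open>s\<close> are dualised on the part
  of \<open>C\<close> cut out by the affine ones, which still contains \<open>s\<close>; the affine
  ones follow on all of \<open>C\<close>, where \<open>s\<close> is relatively interior.\<close>

lemma slater_multipliers:
  assumes fin: "finite N" "finite M" "N \<inter> M = {}" and f: "convex_on C f" and s: "relint_point C s"
    and N: "\<And>l. l \<in> N \<Longrightarrow> convex_on C (g l) \<and> g l s < 0"
    and M: "\<And>l. l \<in> M \<Longrightarrow> affine_fun (g l) \<and> g l s \<le> 0"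
    and lb: "\<And>x. x \<in> C \<Longrightarrow> \<forall>l\<in>N \<union> M. g l x \<le> 0 \<Longrightarrow> v \<le> f x"
  shows "\<exists>m::_ \<Rightarrow> real. (\<forall>l\<in>N \<union> M. 0 \<le> m l) \<and> (\<forall>x\<in>C. v \<le> f x + (\<Sum>l\<in>N \<union> M. m l * g l x))"
proof -
  have C: "convex C" using f by (simp add: convex_on_def)
  define C' where "C' = C \<inter> (\<Inter>l\<in>M. {x\<in>UNIV. g l x \<le> 0})"
  have C': "convex C'"
    unfolding C'_def using M
    by (intro convex_Int convex_INT C convex_on_sublevel affine_fun_convex_on) auto
  have sub: "C' \<subseteq> C" by (auto simp: C'_def)
  have "\<exists>m. (\<forall>l\<in>N. 0 \<le> m l) \<and> (\<forall>x\<in>C'. v \<le> f x + (\<Sum>l\<in>N. m l * g l x))"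
  proof (rule strict_multipliers[OF fin(1), of _ _ s])
    show "convex_on C' f" by (rule convex_on_subset[OF f sub C'])
    show "convex_on C' (g k) \<and> g k s < 0" if "k \<in> N" for k
      using N[OF that] convex_on_subset[OF _ sub C'] by auto
    show "s \<in> C'" using s M by (auto simp: C'_def relint_point_def)
    show "v \<le> f x" if "x \<in> C'" "\<forall>l\<in>N. g l x \<le> 0" for x
      using lb[of x] that by (auto simp: C'_def)
  qed
  then obtain m where m: "\<forall>l\<in>N. 0 \<le> m l" "\<forall>x\<in>C'. v \<le> f x + (\<Sum>l\<in>N. m l * g l x)" by blast
  have "\<exists>k. (\<forall>l\<in>M. 0 \<le> k l) \<and>
      (\<forall>x\<in>C. v \<le> (f x + (\<Sum>l\<in>N. m l * g l x)) + (\<Sum>l\<in>M. k l * g l x))"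
    using m N M s by (intro affine_multipliers[OF fin(2), of _ _ s] convex_on_combination[OF f])
      (auto simp: C'_def)
  then obtain k where k: "\<forall>l\<in>M. 0 \<le> k l"
    "\<forall>x\<in>C. v \<le> (f x + (\<Sum>l\<in>N. m l * g l x)) + (\<Sum>l\<in>M. k l * g l x)" by blast
  define r where "r = (\<lambda>l. if l \<in> N then m l else k l)"
  have "(\<Sum>l\<in>N \<union> M. r l * g l x) = (\<Sum>l\<in>N. m l * g l x) + (\<Sum>l\<in>M. k l * g l x)" for x
  proof -
    have "(\<Sum>l\<in>N \<union> M. r l * g l x) = (\<Sum>l\<in>N. r l * g l x) + (\<Sum>l\<in>M. r l * g l x)"
      by (rule sum.union_disjoint) (use fin in auto)
    moreover have "(\<Sum>l\<in>N. r l * g l x) = (\<Sum>l\<in>N. m l * g l x)" by (simp add: r_def)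
    moreover have "(\<Sum>l\<in>M. r l * g l x) = (\<Sum>l\<in>M. k l * g l x)"
      using fin(3) by (intro sum.cong) (auto simp: r_def)
    ultimately show ?thesis by simp
  qed
  then show ?thesis using k m by (intro exI[of _ r]) (auto simp: r_def algebra_simps)
qed

text \<open>
  Decoupling the two summands to independent arguments \<open>x\<close> and \<open>y\<close>, the equality constraints
  \<open>x = y\<close> have multipliers, which are the slope of the separating affine function.
\<close>

lemma convex_sum_decompose:
  fixes f :: "'a::euclidean_space \<Rightarrow> real"
  assumes f: "convex_on C f" and g: "convex_on D g" and s: "relint_point C s" "relint_point D s"
    and lb: "\<And>x. x \<in> C \<inter> D \<Longrightarrow> v + w \<bullet> x \<le> f x + g x"
  shows "\<exists>y a. (\<forall>x\<in>C. y \<bullet> x + a \<le> f x) \<and> (\<forall>x\<in>D. (w - y) \<bullet> x + (v - a) \<le> g x)"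
proof -
  define F where "F = (\<lambda>(x, y). f x + g y - w \<bullet> y)"
  have "convex_on (C \<times> D) F"
    unfolding convex_on_def
  proof (intro conjI ballI allI impI)
    show "convex (C \<times> D)" using f g by (simp add: convex_on_def convex_Times)
    fix p q u t assume pq: "p \<in> C \<times> D" "q \<in> C \<times> D" and ut: "0 \<le> (u::real)" "0 \<le> t" "u + t = 1"
    obtain x y x' y' where [simp]: "p = (x, y)" "q = (x', y')" by (cases p, cases q)
    have "f (u *\<^sub>R x + t *\<^sub>R x') \<le> u * f x + t * f x'" "g (u *\<^sub>R y + t *\<^sub>R y') \<le> u * g y + t * g y'"
      using f g pq ut by (auto simp: convex_on_def)
    then show "F (u *\<^sub>R p + t *\<^sub>R q) \<le> u * F p + t * F q"
      by (simp add: F_def algebra_simps)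
  qed
  moreover have "relint_point (C \<times> D) (s, s)"
  proof -
    have conv: "convex C" "convex D" using f g by (auto simp: convex_on_def)
    have 1: "convex (C \<times> (UNIV :: 'a set))" "convex ((UNIV :: 'a set) \<times> D)"
      using conv by (auto intro: convex_Times)
    have "relint_point (C \<times> UNIV) (s, s)" "relint_point (UNIV \<times> D) (s, s)"
      using s by (auto simp: relint_point_def)
    from relint_point_Int[OF 1 this] show ?thesis by (simp add: Times_Int_Times)
  qed
  moreover have "affine_fun (\<lambda>(x, y). (x - y) \<bullet> b)" for b :: 'a
    by (auto simp: affine_fun_def algebra_simps)
  moreover have "v \<le> F p" if p: "p \<in> C \<times> D" "\<forall>b\<in>Basis. (\<lambda>(x, y). (x - y) \<bullet> b) p = 0" for p
  proof -
    obtain x y where [simp]: "p = (x, y)" by (cases p)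
    have "\<forall>b\<in>Basis. (x - y) \<bullet> b = 0" using p(2) by simp
    then have "x - y = 0" using euclidean_all_zero_iff by blast
    then have "x = y" by simp
    then show ?thesis using lb[of x] p by (simp add: F_def)
  qed
  ultimately have "\<exists>m::'a \<Rightarrow> real. \<forall>p\<in>C \<times> D. v \<le> F p + (\<Sum>b\<in>Basis. m b * (\<lambda>(x, y). (x - y) \<bullet> b) p)"
    by (intro equality_multipliers[of Basis _ _ "(s, s)"]) auto
  then obtain m :: "'a \<Rightarrow> real" where m: "\<forall>p\<in>C \<times> D. v \<le> F p + (\<Sum>b\<in>Basis. m b * (\<lambda>(x, y). (x - y) \<bullet> b) p)" by blast
  define n where "n = (\<Sum>b\<in>Basis. m b *\<^sub>R b)"
  have ineq: "v \<le> f x + g y - w \<bullet> y + n \<bullet> (x - y)" if "x \<in> C" "y \<in> D" for x y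
  proof -
    have "n \<bullet> (x - y) = (\<Sum>b\<in>Basis. m b * ((x - y) \<bullet> b))"
      unfolding n_def inner_sum_left by (simp add: inner_commute)
    then show ?thesis using m that by (auto simp: F_def)
  qed
  have sC: "s \<in> C" "s \<in> D" using s by (auto simp: relint_point_def)
  \<comment> \<open>The largest offset that fits under \<open>f\<close> with slope
    \<open>- n\<close>; \<open>ineq\<close> shows that the remainder \<open>v - a\<close> fits under
    \<open>g\<close>.\<close>
  define a where "a = (INF x\<in>C. f x + n \<bullet> x)"
  have bdd: "bdd_below ((\<lambda>x. f x + n \<bullet> x) ` C)"
    using ineq[OF _ sC(2)]
    by (intro bdd_belowI2[where m="v - g s + w \<bullet> s + n \<bullet> s"]) (force simp: inner_diff_right)
  show ?thesis
  proof (intro exI[of _ "- n"] exI[of _ a] conjI ballI)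
    fix x assume "x \<in> C"
    then have "a \<le> f x + n \<bullet> x" unfolding a_def by (intro cINF_lower bdd)
    then show "- n \<bullet> x + a \<le> f x" by simp
  next
    fix y assume y: "y \<in> D"
    have "v - (g y - w \<bullet> y - n \<bullet> y) \<le> a"
      unfolding a_def using sC ineq[OF _ y] by (intro cINF_greatest) (force simp: inner_diff_right)+
    then show "(w - - n) \<bullet> y + (v - a) \<le> g y" by (simp add: algebra_simps)
  qed
qed

text \<open>The total slope \<open>w\<close> is kept general for the induction: splitting off a
  summand with slope \<open>y\<close> leaves \<open>w - y\<close> for the others. The empty sum
  forces \<open>w = 0\<close>, as a nonconstant affine function is unbounded above.\<close>

lemma convex_sum_decompose_finite:
  fixes f :: "'k \<Rightarrow> 'a::euclidean_space \<Rightarrow> real"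
  assumes "finite S" "\<And>k. k \<in> S \<Longrightarrow> convex_on (C k) (f k) \<and> relint_point (C k) s"
    and "\<And>x. \<forall>k\<in>S. x \<in> C k \<Longrightarrow> v + w \<bullet> x \<le> (\<Sum>k\<in>S. f k x)"
  shows "\<exists>y a. (\<forall>k\<in>S. \<forall>x\<in>C k. y k \<bullet> x + a k \<le> f k x) \<and> (\<Sum>k\<in>S. y k) = w \<and> v \<le> (\<Sum>k\<in>S. a k)"
  using assms
proof (induction S arbitrary: v w rule: finite_induct)
  case empty
  have *: "v + w \<bullet> x \<le> 0" for x using empty(2)[of x] by simp
  have "w = 0"
  proof (rule ccontr)
    assume "w \<noteq> 0"
    then have "w \<bullet> w > 0" by simp
    then show False using *[of "((\<bar>v\<bar> + 1) / (w \<bullet> w)) *\<^sub>R w"] by simp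
  qed
  then show ?case using *[of 0] by simp
next
  case (insert k S)
  define D where "D = (\<Inter>i\<in>S. C i)"
  have conv: "convex (C i)" if "i \<in> insert k S" for i using insert.prems(1)[OF that] by (simp add: convex_on_def)
  have D: "convex D" unfolding D_def using conv by (intro convex_INT) auto
  have "convex_on D (\<lambda>x. 0 + (\<Sum>i\<in>S. 1 * f i x))"
    using insert.prems(1) D
    by (intro convex_on_combination) (auto simp: convex_on_def D_def)
  then have g: "convex_on D (\<lambda>x. \<Sum>i\<in>S. f i x)" by simp
  have "relint_point D s" unfolding D_def
    using conv insert by (intro relint_point_INT) auto
  moreover have "v + w \<bullet> x \<le> f k x + (\<Sum>i\<in>S. f i x)" if "x \<in> C k \<inter> D" for x
    using insert.prems(2)[of x] insert.hyps that by (auto simp: D_def)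
  ultimately obtain y a where ya: "\<forall>x\<in>C k. y \<bullet> x + a \<le> f k x"
    "\<forall>x\<in>D. (w - y) \<bullet> x + (v - a) \<le> (\<Sum>i\<in>S. f i x)"
    using convex_sum_decompose[of "C k" "f k" D "\<lambda>x. \<Sum>i\<in>S. f i x" s v w] insert.prems(1)[of k] g by auto
  have "\<exists>y' a'. (\<forall>i\<in>S. \<forall>x\<in>C i. y' i \<bullet> x + a' i \<le> f i x) \<and> (\<Sum>i\<in>S. y' i) = w - y \<and> v - a \<le> (\<Sum>i\<in>S. a' i)"
    using ya(2) insert.prems(1) by (intro insert.IH) (auto simp: D_def add.commute)
  then obtain y' a' where y': "\<forall>i\<in>S. \<forall>x\<in>C i. y' i \<bullet> x + a' i \<le> f i x"
    "(\<Sum>i\<in>S. y' i) = w - y" "v - a \<le> (\<Sum>i\<in>S. a' i)" by blast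
  have "(\<Sum>i\<in>S. (y'(k := y)) i) = w - y" "(\<Sum>i\<in>S. (a'(k := a)) i) = (\<Sum>i\<in>S. a' i)"
    using y' insert.hyps by (auto intro!: sum.cong simp: y'(2)[symmetric])
  then show ?case using y' ya insert.hyps
    by (intro exI[of _ "y'(k := y)"] exI[of _ "a'(k := a)"]) auto
qed

section \<open>Closed convex functions: translations and finite sums\<close>

lemma convex_funI:
  fixes f :: "'a::real_vector \<Rightarrow> ereal"
  assumes "\<And>x y a b u v. f x \<le> ereal a \<Longrightarrow> f y \<le> ereal b \<Longrightarrow> 0 \<le> u \<Longrightarrow> 0 \<le> v \<Longrightarrow> u + v = 1 \<Longrightarrow>
    f (u *\<^sub>R x + v *\<^sub>R y) \<le> ereal (u * a + v * b)"
  shows "convex_fun f"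
  unfolding convex_fun_def convex_def using assms by auto

lemma proper_convex_lsc_shift:
  fixes f :: "'a::real_normed_vector \<Rightarrow> ereal"
  assumes f: "proper_convex_lsc f"
  shows "proper_convex_lsc (\<lambda>x. f (a + x))"
  unfolding proper_convex_lsc_def
proof (intro conjI)
  obtain x where "f x < \<infinity>" using f by (auto simp: proper_convex_lsc_def proper_fun_def)
  then have "f (a + (x - a)) < \<infinity>" by simp
  then show "proper_fun (\<lambda>x. f (a + x))"
    using f unfolding proper_convex_lsc_def proper_fun_def by blast
  have cf: "convex_fun f" using f by (simp add: proper_convex_lsc_def)
  show "convex_fun (\<lambda>x. f (a + x))"
  proof (rule convex_funI)
    fix x y b c and u v :: real
    assume A: "f (a + x) \<le> ereal b" "f (a + y) \<le> ereal c" "0 \<le> u" "0 \<le> v" "u + v = 1"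
    have "u *\<^sub>R (a + x) + v *\<^sub>R (a + y) = (u + v) *\<^sub>R a + (u *\<^sub>R x + v *\<^sub>R y)"
      by (simp add: algebra_simps)
    then show "f (a + (u *\<^sub>R x + v *\<^sub>R y)) \<le> ereal (u * b + v * c)"
      using convex_fun_ineq[OF cf A] A by simp
  qed
  show "lsc_on UNIV (\<lambda>x. f (a + x))"
    unfolding lsc_on_UNIV_iff
  proof
    fix w
    have "closed {x. f x \<le> w}" using f by (simp add: proper_convex_lsc_def lsc_on_UNIV_iff)
    then have "closed ((\<lambda>x. a + x) -` {x. f x \<le> w})"
      by (intro closed_vimage continuous_intros)
    then show "closed {x. f (a + x) \<le> w}" by (simp add: vimage_def)
  qed
qed

lemma lsc_on_open:
  fixes f :: "'a::topological_space \<Rightarrow> 'b::complete_linorder"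
  assumes "lsc_on S f"
  shows "\<exists>U. open U \<and> {x\<in>S. w < f x} = S \<inter> U"
proof -
  have "\<exists>T. open T \<and> x \<in> T \<and> (\<forall>y\<in>T \<inter> S. w < f y)" if "x \<in> S" "w < f x" for x
  proof -
    have "f x \<le> Liminf (at x within S) f" using assms that by (simp add: lsc_on_def)
    then have "eventually (\<lambda>y. w < f y) (at x within S)" using that le_Liminf_iff by blast
    then obtain T where "open T" "x \<in> T" "\<forall>y\<in>T. y \<noteq> x \<longrightarrow> y \<in> S \<longrightarrow> w < f y"
      unfolding eventually_at_topological by blast
    then show ?thesis using that(2) by (intro exI[of _ T]) auto
  qed
  then obtain T where T: "\<And>x. x \<in> S \<Longrightarrow> w < f x \<Longrightarrow> open (T x) \<and> x \<in> T x \<and> (\<forall>y\<in>T x \<inter> S. w < f y)"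
    by metis
  show ?thesis
    using T by (intro exI[of _ "\<Union>x\<in>{x\<in>S. w < f x}. T x"]) auto
qed

section \<open>Finite sums of extended reals\<close>

lemma sum_ereal_not_MInf:
  fixes h :: "'s \<Rightarrow> ereal"
  assumes "\<And>s. s \<in> S \<Longrightarrow> h s \<noteq> -\<infinity>"
  shows "(\<Sum>s\<in>S. h s) \<noteq> -\<infinity>"
  using assms by (induction S rule: infinite_finite_induct) auto

text \<open>A strict real lower bound of a sum can be distributed over the summands even if some are
  infinite; an infinite summand absorbs whatever the others lack.\<close>

lemma sum_ereal_less_split:
  fixes h :: "'s \<Rightarrow> ereal"
  assumes "finite S" "\<And>s. s \<in> S \<Longrightarrow> h s \<noteq> -\<infinity>" "ereal w < (\<Sum>s\<in>S. h s)"
  shows "\<exists>t. (\<forall>s\<in>S. ereal (t s) < h s) \<and> w < (\<Sum>s\<in>S. t s)"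
  using assms
proof (induction S arbitrary: w rule: finite_induct)
  case empty
  then show ?case by auto
next
  case (insert k S)
  define R where "R = (\<Sum>s\<in>S. h s)"
  have R: "R \<noteq> -\<infinity>" unfolding R_def using insert by (intro sum_ereal_not_MInf) auto
  have lt: "ereal w < h k + R" using insert by (simp add: R_def)
  have "\<exists>w'. ereal w' < R \<and> ereal (w - w') < h k"
  proof (cases "h k")
    case (real a)
    then have "ereal (w - a) < R" using lt by (cases R) auto
    then obtain w' where "ereal (w - a) < ereal w'" "ereal w' < R" using ereal_dense2 by blast
    then show ?thesis using real by (intro exI[of _ w']) auto
  next
    case PInf
    obtain w' where "ereal w' < R"
    proof (cases R)
      case (real r)
      then show ?thesis using that[of "r - 1"] by simp
    qed (use R that[of 0] in auto)
    then show ?thesis using PInf by auto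
  qed (use insert in auto)
  then obtain w' where w': "ereal w' < R" "ereal (w - w') < h k" by blast
  have "\<exists>t. (\<forall>s\<in>S. ereal (t s) < h s) \<and> w' < (\<Sum>s\<in>S. t s)"
    using insert w' by (intro insert.IH) (auto simp: R_def)
  then obtain t where t: "\<forall>s\<in>S. ereal (t s) < h s" "w' < (\<Sum>s\<in>S. t s)" by blast
  define t' where "t' = t(k := w - w')"
  have "(\<Sum>s\<in>S. t' s) = (\<Sum>s\<in>S. t s)"
    using insert.hyps by (intro sum.cong) (auto simp: t'_def)
  then have "w < (\<Sum>s\<in>insert k S. t' s)" using t insert.hyps by (simp add: t'_def)
  moreover have "\<forall>s\<in>insert k S. ereal (t' s) < h s" using t w' insert.hyps by (auto simp: t'_def)
  ultimately show ?case by blast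
qed

lemma sum_ereal_le_split:
  fixes h :: "'s \<Rightarrow> ereal"
  assumes "finite S" "\<And>s. s \<in> S \<Longrightarrow> h s \<noteq> -\<infinity>" "(\<Sum>s\<in>S. h s) \<le> ereal w"
  shows "\<exists>t. (\<forall>s\<in>S. h s = ereal (t s)) \<and> (\<Sum>s\<in>S. t s) \<le> w"
proof -
  have "(\<Sum>s\<in>S. h s) \<noteq> \<infinity>" using assms(3) by auto
  then have "\<forall>s\<in>S. h s \<noteq> \<infinity>" using assms(1) by (auto simp: sum_Pinfty)
  then have eq: "\<forall>s\<in>S. h s = ereal (real_of_ereal (h s))"
    using assms(2) ereal_real' by (metis abs_ereal.elims ereal_infinity_cases ereal.distinct(1))
  then have "(\<Sum>s\<in>S. h s) = ereal (\<Sum>s\<in>S. real_of_ereal (h s))"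
    by (simp add: sum_ereal[symmetric] del: sum_ereal cong: sum.cong)
  then show ?thesis using eq assms(3) by (intro exI[of _ "\<lambda>s. real_of_ereal (h s)"]) auto
qed

lemma sum_ereal_mono_real:
  fixes h :: "'s \<Rightarrow> ereal"
  shows "(\<And>s. s \<in> S \<Longrightarrow> h s \<le> ereal (t s)) \<Longrightarrow> (\<Sum>s\<in>S. h s) \<le> ereal (\<Sum>s\<in>S. t s)"
    and "(\<And>s. s \<in> S \<Longrightarrow> ereal (t s) \<le> h s) \<Longrightarrow> ereal (\<Sum>s\<in>S. t s) \<le> (\<Sum>s\<in>S. h s)"
  unfolding sum_ereal[symmetric] by (rule sum_mono, simp)+

lemma closed_vimage_coordinate:
  fixes C :: "'b::topological_space set"
  assumes "closed C"
  shows "closed {x :: 's \<Rightarrow> 'b. x s \<in> C}"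
proof -
  have "continuous_on UNIV (\<lambda>x :: 's \<Rightarrow> 'b. x s)"
    by (rule continuous_on_product_coordinates)
  then have "closed ((\<lambda>x :: 's \<Rightarrow> 'b. x s) -` C)" using assms closed_vimage by blast
  then show ?thesis by (simp add: vimage_def)
qed

section \<open>Sums of perspectives and growth bounds\<close>

definition perspective_sum :: "'s set \<Rightarrow> ('s \<Rightarrow> 'a::real_inner \<Rightarrow> ereal) \<Rightarrow> ('s \<Rightarrow> real \<times> 'a) \<Rightarrow> ereal" where
  "perspective_sum S F x = (\<Sum>s\<in>S. perspective (F s) (fst (x s)) (snd (x s)))"

lemma perspective_sum_not_MInf:
  fixes F :: "'s \<Rightarrow> 'a::euclidean_space \<Rightarrow> ereal"
  assumes "\<And>s. s \<in> S \<Longrightarrow> proper_convex_lsc (F s) \<and> 0 \<le> fst (x s)"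
  shows "perspective_sum S F x \<noteq> -\<infinity>"
  unfolding perspective_sum_def using assms by (intro sum_ereal_not_MInf) (simp add: perspective_not_MInf)

lemma perspective_sum_convex:
  fixes F :: "'s \<Rightarrow> 'a::euclidean_space \<Rightarrow> ereal"
  assumes S: "finite S" and F: "\<And>s. s \<in> S \<Longrightarrow> proper_convex_lsc (F s)"
    and nonneg: "\<And>s. s \<in> S \<Longrightarrow> 0 \<le> fst (x s) \<and> 0 \<le> fst (y s)" and uv: "0 \<le> u" "0 \<le> v"
    and le: "perspective_sum S F x \<le> ereal a" "perspective_sum S F y \<le> ereal b"
  shows "perspective_sum S F (\<lambda>s. u *\<^sub>R x s + v *\<^sub>R y s) \<le> ereal (u * a + v * b)"
proof -
  have "\<exists>t. (\<forall>s\<in>S. perspective (F s) (fst (x s)) (snd (x s)) = ereal (t s)) \<and> (\<Sum>s\<in>S. t s) \<le> a"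
    using le(1) F nonneg unfolding perspective_sum_def
    by (intro sum_ereal_le_split S) (auto simp: perspective_not_MInf)
  then obtain t where t: "\<forall>s\<in>S. perspective (F s) (fst (x s)) (snd (x s)) = ereal (t s)" "(\<Sum>s\<in>S. t s) \<le> a" by blast
  have "\<exists>t. (\<forall>s\<in>S. perspective (F s) (fst (y s)) (snd (y s)) = ereal (t s)) \<and> (\<Sum>s\<in>S. t s) \<le> b"
    using le(2) F nonneg unfolding perspective_sum_def
    by (intro sum_ereal_le_split S) (auto simp: perspective_not_MInf)
  then obtain t' where t': "\<forall>s\<in>S. perspective (F s) (fst (y s)) (snd (y s)) = ereal (t' s)" "(\<Sum>s\<in>S. t' s) \<le> b" by blast
  have "perspective (F s) (u * fst (x s) + v * fst (y s)) (u *\<^sub>R snd (x s) + v *\<^sub>R snd (y s))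
      \<le> ereal (u * t s + v * t' s)" if "s \<in> S" for s
    using F[OF that] nonneg[OF that] uv t t' that
    by (intro perspective_add_le perspective_scale_le) auto
  then have "perspective_sum S F (\<lambda>s. u *\<^sub>R x s + v *\<^sub>R y s) \<le> ereal (\<Sum>s\<in>S. u * t s + v * t' s)"
    unfolding perspective_sum_def by (intro sum_ereal_mono_real) simp
  also have "(\<Sum>s\<in>S. u * t s + v * t' s) \<le> u * a + v * b"
    unfolding sum.distrib sum_distrib_left[symmetric] using t t' uv by (intro add_mono mult_left_mono)
  finally show ?thesis by simp
qed

text \<open>The sum is at most \<open>w\<close> iff for every real family \<open>t\<close> of total
  above \<open>w\<close> some summand is at most its \<open>t s\<close>. This writes the set as an
  intersection of finite unions of closed sets, without adding extended reals.\<close>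

lemma closed_perspective_sum_le:
  fixes F :: "'s \<Rightarrow> 'a::euclidean_space \<Rightarrow> ereal"
  assumes S: "finite S" and F: "\<And>s. s \<in> S \<Longrightarrow> proper_convex_lsc (F s)"
  shows "closed {x. (\<forall>s\<in>S. 0 \<le> fst (x s)) \<and> perspective_sum S F x \<le> ereal w}"
proof -
  define A where "A = (\<lambda>s t. {x :: 's \<Rightarrow> real \<times> 'a. x s \<in> {(r, y). r \<ge> 0 \<and> perspective (F s) r y \<le> ereal t}})"
  have A: "closed (A s t)" if "s \<in> S" for s t
    unfolding A_def by (intro closed_vimage_coordinate closed_perspective_le F that)
  have nn: "closed {x :: 's \<Rightarrow> real \<times> 'a. x s \<in> {0..} \<times> UNIV}" for s
    by (intro closed_vimage_coordinate closed_Times) auto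
  have "{x. (\<forall>s\<in>S. 0 \<le> fst (x s)) \<and> perspective_sum S F x \<le> ereal w} =
    (\<Inter>s\<in>S. {x. x s \<in> {0..} \<times> UNIV}) \<inter> (\<Inter>t\<in>{t. w < (\<Sum>s\<in>S. t s)}. \<Union>s\<in>S. A s (t s))"
    (is "?L = ?R")
  proof (intro set_eqI iffI)
    fix x assume x: "x \<in> ?L"
    have "\<exists>s\<in>S. x \<in> A s (t s)" if "w < (\<Sum>s\<in>S. t s)" for t
    proof (rule ccontr)
      assume neg: "\<not> ?thesis"
      have "ereal (\<Sum>s\<in>S. t s) \<le> perspective_sum S F x"
        unfolding perspective_sum_def
      proof (intro sum_ereal_mono_real)
        fix s assume "s \<in> S"
        then have "\<not> perspective (F s) (fst (x s)) (snd (x s)) \<le> ereal (t s)"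
          using neg x by (auto simp: A_def case_prod_beta)
        then show "ereal (t s) \<le> perspective (F s) (fst (x s)) (snd (x s))"
          using linear by blast
      qed
      also have "\<dots> \<le> ereal w" using x by simp
      finally show False using that by simp
    qed
    then show "x \<in> ?R" using x by (auto simp: mem_Times_iff)
  next
    fix x assume x: "x \<in> ?R"
    then have nonneg: "\<forall>s\<in>S. 0 \<le> fst (x s)" by (auto simp: mem_Times_iff)
    have "perspective_sum S F x \<le> ereal w"
    proof (rule ccontr)
      assume "\<not> ?thesis"
      then have "ereal w < (\<Sum>s\<in>S. perspective (F s) (fst (x s)) (snd (x s)))"
        by (simp add: perspective_sum_def)
      then have "\<exists>t. (\<forall>s\<in>S. ereal (t s) < perspective (F s) (fst (x s)) (snd (x s))) \<and> w < (\<Sum>s\<in>S. t s)"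
        using F nonneg by (intro sum_ereal_less_split S) (auto simp: perspective_not_MInf)
      then obtain t where t: "\<forall>s\<in>S. ereal (t s) < perspective (F s) (fst (x s)) (snd (x s))" "w < (\<Sum>s\<in>S. t s)" by blast
      then obtain s where "s \<in> S" "x \<in> A s (t s)" using x by blast
      then show False using t(1) by (auto simp: A_def case_prod_beta leD)
    qed
    then show "x \<in> ?L" using nonneg by simp
  qed
  moreover have "closed ?R"
    using A S by (intro closed_Int closed_INT closed_UN nn ballI) auto
  ultimately show ?thesis by simp
qed

text \<open>Compactness gives a uniform positive lower bound \<open>a\<close> on the unit sphere;
  convexity and \<open>h 0 = 0\<close> propagate it outwards along rays. The term \<open>- a\<close>
  makes the estimate trivial inside the unit ball.\<close>

lemma linear_growth:
  fixes h :: "'a::euclidean_space \<Rightarrow> ereal"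
  assumes h: "proper_convex_lsc h" and h0: "h 0 = 0" and pos: "\<And>x. x \<noteq> 0 \<Longrightarrow> 0 < h x"
  shows "\<exists>a>0. \<forall>x. ereal (a * norm x - a) \<le> h x"
proof -
  define B where "B = (\<lambda>n. {x. h x \<le> ereal (1 / real (Suc n))})"
  have clB: "closed (B n)" for n
    using h by (simp add: B_def proper_convex_lsc_def lsc_on_UNIV_iff)
  have "sphere 0 1 \<inter> (\<Inter>n. B n) = {}"
  proof (rule ccontr)
    assume "\<not> ?thesis"
    then obtain x where "x \<in> sphere 0 1 \<inter> (\<Inter>n. B n)" by blast
    then have x: "norm x = 1" "\<And>n. h x \<le> ereal (1 / real (Suc n))" by (auto simp: B_def)
    have "x \<noteq> 0" using x by auto
    have "h x \<le> ereal 0"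
    proof (rule ereal_le_epsilon2)
      fix e :: real assume "0 < e"
      then obtain n where "1 / real (Suc n) < e" using nat_approx_posE by metis
      then have "ereal (1 / real (Suc n)) \<le> ereal e" by simp
      then show "h x \<le> ereal 0 + ereal e" using order_trans[OF x(2)] by simp
    qed
    then show False using pos[OF \<open>x \<noteq> 0\<close>] by (simp add: zero_ereal_def leD)
  qed
  then obtain F where F: "finite F" "sphere 0 1 \<inter> (\<Inter>n\<in>F. B n) = {}"
    using compact_imp_fip_image[of "sphere (0::'a) 1" UNIV B] clB by auto
  define N where "N = Max (insert 0 F)"
  have "B N \<subseteq> B n" if "n \<in> F" for n
  proof -
    have "n \<le> N" unfolding N_def using F(1) that by (intro Max_ge) auto
    then have "ereal (1 / real (Suc N)) \<le> ereal (1 / real (Suc n))" by (simp add: frac_le)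
    then show ?thesis unfolding B_def using order_trans by blast
  qed
  then have N: "sphere 0 1 \<inter> B N = {}" using F(2) by blast
  define a where "a = 1 / real (Suc N)"
  have a: "a > 0" by (simp add: a_def)
  have nonneg: "0 \<le> h x" for x using h0 pos[of x] by (cases "x = 0") auto
  have "ereal (a * norm x - a) \<le> h x" for x
  proof (cases "norm x \<le> 1")
    case True
    then have "ereal (a * norm x - a) \<le> 0" using a by (simp add: mult_left_le zero_ereal_def)
    then show ?thesis using nonneg[of x] order_trans by blast
  next
    case False
    then have n: "norm x > 1" by simp
    show ?thesis
    proof (rule ccontr)
      assume "\<not> ?thesis"
      then have le: "h x \<le> ereal (a * norm x - a)" by simp
      have "h ((1 / norm x) *\<^sub>R x + (1 - 1 / norm x) *\<^sub>R 0) \<le>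
          ereal (1 / norm x * (a * norm x - a) + (1 - 1 / norm x) * 0)"
        using h n h0 by (intro convex_fun_ineq le) (auto simp: proper_convex_lsc_def zero_ereal_def divide_le_eq)
      also have "1 / norm x * (a * norm x - a) \<le> a" using less_trans[OF zero_less_one n] a by (simp add: pos_divide_le_eq)
      finally have "x /\<^sub>R norm x \<in> B N" by (simp add: B_def a_def divide_inverse)
      moreover have "x /\<^sub>R norm x \<in> sphere 0 1"
        using less_trans[OF zero_less_one n] by simp
      ultimately show False using N by blast
    qed
  qed
  then show ?thesis using a by blast
qed

text \<open>By Cauchy--Schwarz, slope \<open>a *\<^sub>R sgn x\<close> with offset \<open>a\<close>
  defines an affine minorant, and testing the perspective with it at \<open>x\<close> gives the
  claim.\<close>

lemma perspective_linear_growth: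
  fixes h :: "'a::euclidean_space \<Rightarrow> ereal"
  assumes h: "proper_convex_lsc h" and a: "a > 0" "\<And>x. ereal (a * norm x - a) \<le> h x"
    and r: "r \<ge> 0" and le: "perspective h r x \<le> ereal w"
  shows "a * norm x - a * r \<le> w"
proof -
  have "affine_minorant h (a *\<^sub>R sgn x) a"
    unfolding affine_minorant_def
  proof
    fix u
    have "sgn x \<bullet> u \<le> norm (sgn x) * norm u" by (rule norm_cauchy_schwarz)
    also have "\<dots> \<le> 1 * norm u" by (intro mult_right_mono) (auto simp: norm_sgn)
    finally have "(a *\<^sub>R sgn x) \<bullet> u - a \<le> a * norm u - a" using a by simp
    then have "ereal ((a *\<^sub>R sgn x) \<bullet> u - a) \<le> ereal (a * norm u - a)" by simp
    then show "ereal ((a *\<^sub>R sgn x) \<bullet> u - a) \<le> h u" using a(2) order_trans by blast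
  qed
  then have "(a *\<^sub>R sgn x) \<bullet> x - r * a \<le> w" using perspective_le_iff[OF h r] le by blast
  moreover have "sgn x \<bullet> x = norm x"
    by (cases "x = 0") (simp_all add: sgn_div_norm power2_norm_eq_inner[symmetric] power2_eq_square)
  ultimately show ?thesis by (simp add: mult.commute)
qed

text \<open>Tychonoff's theorem, transferred to the topology on the function type.\<close>

lemma compact_Pi_UNIV:
  fixes B :: "'s \<Rightarrow> 'b::topological_space set"
  assumes "\<And>s. compact (B s)"
  shows "compact {x. \<forall>s. x s \<in> B s}"
proof -
  have "compactin (product_topology (\<lambda>_::'s. euclidean :: 'b topology) UNIV) (PiE UNIV B)"
    using assms by (simp add: compactin_PiE)
  then have "compact (PiE UNIV B)" by (simp add: euclidean_product_topology)
  moreover have "PiE UNIV B = {x. \<forall>s. x s \<in> B s}" by (auto simp: PiE_def Pi_def extensional_def)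
  ultimately show ?thesis by simp
qed

lemma ereal_le_real_trans: "ereal a \<le> z \<Longrightarrow> z \<le> ereal b \<Longrightarrow> a \<le> b"
  by (drule (1) order_trans) simp

lemma le_of_affine_growth:
  fixes a b c d :: real
  assumes "\<And>t. t \<ge> 0 \<Longrightarrow> c + t * a \<le> d + t * b"
  shows "a \<le> b"
proof (rule ccontr)
  assume "\<not> a \<le> b"
  then have ab: "a - b > 0" by simp
  define t where "t = (\<bar>d - c\<bar> + 1) / (a - b)"
  have "t \<ge> 0" using ab by (simp add: t_def)
  from assms[OF this] have "t * (a - b) \<le> d - c" by (simp add: algebra_simps)
  then show False using ab by (simp add: t_def)
qed

lemma ereal_le_uminus_diff:
  "X \<le> ereal A \<Longrightarrow> Y \<le> ereal B \<Longrightarrow> ereal (- A - B) \<le> - X - Y"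
  by (cases X; cases Y) auto

section \<open>Integration\<close>

text \<open>Jensen's inequality, one minorant at a time: the pointwise inequality between
  \<open>y \<bullet> X p - b\<close> and \<open>\<phi> p\<close> is multiplied by the weight and
  integrated. Total weight 0 is covered, since \<open>perspective_le_iff\<close> includes
  \<open>r = 0\<close>.\<close>

lemma perspective_integral_le:
  fixes h :: "'a::euclidean_space \<Rightarrow> ereal" and X :: "'w \<Rightarrow> 'a"
  assumes h: "proper_convex_lsc h" and W: "integrable M W" "integrable M (\<lambda>p. W p *\<^sub>R X p)"
    and \<phi>: "integrable M (\<lambda>p. W p * \<phi> p)" and nonneg: "AE p in M. 0 \<le> W p"
    and le: "AE p in M. W p \<noteq> 0 \<longrightarrow> h (X p) \<le> ereal (\<phi> p)"
  shows "perspective h (\<integral>p. W p \<partial>M) (\<integral>p. W p *\<^sub>R X p \<partial>M) \<le> ereal (\<integral>p. W p * \<phi> p \<partial>M)"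
proof -
  have r: "0 \<le> (\<integral>p. W p \<partial>M)" using nonneg by (rule integral_nonneg_AE)
  have "y \<bullet> (\<integral>p. W p *\<^sub>R X p \<partial>M) - (\<integral>p. W p \<partial>M) * b \<le> (\<integral>p. W p * \<phi> p \<partial>M)"
    if m: "affine_minorant h y b" for y b
  proof -
    have "y \<bullet> (\<integral>p. W p *\<^sub>R X p \<partial>M) - (\<integral>p. W p \<partial>M) * b = (\<integral>p. y \<bullet> (W p *\<^sub>R X p) - W p * b \<partial>M)"
    proof -
      have "(\<integral>p. y \<bullet> (W p *\<^sub>R X p) \<partial>M) = y \<bullet> (\<integral>p. W p *\<^sub>R X p \<partial>M)"
        by (intro integral_inner_right W)
      moreover have "integrable M (\<lambda>p. y \<bullet> (W p *\<^sub>R X p))" by (intro integrable_inner_right W)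
      ultimately show ?thesis using W(1) by (subst Bochner_Integration.integral_diff) auto
    qed
    also have "\<dots> \<le> (\<integral>p. W p * \<phi> p \<partial>M)"
    proof (rule integral_mono_AE)
      have "integrable M (\<lambda>p. y \<bullet> (W p *\<^sub>R X p))" by (intro integrable_inner_right W)
      then show "integrable M (\<lambda>p. y \<bullet> (W p *\<^sub>R X p) - W p * b)"
        using W(1) by (intro Bochner_Integration.integrable_diff integrable_mult_left) auto
      show "AE p in M. y \<bullet> (W p *\<^sub>R X p) - W p * b \<le> W p * \<phi> p"
        using nonneg le
      proof eventually_elim
        case (elim p)
        show ?case
        proof (cases "W p = 0")
          case False
          then have "h (X p) \<le> ereal (\<phi> p)" using elim by simp
          moreover have "ereal (y \<bullet> X p - b) \<le> h (X p)" using m by (simp add: affine_minorant_def)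
          ultimately have "y \<bullet> X p - b \<le> \<phi> p" by (metis ereal_less_eq(3) order_trans)
          then have "W p * (y \<bullet> X p - b) \<le> W p * \<phi> p" using elim by (intro mult_left_mono) auto
          then show ?thesis by (simp add: algebra_simps)
        qed simp
      qed
    qed (rule \<phi>)
    finally show ?thesis .
  qed
  then show ?thesis unfolding perspective_le_iff[OF h r] by blast
qed

lemma e2ennreal_eq_real:
  "e2ennreal (ereal r) = ennreal r"
  by (simp add: ennreal.abs_eq e2ennreal_def ennreal_def)

lemma expect_eq_integral:
  assumes h: "integrable Q h" and f: "\<And>z. z \<in> space Q \<Longrightarrow> f z = ereal (h z)"
  shows "expect Q f = ereal (\<integral>z. h z \<partial>Q)"
proof -
  have 1: "(\<integral>\<^sup>+ z. e2ennreal (f z) \<partial>Q) = (\<integral>\<^sup>+ z. ennreal (h z) \<partial>Q)"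
    using f by (intro nn_integral_cong) (simp add: e2ennreal_eq_real)
  have 2: "(\<integral>\<^sup>+ z. e2ennreal (- f z) \<partial>Q) = (\<integral>\<^sup>+ z. ennreal (- h z) \<partial>Q)"
    using f by (intro nn_integral_cong) (simp add: e2ennreal_eq_real)
  have "(\<integral>\<^sup>+ z. ennreal (h z) \<partial>Q) < \<infinity>" "(\<integral>\<^sup>+ z. ennreal (- h z) \<partial>Q) < \<infinity>"
    using h unfolding real_integrable_def by (auto simp: top.not_eq_extremum)
  then have fin: "(\<integral>\<^sup>+ z. ennreal (h z) \<partial>Q) \<noteq> top" "(\<integral>\<^sup>+ z. ennreal (- h z) \<partial>Q) \<noteq> top" by auto
  have "ereal (enn2real a - enn2real b) = enn2ereal a - enn2ereal b" if "a \<noteq> top" "b \<noteq> top" for a b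
    using that by (cases a; cases b) (auto simp: enn2ereal_ennreal)
  then show ?thesis
    unfolding expect_def 1 2 real_lebesgue_integral_def[OF h] using fin by simp
qed

lemma integrable_of_expect:
  assumes h: "h \<in> borel_measurable Q" and f: "\<And>z. z \<in> space Q \<Longrightarrow> f z = ereal (h z)"
    and neg: "(\<integral>\<^sup>+ z. e2ennreal (- f z) \<partial>Q) < \<infinity>" and le: "expect Q f < \<infinity>"
  shows "integrable Q h"
proof -
  have 1: "(\<integral>\<^sup>+ z. e2ennreal (f z) \<partial>Q) = (\<integral>\<^sup>+ z. ennreal (h z) \<partial>Q)"
    using f by (intro nn_integral_cong) (simp add: e2ennreal_eq_real)
  have 2: "(\<integral>\<^sup>+ z. e2ennreal (- f z) \<partial>Q) = (\<integral>\<^sup>+ z. ennreal (- h z) \<partial>Q)"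
    using f by (intro nn_integral_cong) (simp add: e2ennreal_eq_real)
  have "(\<integral>\<^sup>+ z. ennreal (h z) \<partial>Q) \<noteq> top"
  proof
    assume top: "(\<integral>\<^sup>+ z. ennreal (h z) \<partial>Q) = top"
    have "enn2ereal (\<integral>\<^sup>+ z. e2ennreal (- f z) \<partial>Q) \<noteq> \<infinity>"
      using neg by (cases "\<integral>\<^sup>+ z. e2ennreal (- f z) \<partial>Q") (auto simp: enn2ereal_ennreal)
    moreover have "enn2ereal top = \<infinity>" by (simp add: top_ennreal.rep_eq top_ereal_def)
    ultimately have "expect Q f = \<infinity>" unfolding expect_def 1 top
      by (cases "enn2ereal (\<integral>\<^sup>+ z. e2ennreal (- f z) \<partial>Q)") auto
    then show False using le by simp
  qed
  then show ?thesis unfolding real_integrable_def using h neg unfolding 2 by auto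
qed

lemma expect_not_MInf:
  assumes "(\<integral>\<^sup>+ z. e2ennreal (- f z) \<partial>Q) < \<infinity>"
  shows "expect Q f \<noteq> -\<infinity>"
  using assms unfolding expect_def
  by (cases "\<integral>\<^sup>+ z. e2ennreal (- f z) \<partial>Q"; cases "\<integral>\<^sup>+ z. e2ennreal (f z) \<partial>Q")
    (auto simp: enn2ereal_ennreal)

text \<open>The positive parts may be infinite, whence the case distinction; finite negative parts
  keep every difference meaningful.\<close>

lemma mixture_difference_ge:
  fixes P1 P2 N1 N2 :: ennreal
  assumes u: "0 < u" "u < 1" and fin: "N1 < \<infinity>" "N2 < \<infinity>"
    and 1: "ereal r1 \<le> enn2ereal P1 - enn2ereal N1" and 2: "ereal r2 \<le> enn2ereal P2 - enn2ereal N2"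
  shows "ereal ((1 - u) * r1 + u * r2) \<le>
    enn2ereal (ennreal (1 - u) * P1 + ennreal u * P2) - enn2ereal (ennreal (1 - u) * N1 + ennreal u * N2)"
proof -
  obtain n1 n2 where n: "N1 = ennreal n1" "n1 \<ge> 0" "N2 = ennreal n2" "n2 \<ge> 0"
    using fin by (cases N1; cases N2) auto
  have N: "ennreal (1 - u) * N1 + ennreal u * N2 = ennreal ((1 - u) * n1 + u * n2)"
    using n u by (simp add: ennreal_mult[symmetric] ennreal_plus[symmetric] del: ennreal_plus)
  have nn: "0 \<le> (1 - u) * n1 + u * n2" using n u by simp
  show ?thesis
  proof (cases "P1 = top \<or> P2 = top")
    case True
    then have top: "ennreal (1 - u) * P1 + ennreal u * P2 = top"
      using u by (auto simp: ennreal_mult_top)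
    show ?thesis unfolding N top using nn by (simp add: enn2ereal_ennreal)
  next
    case False
    then obtain p1 p2 where p: "P1 = ennreal p1" "p1 \<ge> 0" "P2 = ennreal p2" "p2 \<ge> 0"
      by (cases P1; cases P2) auto
    have PP: "ennreal (1 - u) * P1 + ennreal u * P2 = ennreal ((1 - u) * p1 + u * p2)"
      using p u by (simp add: ennreal_mult[symmetric] ennreal_plus[symmetric] del: ennreal_plus)
    have pp: "0 \<le> (1 - u) * p1 + u * p2" using p u by simp
    have "r1 \<le> p1 - n1" "r2 \<le> p2 - n2" using 1 2 p n by (simp_all add: enn2ereal_ennreal)
    then have "(1 - u) * r1 + u * r2 \<le> (1 - u) * (p1 - n1) + u * (p2 - n2)"
      using u by (intro add_mono mult_left_mono) auto
    then show ?thesis unfolding N PP using nn pp by (simp add: enn2ereal_ennreal algebra_simps)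
  qed
qed

text \<open>The mixture is a Bernoulli choice between the two measures followed by sampling, so the
  integral formula for \<open>bind\<close> applies.\<close>

lemma prob_mixture:
  assumes A: "A \<in> space (prob_algebra N)" and B: "B \<in> space (prob_algebra N)" and u: "0 \<le> u" "u \<le> 1"
  shows "\<exists>M\<in>space (prob_algebra N). \<forall>f\<in>borel_measurable N.
    (\<integral>\<^sup>+ x. f x \<partial>M) = ennreal (1 - u) * (\<integral>\<^sup>+ x. f x \<partial>A) + ennreal u * (\<integral>\<^sup>+ x. f x \<partial>B)"
proof -
  define K where "K = (\<lambda>b. if b then B else A)"
  define T where "T = measure_pmf (bernoulli_pmf u)"
  have T: "T \<in> space (prob_algebra (count_space UNIV))"
    unfolding T_def space_prob_algebra by (simp add: measure_pmf.prob_space_axioms)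
  have K: "K \<in> count_space UNIV \<rightarrow>\<^sub>M prob_algebra N"
    using A B by (auto simp: K_def)
  have "(T \<bind> K) \<in> space (prob_algebra N)"
    using prob_space_bind'[OF T K] sets_bind'[OF T K] by (simp add: space_prob_algebra)
  moreover have "(\<integral>\<^sup>+ x. f x \<partial>(T \<bind> K)) = ennreal (1 - u) * (\<integral>\<^sup>+ x. f x \<partial>A) + ennreal u * (\<integral>\<^sup>+ x. f x \<partial>B)"
    if f: "f \<in> borel_measurable N" for f
  proof -
    have "K \<in> T \<rightarrow>\<^sub>M subprob_algebra N"
      using measurable_prob_algebraD[OF K] by (simp add: T_def)
    then have "(\<integral>\<^sup>+ x. f x \<partial>(T \<bind> K)) = (\<integral>\<^sup>+ b. \<integral>\<^sup>+ x. f x \<partial>K b \<partial>T)"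
      by (rule nn_integral_bind[OF f])
    also have "\<dots> = (\<integral>\<^sup>+ x. f x \<partial>K True) * u + (\<integral>\<^sup>+ x. f x \<partial>K False) * (1 - u)"
      unfolding T_def using u by (intro nn_integral_bernoulli_pmf) auto
    finally show ?thesis by (simp add: K_def mult.commute add.commute)
  qed
  ultimately show ?thesis by blast
qed

text \<open>Superlevel sets are relatively open in \<open>Z \<times> Z\<close>; second countability
  makes open subsets of the product measurable for the product sigma-algebra.\<close>

lemma lsc_borel_measurable:
  fixes c :: "'a::{second_countable_topology} \<Rightarrow> 'a \<Rightarrow> ennreal"
  assumes "lsc_on (Z \<times> Z) (\<lambda>(z, z'). c z z')"
  shows "(\<lambda>(z, z'). c z z') \<in> borel_measurable (borel_on Z \<Otimes>\<^sub>M borel_on Z)"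
proof (rule borel_measurableI_greater)
  fix w :: ennreal
  obtain U where U: "open U" "{p\<in>Z \<times> Z. w < (\<lambda>(z, z'). c z z') p} = (Z \<times> Z) \<inter> U"
    using lsc_on_open[OF assms] by blast
  have sp: "space (borel_on Z \<Otimes>\<^sub>M borel_on Z) = Z \<times> Z"
    by (simp add: space_pair_measure space_restrict_space)
  have 1: "(\<lambda>p. fst p) \<in> (borel_on Z \<Otimes>\<^sub>M borel_on Z) \<rightarrow>\<^sub>M borel" "(\<lambda>p. snd p) \<in> (borel_on Z \<Otimes>\<^sub>M borel_on Z) \<rightarrow>\<^sub>M borel"
    by (auto intro!: measurable_compose[OF measurable_fst] measurable_compose[OF measurable_snd] measurable_restrict_space1)
  have "(\<lambda>p. (fst p, snd p)) \<in> (borel_on Z \<Otimes>\<^sub>M borel_on Z) \<rightarrow>\<^sub>M borel"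
    using borel_measurable_Pair[OF 1] .
  then have "(\<lambda>p. (fst p, snd p)) -` U \<inter> space (borel_on Z \<Otimes>\<^sub>M borel_on Z) \<in> sets (borel_on Z \<Otimes>\<^sub>M borel_on Z)"
    using U(1) by (intro measurable_sets) auto
  moreover have "(\<lambda>p. (fst p, snd p)) -` U \<inter> space (borel_on Z \<Otimes>\<^sub>M borel_on Z) =
      {p\<in>space (borel_on Z \<Otimes>\<^sub>M borel_on Z). w < (\<lambda>(z, z'). c z z') p}"
    unfolding sp U(2) by auto
  ultimately show "{p\<in>space (borel_on Z \<Otimes>\<^sub>M borel_on Z). w < (\<lambda>(z, z'). c z z') p} \<in> sets (borel_on Z \<Otimes>\<^sub>M borel_on Z)"
    by simp
qed

text \<open>Compact sublevel sets bound \<open>A\<close> from below. Outside a ball that contains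
  the sublevel set one unit above \<open>A t0\<close>, convexity along segments from
  \<open>t0\<close> forces growth at a fixed linear rate.\<close>

lemma inf_compact_coercive:
  fixes A :: "'a::euclidean_space \<Rightarrow> ereal"
  assumes T: "convex T" and not_MInf: "\<And>t. t \<in> T \<Longrightarrow> A t \<noteq> -\<infinity>" and fin: "t0 \<in> T" "A t0 < \<infinity>"
    and comp: "\<And>a::real. compact {t\<in>T. A t \<le> ereal a}"
    and conv: "\<And>s t u v a b. s \<in> T \<Longrightarrow> t \<in> T \<Longrightarrow> 0 \<le> u \<Longrightarrow> 0 \<le> v \<Longrightarrow> u + v = 1 \<Longrightarrow>
      A s \<le> ereal a \<Longrightarrow> A t \<le> ereal b \<Longrightarrow> A (u *\<^sub>R s + v *\<^sub>R t) \<le> ereal (u * a + v * b)"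
  shows "\<exists>a>0. \<exists>b. \<forall>t\<in>T. ereal (a * norm t - b) \<le> A t"
proof -
  obtain a0 where a0: "A t0 = ereal a0" using fin not_MInf[OF fin(1)] by (cases "A t0") auto
  define S where "S = (\<lambda>w. {t\<in>T. A t \<le> ereal w})"
  have "\<exists>m. \<forall>t\<in>T. ereal m \<le> A t"
  proof (rule ccontr)
    assume "\<not> ?thesis"
    then have ne: "\<And>m. \<exists>t\<in>T. A t < ereal m" by (auto simp: not_le)
    \<comment> \<open>If \<open>A\<close> were unbounded below, its nested nonempty compact sublevel
      sets would share a point, where \<open>A\<close> would be -\<infinity>.\<close>
    have "S a0 \<inter> (\<Inter>w\<in>UNIV. S w) \<noteq> {}"
    proof (rule compact_imp_fip_image)
      show "compact (S a0)" unfolding S_def by (rule comp)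
      show "closed (S w)" for w unfolding S_def by (intro compact_imp_closed comp)
      fix I' :: "real set" assume I': "finite I'"
      obtain t where t: "t \<in> T" "A t < ereal (Min (insert a0 I'))" using ne by blast
      have "t \<in> S w" if "w \<in> insert a0 I'" for w
      proof -
        have "Min (insert a0 I') \<le> w" using I' that by (intro Min_le) auto
        then have "A t \<le> ereal w" using t(2) by (metis ereal_less_eq(3) less_imp_le order_trans)
        then show ?thesis using t(1) by (simp add: S_def)
      qed
      then show "S a0 \<inter> (\<Inter>w\<in>I'. S w) \<noteq> {}" by blast
    qed
    then obtain t where t: "t \<in> T" "\<And>w. A t \<le> ereal w" by (auto simp: S_def)
    then have "A t = -\<infinity>" by (intro ereal_bot) auto
    then show False using not_MInf t by blast
  qed
  then obtain m where m: "\<And>t. t \<in> T \<Longrightarrow> ereal m \<le> A t" by blast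
  obtain R where R: "\<And>t. t \<in> S (a0 + 1) \<Longrightarrow> norm (t - t0) \<le> R"
  proof -
    have "bounded (S (a0 + 1))" unfolding S_def by (intro compact_imp_bounded comp)
    then obtain B where "\<forall>t\<in>S (a0 + 1). norm t \<le> B" by (auto simp: bounded_iff)
    then have "norm (t - t0) \<le> B + norm t0" if "t \<in> S (a0 + 1)" for t
      using that norm_triangle_ineq4[of t t0] by fastforce
    then show thesis using that by blast
  qed
  \<comment> \<open>A radius strictly above the bound \<open>R\<close>, so that every point of
    \<open>T\<close> at distance \<open>r\<close> from \<open>t0\<close> has value above
    \<open>a0 + 1\<close>; the growth rate is then \<open>1 / r\<close>.\<close>
  define r where "r = \<bar>R\<bar> + 1"
  have r: "r > 0" by (simp add: r_def)
  have far: "ereal (a0 + norm (t - t0) / r) \<le> A t" if t: "t \<in> T" "norm (t - t0) \<ge> r" for t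
  proof (rule ccontr)
    assume neg: "\<not> ?thesis"
    define k where "k = r / norm (t - t0)"
    have n: "norm (t - t0) > 0" using t r by linarith
    have k: "0 < k" "k \<le> 1" using t r n by (auto simp: k_def)
    define s where "s = (1 - k) *\<^sub>R t0 + k *\<^sub>R t"
    have "s - t0 = k *\<^sub>R (t - t0)" by (simp add: s_def algebra_simps)
    then have "norm (s - t0) = r" using n r by (simp add: k_def)
    then have "s \<notin> S (a0 + 1)" using R[of s] by (auto simp: r_def)
    moreover have "s \<in> T" unfolding s_def using T fin t k by (intro convexD) auto
    ultimately have "ereal (a0 + 1) < A s" by (auto simp: S_def)
    also have "A s \<le> ereal ((1 - k) * a0 + k * (a0 + norm (t - t0) / r))"
      unfolding s_def using a0 neg t k fin by (intro conv) auto
    also have "(1 - k) * a0 + k * (a0 + norm (t - t0) / r) = a0 + k * (norm (t - t0) / r)"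
      by (simp add: algebra_simps)
    also have "k * (norm (t - t0) / r) = 1" using n r by (simp add: k_def)
    finally show False by simp
  qed
  define b where "b = \<bar>m\<bar> + \<bar>a0\<bar> + 1 + norm t0 / r"
  have "ereal (1 / r * norm t - b) \<le> A t" if t: "t \<in> T" for t
  proof -
    have "norm t \<le> norm (t - t0) + norm t0" using norm_triangle_ineq[of "t - t0" t0] by simp
    then have le: "norm t / r \<le> norm (t - t0) / r + norm t0 / r"
      using r by (simp add: add_divide_distrib[symmetric] divide_right_mono)
    show ?thesis
    proof (cases "norm (t - t0) \<ge> r")
      case True
      have "1 / r * norm t - b \<le> a0 + norm (t - t0) / r" using le by (simp add: b_def)
      then show ?thesis using far[OF t True] by (meson ereal_less_eq(3) order_trans)
    next
      case False
      then have "norm (t - t0) / r \<le> 1" using r by simp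
      then have "1 / r * norm t - b \<le> m" using le by (simp add: b_def)
      then show ?thesis using m[OF t] by (meson ereal_less_eq(3) order_trans)
    qed
  qed
  then show ?thesis using r by (intro exI[of _ "1 / r"]) auto
qed

section \<open>The finite program as a convex game\<close>

text \<open>Extending by \<infinity> preserves lower semicontinuity because \<open>Z\<close> is
  closed: a sublevel set at a finite nonnegative level is relatively closed in \<open>Z\<close>,
  hence closed.\<close>

lemma cost_section_proper_convex_lsc:
  assumes Z: "closed Z" and z': "z' \<in> Z" and zero: "c z' z' = 0"
    and lsc: "lsc_on (Z \<times> Z) (\<lambda>(z, z'). c z z')" and conv: "convex_fun (cost_section Z c z')"
  shows "proper_convex_lsc (cost_section Z c z')"
  unfolding proper_convex_lsc_def
proof (intro conjI conv)
  have nonneg: "0 \<le> cost_section Z c z' x" for x by (simp add: cost_section_def)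
  have "-\<infinity> < cost_section Z c z' x" for x by (rule less_le_trans[OF _ nonneg]) simp
  moreover have "cost_section Z c z' z' < \<infinity>" using z' zero by (simp add: cost_section_def)
  ultimately show "proper_fun (cost_section Z c z')" unfolding proper_fun_def by blast
  show "lsc_on UNIV (cost_section Z c z')"
    unfolding lsc_on_UNIV_iff
  proof
    fix w :: ereal
    consider "w < 0" | "w = \<infinity>" | "0 \<le> w" "w \<noteq> \<infinity>" by fastforce
    then show "closed {x. cost_section Z c z' x \<le> w}"
    proof cases
      case 1
      then have "{x. cost_section Z c z' x \<le> w} = {}" using nonneg by (auto simp: not_le intro: less_le_trans)
      then show ?thesis by simp
    next
      case 2
      then show ?thesis by simp
    next
      case 3
      obtain U where U: "open U" "{p\<in>Z \<times> Z. e2ennreal w < (\<lambda>(z, z'). c z z') p} = (Z \<times> Z) \<inter> U"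
        using lsc_on_open[OF lsc] by blast
      have "enn2ereal (c x z') \<le> w \<longleftrightarrow> c x z' \<le> e2ennreal w" for x
        using 3 by (metis enn2ereal_e2ennreal less_eq_ennreal.rep_eq)
      then have le: "enn2ereal (c x z') \<le> w \<longleftrightarrow> (x, z') \<notin> U" if "x \<in> Z" for x
        using U(2) that z' by (auto simp: set_eq_iff not_less[symmetric])
      have "{x. cost_section Z c z' x \<le> w} = Z \<inter> - ((\<lambda>x. (x, z')) -` U)"
        using 3 le by (auto simp: cost_section_def split: if_splits)
      moreover have "open ((\<lambda>x. (x, z')) -` U)"
        using U(1) by (intro open_vimage continuous_intros)
      ultimately show ?thesis using Z by auto
    qed
  qed
qed

locale dro_program =
  fixes \<Theta> :: "(real^'m) set" and Z :: "(real^'d) set"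
    and c :: "real^'d \<Rightarrow> real^'d \<Rightarrow> ennreal"
    and loss :: "real^'m \<Rightarrow> real^'d \<Rightarrow> ereal"
    and li :: "nat \<Rightarrow> real^'m \<Rightarrow> real^'d \<Rightarrow> ereal"
    and f :: "nat \<Rightarrow> real^'d \<Rightarrow> ereal" and g :: "nat \<Rightarrow> real^'m \<Rightarrow> ereal"
    and p :: "nat \<Rightarrow> real" and zh :: "nat \<Rightarrow> real^'d"
    and \<epsilon> :: real and I J K L :: nat and P :: "(real^'d) measure"
  assumes eps: "\<epsilon> > 0" and closed_Z: "closed Z"
    and cost_zero: "\<And>z z'. z \<in> Z \<Longrightarrow> z' \<in> Z \<Longrightarrow> c z z' = 0 \<longleftrightarrow> z = z'"
    and atoms: "\<And>j. j \<in> {1..J} \<Longrightarrow> p j > 0 \<and> zh j \<in> Z"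
    and cost_lsc: "lsc_on (Z \<times> Z) (\<lambda>(z, z'). c z z')"
    and cost_convex: "\<And>z'. z' \<in> Z \<Longrightarrow> convex_fun (cost_section Z c z')"
    and I: "I \<ge> 1"
    and loss_max: "\<And>\<theta> z. \<theta> \<in> \<Theta> \<Longrightarrow> z \<in> Z \<Longrightarrow> loss \<theta> z = Max ((\<lambda>i. li i \<theta> z) ` {1..I})"
    and loss_convex: "\<And>i z. i \<in> {1..I} \<Longrightarrow> z \<in> Z \<Longrightarrow> proper_convex_lsc (\<lambda>\<theta>. li i \<theta> z)"
    and loss_concave: "\<And>i \<theta>. i \<in> {1..I} \<Longrightarrow> proper_convex_lsc (\<lambda>z. - li i \<theta> z)"
    and f_convex: "\<And>k. k \<in> {1..K} \<Longrightarrow> proper_convex_lsc (f k)"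
    and g_convex: "\<And>l. l \<in> {1..L} \<Longrightarrow> proper_convex_lsc (g l)"
    and Z_eq: "Z = {z. \<forall>k\<in>{1..K}. f k z \<le> 0}"
    and \<Theta>_eq: "\<Theta> = {\<theta>. \<forall>l\<in>{1..L}. g l \<theta> \<le> 0}"
    and slater_\<Theta>: "\<exists>\<theta>. slater_point L g \<theta>"
    and P_distribution: "P \<in> distributions Z"
    and P_discrete: "\<And>A. A \<in> sets (borel_on Z) \<Longrightarrow>
        emeasure P A = (\<Sum>j=1..J. ennreal (p j) * emeasure (return (borel_on Z) (zh j)) A)"
    and unif_integrable: "\<And>Q \<theta>'. Q \<in> ambiguity_set Z c \<epsilon> P \<Longrightarrow> \<theta>' \<in> \<Theta> \<Longrightarrow>
        \<exists>U. open U \<and> \<theta>' \<in> U \<and>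
          uniformly_integrable_family Q (U \<inter> \<Theta>) (\<lambda>\<theta> z. e2ennreal (- min 0 (loss \<theta> z)))"
begin

text \<open>
  A point \<open>x\<close> stores the program variables \<open>x (i, j) = (q i j, \<xi> i j)\<close>. The set \<open>DD e\<close> collects the
  points satisfying all constraints on them, with transport budget \<open>e\<close>, and \<open>- G \<theta> x\<close> is the
  expected loss they represent; \<open>\<alpha>\<close>, \<open>\<beta>\<close> and \<open>\<nu>\<close> are dual to \<open>\<theta>\<close>.
\<close>

definition S where "S = {1..I} \<times> {1..J}"

definition cost :: "nat \<times> nat \<Rightarrow> real^'d \<Rightarrow> ereal" where
  "cost s = (\<lambda>x. cost_section Z c (zh (snd s)) (zh (snd s) + x))"
definition constr :: "nat \<Rightarrow> nat \<times> nat \<Rightarrow> real^'d \<Rightarrow> ereal" where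
  "constr k s = (\<lambda>x. f k (zh (snd s) + x))"
definition gain :: "real^'m \<Rightarrow> nat \<times> nat \<Rightarrow> real^'d \<Rightarrow> ereal" where
  "gain \<theta> s = (\<lambda>x. - li (fst s) \<theta> (zh (snd s) + x))"

definition G :: "real^'m \<Rightarrow> (nat \<times> nat \<Rightarrow> real \<times> (real^'d)) \<Rightarrow> ereal" where
  "G \<theta> x = perspective_sum S (gain \<theta>) x"

definition DD :: "real \<Rightarrow> (nat \<times> nat \<Rightarrow> real \<times> (real^'d)) set" where
  "DD e = {x. (\<forall>s\<in>S. 0 \<le> fst (x s)) \<and> (\<forall>s. s \<notin> S \<longrightarrow> x s = 0) \<and>
     (\<forall>s\<in>S. \<forall>k\<in>{1..K}. perspective (constr k s) (fst (x s)) (snd (x s)) \<le> ereal 0) \<and>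
     (\<forall>j\<in>{1..J}. (\<Sum>i=1..I. fst (x (i, j))) = p j) \<and>
     perspective_sum S cost x \<le> ereal e}"

abbreviation D :: "(nat \<times> nat \<Rightarrow> real \<times> (real^'d)) set" where
  "D \<equiv> DD \<epsilon>"

lemma
  assumes "x \<in> DD e"
  shows D_nonneg: "s \<in> S \<Longrightarrow> 0 \<le> fst (x s)"
    and D_outside: "s \<notin> S \<Longrightarrow> x s = 0"
    and D_constr: "s \<in> S \<Longrightarrow> k \<in> {1..K} \<Longrightarrow> perspective (constr k s) (fst (x s)) (snd (x s)) \<le> ereal 0"
    and D_mass: "j \<in> {1..J} \<Longrightarrow> (\<Sum>i=1..I. fst (x (i, j))) = p j"
    and D_cost: "perspective_sum S cost x \<le> ereal e"
  using assms unfolding DD_def by blast+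

lemma finite_S: "finite S" by (simp add: S_def)

lemma S_D: "s \<in> S \<Longrightarrow> fst s \<in> {1..I} \<and> snd s \<in> {1..J}" by (auto simp: S_def)

lemma zh_Z: "s \<in> S \<Longrightarrow> zh (snd s) \<in> Z" using atoms S_D by blast

lemma cost_pcl: "s \<in> S \<Longrightarrow> proper_convex_lsc (cost s)"
  unfolding cost_def using zh_Z[of s] cost_zero
  by (intro proper_convex_lsc_shift cost_section_proper_convex_lsc closed_Z cost_lsc cost_convex) auto

lemma constr_pcl: "k \<in> {1..K} \<Longrightarrow> proper_convex_lsc (constr k s)"
  unfolding constr_def by (intro proper_convex_lsc_shift f_convex)

lemma gain_pcl: "s \<in> S \<Longrightarrow> proper_convex_lsc (gain \<theta> s)"
  unfolding gain_def using S_D by (intro proper_convex_lsc_shift[of "\<lambda>z. - li (fst s) \<theta> z"] loss_concave) blast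

lemma cost_nonneg: "0 \<le> cost s x"
  by (simp add: cost_def cost_section_def)

lemma cost_0: "s \<in> S \<Longrightarrow> cost s 0 = 0"
  using zh_Z[of s] cost_zero[of "zh (snd s)" "zh (snd s)"]
  by (simp add: cost_def cost_section_def zero_ennreal.rep_eq)

lemma cost_pos: "s \<in> S \<Longrightarrow> x \<noteq> 0 \<Longrightarrow> 0 < cost s x"
  using zh_Z[of s] cost_zero[of "zh (snd s) + x" "zh (snd s)"]
  by (auto simp: cost_def cost_section_def less_le)
    (metis enn2ereal_inject zero_ennreal.rep_eq)

lemma perspective_cost_nonneg:
  assumes "s \<in> S" "0 \<le> r"
  shows "0 \<le> perspective (cost s) r x"
proof (rule ccontr)
  assume "\<not> ?thesis"
  then have "perspective (cost s) r x < 0" by simp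
  then obtain w where w: "perspective (cost s) r x < ereal w" "ereal w < 0"
    using ereal_dense2 by blast
  have "affine_minorant (cost s) 0 0"
    using cost_nonneg by (simp add: affine_minorant_def zero_ereal_def[symmetric])
  then have "0 \<bullet> x - r * 0 \<le> w"
    using perspective_le_iff[OF cost_pcl[OF assms(1)] assms(2)] w(1) less_imp_le by blast
  then show False using w(2) by simp
qed

text \<open>Properness in \<theta> excludes -\<infinity> at points of \<open>Z\<close>, and
  properness of the negated loss in \<open>z\<close> excludes \<infinity>. No restriction of
  \<theta> to \<Theta> is involved.\<close>

lemma li_finite: "i \<in> {1..I} \<Longrightarrow> z \<in> Z \<Longrightarrow> \<bar>li i \<theta> z\<bar> \<noteq> \<infinity>"
  using proper_convex_lsc_not_MInf[OF loss_convex, of i z \<theta>]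
    proper_convex_lsc_not_MInf[OF loss_concave, of i \<theta> z]
  by (cases "li i \<theta> z") auto

lemma D_point:
  assumes x: "x \<in> DD e" and s: "s \<in> S" and r: "fst (x s) > 0"
  shows "zh (snd s) + snd (x s) /\<^sub>R fst (x s) \<in> Z"
proof -
  have "f k (zh (snd s) + snd (x s) /\<^sub>R fst (x s)) \<le> 0" if k: "k \<in> {1..K}" for k
  proof -
    have "perspective (constr k s) (fst (x s)) (snd (x s)) \<le> ereal 0" by (rule D_constr[OF x s k])
    then have "ereal (fst (x s)) * f k (zh (snd s) + snd (x s) /\<^sub>R fst (x s)) \<le> 0"
      using r by (simp add: perspective_def constr_def zero_ereal_def)
    then show ?thesis using r
      by (cases "f k (zh (snd s) + snd (x s) /\<^sub>R fst (x s))") (auto simp: zero_ereal_def mult_le_0_iff)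
  qed
  then show ?thesis by (simp add: Z_eq)
qed

text \<open>At weight 0 the constraints say that the displacement is a recession direction of each
  \<open>f k\<close>, so the whole ray from the atom stays in \<open>Z\<close>.\<close>

lemma D_ray:
  assumes x: "x \<in> DD e" and s: "s \<in> S" and r: "fst (x s) = 0" and t: "t \<ge> 0"
  shows "zh (snd s) + t *\<^sub>R snd (x s) \<in> Z"
proof -
  have "f k (zh (snd s) + t *\<^sub>R snd (x s)) \<le> 0" if k: "k \<in> {1..K}" for k
  proof -
    have "perspective (constr k s) 0 (snd (x s)) \<le> ereal 0" using D_constr[OF x s k] r by simp
    moreover have "constr k s 0 \<le> ereal 0" using zh_Z[OF s] k by (simp add: constr_def Z_eq zero_ereal_def)
    ultimately have "constr k s (0 + t *\<^sub>R snd (x s)) \<le> ereal (0 + t * 0)"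
      using recession_le[OF constr_pcl[OF k]] t by blast
    then show ?thesis by (simp add: constr_def zero_ereal_def)
  qed
  then show ?thesis by (simp add: Z_eq)
qed

text \<open>Budgets are averaged along with the points, so a point exceeding the budget can be
  repaired by mixing in a cheaper one.\<close>

lemma convex_DD:
  assumes x: "x \<in> DD a" and y: "y \<in> DD b" and uv: "0 \<le> u" "0 \<le> v" "u + v = 1"
  shows "(\<lambda>s. u *\<^sub>R x s + v *\<^sub>R y s) \<in> DD (u * a + v * b)"
  unfolding DD_def
proof (intro CollectI conjI ballI allI impI)
  fix s assume s: "s \<in> S"
  show "0 \<le> fst (u *\<^sub>R x s + v *\<^sub>R y s)"
    using D_nonneg[OF x s] D_nonneg[OF y s] uv by simp
  fix k assume k: "k \<in> {1..K}"
  have "perspective (constr k s) (u * fst (x s) + v * fst (y s)) (u *\<^sub>R snd (x s) + v *\<^sub>R snd (y s))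
      \<le> ereal (u * 0 + v * 0)"
    using D_nonneg[OF x s] D_nonneg[OF y s] D_constr[OF x s k] D_constr[OF y s k] uv
    by (intro perspective_add_le perspective_scale_le constr_pcl k) auto
  then show "perspective (constr k s) (fst (u *\<^sub>R x s + v *\<^sub>R y s)) (snd (u *\<^sub>R x s + v *\<^sub>R y s)) \<le> ereal 0"
    by simp
next
  fix j assume j: "j \<in> {1..J}"
  have "(\<Sum>i=1..I. fst (u *\<^sub>R x (i, j) + v *\<^sub>R y (i, j))) =
      u * (\<Sum>i=1..I. fst (x (i, j))) + v * (\<Sum>i=1..I. fst (y (i, j)))"
    by (simp add: sum.distrib sum_distrib_left)
  also have "\<dots> = (u + v) * p j"
    by (simp only: D_mass[OF x j] D_mass[OF y j] distrib_right)
  finally show "(\<Sum>i=1..I. fst (u *\<^sub>R x (i, j) + v *\<^sub>R y (i, j))) = p j" using uv by simp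
next
  show "perspective_sum S cost (\<lambda>s. u *\<^sub>R x s + v *\<^sub>R y s) \<le> ereal (u * a + v * b)"
    using D_nonneg[OF x] D_nonneg[OF y] D_cost[OF x] D_cost[OF y] uv
    by (intro perspective_sum_convex finite_S cost_pcl) auto
qed (simp add: D_outside[OF x] D_outside[OF y])

lemma convex_D:
  assumes "x \<in> D" "y \<in> D" and uv: "0 \<le> u" "0 \<le> v" "u + v = 1"
  shows "(\<lambda>s. u *\<^sub>R x s + v *\<^sub>R y s) \<in> D"
proof -
  have "u * \<epsilon> + v * \<epsilon> = \<epsilon>" using uv by (simp add: distrib_right[symmetric])
  then show ?thesis using convex_DD[OF assms] by simp
qed

lemma closed_D: "closed D"
proof -
  have eq: "D = {x. (\<forall>s\<in>S. 0 \<le> fst (x s)) \<and> perspective_sum S cost x \<le> ereal \<epsilon>} \<inter>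
      (\<Inter>s\<in>- S. {x. x s \<in> {0}}) \<inter>
      (\<Inter>s\<in>S. \<Inter>k\<in>{1..K}. {x. x s \<in> {(r, y). r \<ge> 0 \<and> perspective (constr k s) r y \<le> ereal 0}}) \<inter>
      (\<Inter>j\<in>{1..J}. {x. (\<Sum>i=1..I. fst (x (i, j))) = p j})"
    unfolding DD_def by (auto simp: case_prod_beta)
  have c4: "closed {x :: nat \<times> nat \<Rightarrow> real \<times> (real^'d). (\<Sum>i=1..I. fst (x (i, j))) = p j}" for j
  proof (rule closed_Collect_eq)
    have "continuous_on UNIV (\<lambda>x :: nat \<times> nat \<Rightarrow> real \<times> (real^'d). x (i, j))" for i
      by (rule continuous_on_product_coordinates)
    then show "continuous_on UNIV (\<lambda>x :: nat \<times> nat \<Rightarrow> real \<times> (real^'d). \<Sum>i=1..I. fst (x (i, j)))"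
      by (intro continuous_intros)
  qed auto
  have c1: "closed {x. (\<forall>s\<in>S. 0 \<le> fst (x s)) \<and> perspective_sum S cost x \<le> ereal \<epsilon>}"
    by (intro closed_perspective_sum_le finite_S cost_pcl)
  have c2: "closed {x :: nat \<times> nat \<Rightarrow> real \<times> (real^'d). x s \<in> {0}}" for s
    by (intro closed_vimage_coordinate) simp
  have c3: "closed {x. x s \<in> {(r, y). r \<ge> 0 \<and> perspective (constr k s) r y \<le> ereal 0}}"
    if "k \<in> {1..K}" for k s
    by (intro closed_vimage_coordinate closed_perspective_le constr_pcl that)
  show ?thesis unfolding eq by (intro closed_Int closed_INT ballI c1 c2 c3 c4)
qed

text \<open>The mass equations bound the weights and linear growth of the cost bounds the
  displacements. Coordinates outside \<open>S\<close> are pinned to 0, which gives compactness in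
  the full function space.\<close>

lemma compact_D: "compact D"
proof -
  have "\<exists>a. 0 < a \<and> (\<forall>x. ereal (a * norm x - a) \<le> cost s x)" if "s \<in> S" for s
    using linear_growth[OF cost_pcl[OF that] cost_0[OF that]] cost_pos[OF that] by blast
  then obtain a where a: "\<And>s. s \<in> S \<Longrightarrow> 0 < a s \<and> (\<forall>x. ereal (a s * norm x - a s) \<le> cost s x)" by metis
  define B where "B = (\<lambda>s. if s \<in> S then {0..p (snd s)} \<times> cball (0::real^'d) (\<epsilon> / a s + p (snd s)) else {0})"
  have "compact (B s)" for s by (auto simp: B_def intro: compact_Times)
  then have cB: "compact {x. \<forall>s. x s \<in> B s}" by (rule compact_Pi_UNIV)
  have "D \<subseteq> {x. \<forall>s. x s \<in> B s}"
  proof (intro subsetI CollectI allI)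
    fix x s assume x: "x \<in> D"
    show "x s \<in> B s"
    proof (cases "s \<in> S")
      case False
      then show ?thesis using D_outside[OF x] by (simp add: B_def)
    next
      case s: True
      obtain i j where [simp]: "s = (i, j)" by (cases s)
      note nonneg = D_nonneg[OF x]
      have "fst (x (i, j)) \<le> (\<Sum>i=1..I. fst (x (i, j)))"
        using s nonneg by (intro member_le_sum) (auto simp: S_def)
      then have le: "fst (x s) \<le> p j" using D_mass[OF x, of j] s by (auto simp: S_def)
      have "perspective (cost s) (fst (x s)) (snd (x s)) \<le> perspective_sum S cost x"
        unfolding perspective_sum_def
        using s nonneg perspective_cost_nonneg
          sum_mono2[OF finite_S, of "{s}" "\<lambda>s. perspective (cost s) (fst (x s)) (snd (x s))"] by simp
      also have "\<dots> \<le> ereal \<epsilon>" by (rule D_cost[OF x])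
      finally have "a s * norm (snd (x s)) - a s * fst (x s) \<le> \<epsilon>"
        using perspective_linear_growth[OF cost_pcl[OF s]] a[OF s] nonneg[OF s] by blast
      then have "norm (snd (x s)) \<le> \<epsilon> / a s + fst (x s)" using a[OF s] by (simp add: field_simps)
      then show ?thesis using s le nonneg[OF s] by (simp add: B_def mem_Times_iff)
    qed
  qed
  then have "{x. \<forall>s. x s \<in> B s} \<inter> D = D" by (rule Int_absorb1)
  then show ?thesis using compact_Int_closed[OF cB closed_D] by metis
qed

text \<open>Convexity of each loss in \<theta> survives the perspective in the other variable. At
  positive weight the loss is evaluated at one point of \<open>Z\<close>. At weight 0 the
  perspective is a recession slope, and convexity in \<theta> is used at a remote point of the ray.
  Strict real bounds \<open>a\<close> and \<open>b\<close> cover infinite slopes.\<close>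

lemma gain_perspective_concave:
  assumes x: "x \<in> D" and s: "s \<in> S" and uv: "0 \<le> u" "0 \<le> v" "u + v = 1"
    and a: "ereal a < perspective (gain \<theta> s) (fst (x s)) (snd (x s))"
    and b: "ereal b < perspective (gain \<theta>' s) (fst (x s)) (snd (x s))"
  shows "ereal (u * a + v * b) \<le> perspective (gain (u *\<^sub>R \<theta> + v *\<^sub>R \<theta>') s) (fst (x s)) (snd (x s))"
proof -
  let ?t = "u *\<^sub>R \<theta> + v *\<^sub>R \<theta>'" and ?r = "fst (x s)" and ?y = "snd (x s)"
  define z where "z = (\<lambda>t. zh (snd s) + t *\<^sub>R ?y)"
  have i: "fst s \<in> {1..I}" using S_D s by blast
  have r: "?r \<ge> 0" by (rule D_nonneg[OF x s])
  show ?thesis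
  proof (rule ccontr)
    assume "\<not> ?thesis"
    then have lt: "perspective (gain ?t s) ?r ?y < ereal (u * a + v * b)" by simp
    then obtain T where T: "perspective (gain ?t s) ?r ?y < ereal T" "T < u * a + v * b"
      using ereal_dense2 by (metis less_ereal.simps(1))
    show False
    proof (cases "?r > 0")
      case True
      define w where "w = zh (snd s) + ?y /\<^sub>R ?r"
      have w: "w \<in> Z" unfolding w_def by (rule D_point[OF x s True])
      have fin: "\<bar>li (fst s) \<theta> w\<bar> \<noteq> \<infinity>" "\<bar>li (fst s) \<theta>' w\<bar> \<noteq> \<infinity>" "\<bar>li (fst s) ?t w\<bar> \<noteq> \<infinity>"
        using li_finite[OF i w] by auto
      then obtain A B C where AB: "li (fst s) \<theta> w = ereal A" "li (fst s) \<theta>' w = ereal B" "li (fst s) ?t w = ereal C"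
        by auto
      have "C \<le> u * A + v * B"
        using convex_fun_ineq[of "\<lambda>\<theta>. li (fst s) \<theta> w" \<theta> A \<theta>' B u v] loss_convex[OF i w] uv AB
        by (simp add: proper_convex_lsc_def)
      then have "?r * C \<le> ?r * (u * A + v * B)" using True by simp
      moreover have "a < - (?r * A)" "b < - (?r * B)" "- (?r * C) < T"
        using a b T True AB by (simp_all add: perspective_def gain_def w_def)
      moreover have "u * a \<le> u * (- (?r * A))" "v * b \<le> v * (- (?r * B))"
        by (intro mult_left_mono uv less_imp_le calculation)+
      ultimately show False using T(2) by (simp add: algebra_simps)
    next
      case False
      then have r0: "?r = 0" using r by simp
      have zZ: "z t \<in> Z" if "t \<ge> 0" for t unfolding z_def by (rule D_ray[OF x s r0 that])
      obtain y1 b1 where 1: "affine_minorant (gain \<theta> s) y1 b1" "a < y1 \<bullet> ?y"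
        using a perspective_le_iff[OF gain_pcl[OF s], of 0 \<theta> ?y a] r0 by (auto simp: not_le[symmetric])
      obtain y2 b2 where 2: "affine_minorant (gain \<theta>' s) y2 b2" "b < y2 \<bullet> ?y"
        using b perspective_le_iff[OF gain_pcl[OF s], of 0 \<theta>' ?y b] r0 by (auto simp: not_le[symmetric])
      obtain C where C: "li (fst s) ?t (zh (snd s)) = ereal C" using li_finite[OF i zh_Z[OF s]] by auto
      define d where "d = u * a + v * b - T"
      have d: "d > 0" using T(2) by (simp add: d_def)
      \<comment> \<open>Far enough along the ray the slope deficit \<open>t * d\<close> outweighs
        the offsets \<open>b1\<close>, \<open>b2\<close> and \<open>C\<close>, contradicting
        convexity in \<theta> at the point \<open>z t\<close>.\<close>
      define t where "t = (\<bar>u * b1 + v * b2 - C\<bar> + 1) / d"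
      have t: "t > 0" using d by (simp add: t_def add_pos_nonneg)
      have "z t \<in> Z" using zZ t by simp
      then obtain A' B' C' where A': "li (fst s) \<theta> (z t) = ereal A'" "li (fst s) \<theta>' (z t) = ereal B'"
        "li (fst s) ?t (z t) = ereal C'" using li_finite[OF i] by (metis abs_neq_infinity_cases)
      have "y1 \<bullet> (t *\<^sub>R ?y) - b1 \<le> - A'" "y2 \<bullet> (t *\<^sub>R ?y) - b2 \<le> - B'"
        using 1(1) 2(1) A' unfolding affine_minorant_def gain_def z_def
        by (metis ereal_less_eq(3) uminus_ereal.simps(1))+
      moreover have "t * a \<le> t * (y1 \<bullet> ?y)" "t * b \<le> t * (y2 \<bullet> ?y)" using 1 2 t by simp_all
      ultimately have AB: "A' \<le> b1 - t * a" "B' \<le> b2 - t * b" by simp_all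
      have "gain ?t s (0 + t *\<^sub>R ?y) \<le> ereal (- C + t * T)"
        using T(1) r0 t C
        by (intro recession_le gain_pcl s) (auto simp: gain_def)
      then have "C - t * T \<le> C'" using A' by (simp add: gain_def z_def)
      also have "C' \<le> u * A' + v * B'"
        using convex_fun_ineq[of "\<lambda>\<theta>. li (fst s) \<theta> (z t)" \<theta> A' \<theta>' B' u v]
          loss_convex[OF i \<open>z t \<in> Z\<close>] uv A' by (simp add: proper_convex_lsc_def)
      also have "\<dots> \<le> u * (b1 - t * a) + v * (b2 - t * b)"
        using AB uv by (intro add_mono mult_left_mono)
      finally have "t * d \<le> u * b1 + v * b2 - C" by (simp add: d_def algebra_simps)
      then show False using d by (simp add: t_def)
    qed
  qed
qed

lemma G_not_MInf: "x \<in> DD e \<Longrightarrow> G \<theta> x \<noteq> -\<infinity>"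
  unfolding G_def by (intro perspective_sum_not_MInf) (simp add: gain_pcl D_nonneg)

text \<open>Summands may be infinite, so lower bounds of the sums are first split into strict real
  bounds of the summands, at the price of an arbitrarily small \<open>e\<close>.\<close>

lemma G_concave:
  assumes x: "x \<in> D" and uv: "0 \<le> u" "0 \<le> v" "u + v = 1"
    and a: "ereal a \<le> G \<theta> x" and b: "ereal b \<le> G \<theta>' x"
  shows "ereal (u * a + v * b) \<le> G (u *\<^sub>R \<theta> + v *\<^sub>R \<theta>') x"
proof (rule ereal_le_epsilon2)
  fix e :: real assume e: "0 < e"
  have split: "\<exists>t. (\<forall>s\<in>S. ereal (t s) < perspective (gain \<tau> s) (fst (x s)) (snd (x s))) \<and> w - e < (\<Sum>s\<in>S. t s)"
    if "ereal w \<le> G \<tau> x" for w \<tau>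
  proof (rule sum_ereal_less_split[OF finite_S])
    show "perspective (gain \<tau> s) (fst (x s)) (snd (x s)) \<noteq> -\<infinity>" if "s \<in> S" for s
      by (rule perspective_not_MInf[OF gain_pcl[OF that] D_nonneg[OF x that]])
    have "ereal (w - e) < ereal w" using e by simp
    also have "\<dots> \<le> (\<Sum>s\<in>S. perspective (gain \<tau> s) (fst (x s)) (snd (x s)))"
      using that by (simp add: G_def perspective_sum_def)
    finally show "ereal (w - e) < (\<Sum>s\<in>S. perspective (gain \<tau> s) (fst (x s)) (snd (x s)))" .
  qed
  obtain t where t: "\<forall>s\<in>S. ereal (t s) < perspective (gain \<theta> s) (fst (x s)) (snd (x s))" "a - e < (\<Sum>s\<in>S. t s)"
    using split[OF a] by blast
  obtain t' where t': "\<forall>s\<in>S. ereal (t' s) < perspective (gain \<theta>' s) (fst (x s)) (snd (x s))" "b - e < (\<Sum>s\<in>S. t' s)"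
    using split[OF b] by blast
  have "ereal (\<Sum>s\<in>S. u * t s + v * t' s) \<le> G (u *\<^sub>R \<theta> + v *\<^sub>R \<theta>') x"
    unfolding G_def perspective_sum_def
    using t(1) t'(1) by (intro sum_ereal_mono_real gain_perspective_concave x uv) auto
  moreover have "(u * a + v * b) - e \<le> (\<Sum>s\<in>S. u * t s + v * t' s)"
  proof -
    have "u * (a - e) + v * (b - e) \<le> u * (\<Sum>s\<in>S. t s) + v * (\<Sum>s\<in>S. t' s)"
      using t(2) t'(2) uv by (intro add_mono mult_left_mono) auto
    moreover have "u * (a - e) + v * (b - e) = u * a + v * b - (u + v) * e" by (simp add: algebra_simps)
    ultimately show ?thesis using uv by (simp add: sum.distrib sum_distrib_left)
  qed
  then have "ereal (u * a + v * b) \<le> ereal (\<Sum>s\<in>S. u * t s + v * t' s) + ereal e" by simp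
  ultimately show "ereal (u * a + v * b) \<le> G (u *\<^sub>R \<theta> + v *\<^sub>R \<theta>') x + ereal e"
    by (meson add_right_mono order_trans)
qed

text \<open>The parameter \<open>\<theta>'\<close> is the midpoint of \<open>\<theta>\<close> and
  its reflection \<open>\<tau>\<close>. As \<open>G\<close> is not -\<infinity> at
  \<open>\<tau>\<close>, concavity carries the value \<infinity> over to
  \<open>\<theta>'\<close>.\<close>

lemma G_PInf:
  assumes x: "x \<in> D" and inf: "G \<theta> x = \<infinity>"
  shows "G \<theta>' x = \<infinity>"
proof -
  define \<tau> where "\<tau> = 2 *\<^sub>R \<theta>' - \<theta>"
  obtain b where b: "ereal b \<le> G \<tau> x"
    using G_not_MInf[OF x, of \<tau>] by (cases "G \<tau> x") auto
  have mid: "(1/2) *\<^sub>R \<theta> + (1/2) *\<^sub>R \<tau> = \<theta>'" by (simp add: \<tau>_def algebra_simps scaleR_2[symmetric])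
  have "ereal w \<le> G \<theta>' x" for w
  proof -
    have "ereal (1/2 * (2 * w - b) + 1/2 * b) \<le> G ((1/2) *\<^sub>R \<theta> + (1/2) *\<^sub>R \<tau>) x"
      using b inf by (intro G_concave x) auto
    then show ?thesis unfolding mid by (simp add: field_simps)
  qed
  then show ?thesis by (intro ereal_top) auto
qed

lemma G_convex:
  assumes "x \<in> DD d" "y \<in> DD e" "0 \<le> u" "0 \<le> v" "G \<theta> x \<le> ereal a" "G \<theta> y \<le> ereal b"
  shows "G \<theta> (\<lambda>s. u *\<^sub>R x s + v *\<^sub>R y s) \<le> ereal (u * a + v * b)"
  using assms unfolding G_def
  by (intro perspective_sum_convex finite_S gain_pcl) (auto simp: D_nonneg)

lemma convex_\<Theta>: "convex \<Theta>"
  unfolding convex_def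
proof (intro ballI allI impI)
  fix \<theta> \<theta>' and u v :: real assume A: "\<theta> \<in> \<Theta>" "\<theta>' \<in> \<Theta>" "0 \<le> u" "0 \<le> v" "u + v = 1"
  have "g l (u *\<^sub>R \<theta> + v *\<^sub>R \<theta>') \<le> 0" if "l \<in> {1..L}" for l
    using convex_fun_ineq[of "g l" \<theta> 0 \<theta>' 0 u v] A g_convex[OF that] that
    by (simp add: \<Theta>_eq proper_convex_lsc_def zero_ereal_def)
  then show "u *\<^sub>R \<theta> + v *\<^sub>R \<theta>' \<in> \<Theta>" by (simp add: \<Theta>_eq)
qed

lemma game: "convex_game \<Theta> G D"
proof
  show "convex \<Theta>" by (rule convex_\<Theta>)
  show "G \<theta> x \<noteq> -\<infinity>" if "x \<in> D" for \<theta> x using G_not_MInf that by blast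
  show "G \<theta>' x = \<infinity>" if "x \<in> D" "G \<theta> x = \<infinity>" for \<theta> \<theta>' x using G_PInf that by blast
  show "ereal (u * a + v * b) \<le> G (u *\<^sub>R \<theta> + v *\<^sub>R \<theta>') x"
    if "x \<in> D" "0 \<le> u" "0 \<le> v" "u + v = 1" "ereal a \<le> G \<theta> x" "ereal b \<le> G \<theta>' x" for \<theta> \<theta>' x u v a b
    by (rule G_concave) (use that in auto)
  show "\<exists>z\<in>D. \<forall>\<theta>\<in>\<Theta>. \<forall>a b. G \<theta> x \<le> ereal a \<longrightarrow> G \<theta> y \<le> ereal b \<longrightarrow> G \<theta> z \<le> ereal (u * a + v * b)"
    if "x \<in> D" "y \<in> D" "0 \<le> u" "0 \<le> v" "u + v = 1" for x y u v
    using convex_D[OF that] G_convex[OF that(1-4)]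
    by (intro bexI[of _ "\<lambda>s. u *\<^sub>R x s + v *\<^sub>R y s"]) auto
qed

lemma closed_G: "closed {x\<in>D. G \<theta> x \<le> ereal w}"
proof -
  have "D \<subseteq> {x. \<forall>s\<in>S. 0 \<le> fst (x s)}" using D_nonneg by blast
  then have "{x\<in>D. G \<theta> x \<le> ereal w} =
      D \<inter> {x. (\<forall>s\<in>S. 0 \<le> fst (x s)) \<and> perspective_sum S (gain \<theta>) x \<le> ereal w}"
    unfolding G_def by blast
  moreover have "closed {x. (\<forall>s\<in>S. 0 \<le> fst (x s)) \<and> perspective_sum S (gain \<theta>) x \<le> ereal w}"
    by (intro closed_perspective_sum_le finite_S gain_pcl)
  ultimately show ?thesis using closed_D by (simp add: closed_Int)
qed

lemma \<Theta>_nonempty: "\<Theta> \<noteq> {}"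
  using slater_\<Theta> by (auto simp: slater_point_def \<Theta>_eq)

lemma minimax_D:
  assumes "\<And>x. x \<in> D \<Longrightarrow> \<exists>\<theta>\<in>\<Theta>. ereal w < G \<theta> x"
  shows "\<exists>\<theta>\<in>\<Theta>. \<forall>x\<in>D. ereal w \<le> G \<theta> x"
  by (rule minimax[OF game \<Theta>_nonempty compact_D closed_G assms])

section \<open>Duality in the decision variable\<close>

definition cgain :: "nat \<times> nat \<Rightarrow> (real^'m) \<times> (real^'d) \<Rightarrow> ereal" where
  "cgain s = (\<lambda>(a, x). conjugate (\<lambda>\<theta>. li (fst s) \<theta> (zh (snd s) + x)) a)"

text \<open>Conjugation in \<theta> commutes with the perspective: the right side bounds, at
  \<alpha>, the conjugate of minus the perspective of the gain. At positive weight this is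
  rescaling; at weight 0 two recession functions are compared, and each direction transfers slopes
  of minorants.\<close>

lemma perspective_cgain_le_iff:
  assumes x: "x \<in> D" and s: "s \<in> S"
  shows "perspective (cgain s) (fst (x s)) (\<alpha>, snd (x s)) \<le> ereal w \<longleftrightarrow>
    (\<forall>\<theta>. perspective (gain \<theta> s) (fst (x s)) (snd (x s)) \<le> ereal (w - \<alpha> \<bullet> \<theta>))"
proof -
  let ?r = "fst (x s)" and ?y = "snd (x s)"
  have i: "fst s \<in> {1..I}" using S_D s by blast
  show ?thesis
  proof (cases "?r > 0")
    case True
    define z where "z = zh (snd s) + ?y /\<^sub>R ?r"
    have "perspective (cgain s) ?r (\<alpha>, ?y) = ereal ?r * conjugate (\<lambda>\<theta>. li (fst s) \<theta> z) (\<alpha> /\<^sub>R ?r)"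
      using True by (simp add: perspective_def cgain_def z_def)
    also have "\<dots> \<le> ereal w \<longleftrightarrow> conjugate (\<lambda>\<theta>. li (fst s) \<theta> z) (\<alpha> /\<^sub>R ?r) \<le> ereal (w / ?r)"
      using True by (cases "conjugate (\<lambda>\<theta>. li (fst s) \<theta> z) (\<alpha> /\<^sub>R ?r)") (auto simp: field_simps)
    also have "\<dots> \<longleftrightarrow> (\<forall>\<theta>. ereal ((\<alpha> /\<^sub>R ?r) \<bullet> \<theta> - w / ?r) \<le> li (fst s) \<theta> z)"
      by (simp add: conjugate_le_iff affine_minorant_def)
    also have "\<dots> \<longleftrightarrow> (\<forall>\<theta>. perspective (gain \<theta> s) ?r ?y \<le> ereal (w - \<alpha> \<bullet> \<theta>))"
    proof -
      have "ereal ((\<alpha> /\<^sub>R ?r) \<bullet> \<theta> - w / ?r) \<le> li (fst s) \<theta> z \<longleftrightarrow>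
          perspective (gain \<theta> s) ?r ?y \<le> ereal (w - \<alpha> \<bullet> \<theta>)" for \<theta>
      proof -
        have p: "perspective (gain \<theta> s) ?r ?y = ereal ?r * - li (fst s) \<theta> z"
          using True by (simp add: perspective_def gain_def z_def)
        have eq: "?r * ((\<alpha> /\<^sub>R ?r) \<bullet> \<theta> - w / ?r) = \<alpha> \<bullet> \<theta> - w"
          using True by (simp add: right_diff_distrib)
        show ?thesis
        proof (cases "li (fst s) \<theta> z")
          case (real A)
          have "(\<alpha> /\<^sub>R ?r) \<bullet> \<theta> - w / ?r \<le> A \<longleftrightarrow> \<alpha> \<bullet> \<theta> - w \<le> ?r * A"
            using mult_le_cancel_left_pos[OF True, of "(\<alpha> /\<^sub>R ?r) \<bullet> \<theta> - w / ?r" A] unfolding eq by simp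
          then show ?thesis using p real by auto
        qed (use p True in auto)
      qed
      then show ?thesis by simp
    qed
    finally show ?thesis .
  next
    case False
    then have r0: "?r = 0" using D_nonneg[OF x s] by simp
    show ?thesis
    proof
      assume le: "perspective (cgain s) ?r (\<alpha>, ?y) \<le> ereal w"
      show "\<forall>\<theta>. perspective (gain \<theta> s) ?r ?y \<le> ereal (w - \<alpha> \<bullet> \<theta>)"
      proof
        fix \<theta>
        have "e \<bullet> ?y - 0 * b \<le> w - \<alpha> \<bullet> \<theta>" if m: "affine_minorant (gain \<theta> s) e b" for e b
        proof -
          \<comment> \<open>A minorant of the gain at fixed \<theta> gives one of
            \<open>cgain s\<close> with slope \<open>(\<theta>, e)\<close>, as \<theta> competes in
            the supremum defining the conjugate.\<close>
          have "affine_minorant (cgain s) (\<theta>, e) b"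
            unfolding affine_minorant_def
          proof clarify
            fix a u
            have "ereal (e \<bullet> u - b) \<le> - li (fst s) \<theta> (zh (snd s) + u)"
              using m by (simp add: affine_minorant_def gain_def)
            then have "ereal ((\<theta>, e) \<bullet> (a, u) - b) \<le> ereal (a \<bullet> \<theta>) - li (fst s) \<theta> (zh (snd s) + u)"
              by (cases "li (fst s) \<theta> (zh (snd s) + u)") (auto simp: inner_commute)
            also have "\<dots> \<le> cgain s (a, u)"
              unfolding cgain_def conjugate_def prod.case by (rule SUP_upper) simp
            finally show "ereal ((\<theta>, e) \<bullet> (a, u) - b) \<le> cgain s (a, u)" .
          qed
          then have "conjugate (cgain s) (\<theta>, e) \<le> ereal b" by (simp add: conjugate_le_iff)
          then have "(\<theta>, e) \<in> effective_dom (conjugate (cgain s))"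
            unfolding effective_dom_def by (auto intro: le_less_trans)
          then have "ereal ((\<alpha>, ?y) \<bullet> (\<theta>, e)) \<le> perspective (cgain s) ?r (\<alpha>, ?y)"
            unfolding perspective_def using r0 by (auto simp del: inner_Pair intro: SUP_upper)
          then have "ereal ((\<alpha>, ?y) \<bullet> (\<theta>, e)) \<le> ereal w" using le order_trans by blast
          then show ?thesis by (simp add: inner_commute)
        qed
        then show "perspective (gain \<theta> s) ?r ?y \<le> ereal (w - \<alpha> \<bullet> \<theta>)"
          unfolding r0 perspective_le_iff[OF gain_pcl[OF s] order_refl] by simp
      qed
    next
      assume le: "\<forall>\<theta>. perspective (gain \<theta> s) ?r ?y \<le> ereal (w - \<alpha> \<bullet> \<theta>)"
      have "(\<alpha>, ?y) \<bullet> e \<le> w" if e: "e \<in> effective_dom (conjugate (cgain s))" for e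
      proof -
        have "conjugate (cgain s) e < \<infinity>" using e by (simp add: effective_dom_def)
        then obtain B where "conjugate (cgain s) e \<le> ereal B"
          by (cases "conjugate (cgain s) e") auto
        then have B: "affine_minorant (cgain s) e B" by (simp add: conjugate_le_iff)
        obtain a0 b0 where m0: "affine_minorant (\<lambda>\<theta>. li (fst s) \<theta> (zh (snd s))) a0 b0"
          by (rule proper_convex_lsc_has_minorant[OF loss_convex[OF i zh_Z[OF s]]])
        have "(a0, 0) \<bullet> e - B + t * ((\<alpha>, ?y) \<bullet> e) \<le> b0 + t * w" if t: "t \<ge> 0" for t
        proof -
          \<comment> \<open>Moving by \<open>t\<close> along the ray turns a minorant at the atom
            into one whose slope and offset are shifted by \<open>t * \<alpha>\<close> and
            \<open>t * w\<close>. Comparing growth in \<open>t\<close> then isolates the desired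
            slope inequality.\<close>
          have "affine_minorant (\<lambda>\<theta>. li (fst s) \<theta> (zh (snd s) + t *\<^sub>R ?y)) (a0 + t *\<^sub>R \<alpha>) (b0 + t * w)"
            unfolding affine_minorant_def
          proof
            fix \<theta>
            obtain C where C: "li (fst s) \<theta> (zh (snd s)) = ereal C"
              using li_finite[OF i zh_Z[OF s], of \<theta>] by auto
            have "a0 \<bullet> \<theta> - b0 \<le> C" using m0 C unfolding affine_minorant_def by (metis ereal_less_eq(3))
            have "gain \<theta> s (0 + t *\<^sub>R ?y) \<le> ereal (- C + t * (w - \<alpha> \<bullet> \<theta>))"
              using le r0 C by (intro recession_le gain_pcl s t) (auto simp: gain_def)
            then have "- li (fst s) \<theta> (zh (snd s) + t *\<^sub>R ?y) \<le> ereal (- C + t * (w - \<alpha> \<bullet> \<theta>))"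
              by (simp add: gain_def)
            then have "ereal (C - t * (w - \<alpha> \<bullet> \<theta>)) \<le> li (fst s) \<theta> (zh (snd s) + t *\<^sub>R ?y)"
              by (cases "li (fst s) \<theta> (zh (snd s) + t *\<^sub>R ?y)") auto
            moreover have "(a0 + t *\<^sub>R \<alpha>) \<bullet> \<theta> - (b0 + t * w) \<le> C - t * (w - \<alpha> \<bullet> \<theta>)"
              using \<open>a0 \<bullet> \<theta> - b0 \<le> C\<close> by (simp add: algebra_simps)
            ultimately show "ereal ((a0 + t *\<^sub>R \<alpha>) \<bullet> \<theta> - (b0 + t * w)) \<le> li (fst s) \<theta> (zh (snd s) + t *\<^sub>R ?y)"
              by (meson ereal_less_eq(3) order_trans)
          qed
          then have "cgain s (a0 + t *\<^sub>R \<alpha>, t *\<^sub>R ?y) \<le> ereal (b0 + t * w)"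
            by (simp add: cgain_def conjugate_le_iff)
          moreover have "ereal (e \<bullet> (a0 + t *\<^sub>R \<alpha>, t *\<^sub>R ?y) - B) \<le> cgain s (a0 + t *\<^sub>R \<alpha>, t *\<^sub>R ?y)"
            using B by (simp add: affine_minorant_def)
          ultimately have "e \<bullet> (a0 + t *\<^sub>R \<alpha>, t *\<^sub>R ?y) - B \<le> b0 + t * w"
            using ereal_le_real_trans by blast
          moreover have "e \<bullet> (a0 + t *\<^sub>R \<alpha>, t *\<^sub>R ?y) = (a0, 0) \<bullet> e + t * ((\<alpha>, ?y) \<bullet> e)"
            by (cases e) (simp add: inner_add_right inner_commute distrib_left)
          ultimately show ?thesis by simp
        qed
        then show ?thesis by (rule le_of_affine_growth)
      qed
      then show "perspective (cgain s) ?r (\<alpha>, ?y) \<le> ereal w"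
        using r0 by (simp add: perspective_def SUP_le_iff)
    qed
  qed
qed

section \<open>Weak and strong Lagrange duality\<close>

lemma sum_S: "(\<Sum>i=1..I. \<Sum>j=1..J. F i j) = (\<Sum>s\<in>S. F (fst s) (snd s))"
  by (simp add: S_def sum.cartesian_product case_prod_beta)

lemma ball_S: "(\<forall>i\<in>{1..I}. \<forall>j\<in>{1..J}. Q i j) \<longleftrightarrow> (\<forall>s\<in>S. Q (fst s) (snd s))"
  by (auto simp: S_def)

lemma program_feasible_iff:
  "program_feasible I J K L Z c \<epsilon> p zh f q \<nu> \<xi> \<alpha> \<beta> \<longleftrightarrow>
    (\<lambda>s. if s \<in> S then (q (fst s) (snd s), \<xi> (fst s) (snd s)) else 0) \<in> D \<and>
    (\<forall>l\<in>{1..L}. \<nu> l \<ge> 0) \<and> (\<Sum>s\<in>S. \<alpha> (fst s) (snd s)) + (\<Sum>l=1..L. \<beta> l) = 0"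
proof -
  let ?x = "\<lambda>s. if s \<in> S then (q (fst s) (snd s), \<xi> (fst s) (snd s)) else 0"
  have "perspective_sum S cost ?x = (\<Sum>i=1..I. \<Sum>j=1..J.
      perspective (\<lambda>x. cost_section Z c (zh j) (zh j + x)) (q i j) (\<xi> i j))"
    unfolding sum_S perspective_sum_def cost_def by (intro sum.cong) auto
  moreover have "(\<Sum>i=1..I. fst (?x (i, j))) = (\<Sum>i=1..I. q i j)" if "j \<in> {1..J}" for j
    using that by (intro sum.cong) (auto simp: S_def)
  ultimately show ?thesis
    unfolding program_feasible_def DD_def ball_S sum_S
    by (auto simp: constr_def zero_ereal_def)
qed

lemma program_objective_eq:
  "program_objective I J L zh li g q \<nu> \<xi> \<alpha> \<beta> =
    - (\<Sum>s\<in>S. perspective (cgain s) (q (fst s) (snd s)) (\<alpha> (fst s) (snd s), \<xi> (fst s) (snd s)))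
    - (\<Sum>l=1..L. perspective (conjugate (g l)) (\<nu> l) (\<beta> l))"
  unfolding program_objective_def sum_S cgain_def ..

text \<open>Weak duality: Young's inequality is applied to every loss and every constraint. The
  linear terms cancel since all slopes add up to 0, and \<open>g l \<theta> \<le> 0\<close> on
  \<Theta> removes the constraint values.\<close>

lemma program_point:
  assumes feas: "program_feasible I J K L Z c \<epsilon> p zh f q \<nu> \<xi> \<alpha> \<beta>"
    and v: "ereal v \<le> program_objective I J L zh li g q \<nu> \<xi> \<alpha> \<beta>"
  shows "\<exists>x\<in>D. \<forall>\<theta>\<in>\<Theta>. G \<theta> x \<le> ereal (- v)"
proof -
  define x where "x = (\<lambda>s. if s \<in> S then (q (fst s) (snd s), \<xi> (fst s) (snd s)) else 0)"
  have x: "x \<in> D" and \<nu>: "\<forall>l\<in>{1..L}. \<nu> l \<ge> 0"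
    and zero: "(\<Sum>s\<in>S. \<alpha> (fst s) (snd s)) + (\<Sum>l=1..L. \<beta> l) = 0"
    using feas unfolding program_feasible_iff x_def by blast+
  define X where "X = (\<Sum>s\<in>S. perspective (cgain s) (fst (x s)) (\<alpha> (fst s) (snd s), snd (x s)))"
  define Y where "Y = (\<Sum>l=1..L. perspective (conjugate (g l)) (\<nu> l) (\<beta> l))"
  have obj: "program_objective I J L zh li g q \<nu> \<xi> \<alpha> \<beta> = - X - Y"
    unfolding program_objective_eq X_def Y_def x_def by (simp cong: sum.cong)
  have ninf1: "perspective (cgain s) (fst (x s)) (\<alpha> (fst s) (snd s), snd (x s)) \<noteq> -\<infinity>" if s: "s \<in> S" for s
  proof
    assume inf: "perspective (cgain s) (fst (x s)) (\<alpha> (fst s) (snd s), snd (x s)) = -\<infinity>"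
    have "perspective (gain 0 s) (fst (x s)) (snd (x s)) \<le> ereal w" for w
      using perspective_cgain_le_iff[OF x s, of "\<alpha> (fst s) (snd s)" w] inf by (auto dest: spec[of _ 0])
    then have "perspective (gain 0 s) (fst (x s)) (snd (x s)) = -\<infinity>" by (intro ereal_bot)
    then show False using perspective_not_MInf[OF gain_pcl[OF s] D_nonneg[OF x s]] by simp
  qed
  obtain \<theta>0 where \<theta>0: "\<theta>0 \<in> \<Theta>" using \<Theta>_nonempty by blast
  have ninf2: "perspective (conjugate (g l)) (\<nu> l) (\<beta> l) \<noteq> -\<infinity>" if l: "l \<in> {1..L}" for l
  proof
    assume inf: "perspective (conjugate (g l)) (\<nu> l) (\<beta> l) = -\<infinity>"
    have "g l \<theta>0 \<le> ereal 0" using \<theta>0 l by (simp add: \<Theta>_eq zero_ereal_def)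
    moreover have "\<forall>u t. g l u \<le> ereal t \<longrightarrow> u \<bullet> \<beta> l - \<nu> l * t \<le> \<theta>0 \<bullet> \<beta> l - 1"
      using perspective_conjugate_le_iff[OF g_convex[OF l], of "\<nu> l" "\<beta> l" "\<theta>0 \<bullet> \<beta> l - 1"] inf \<nu> l by simp
    ultimately have "\<theta>0 \<bullet> \<beta> l - \<nu> l * 0 \<le> \<theta>0 \<bullet> \<beta> l - 1" by blast
    then show False by simp
  qed
  have X: "X \<noteq> -\<infinity>" unfolding X_def by (rule sum_ereal_not_MInf) (rule ninf1)
  have Y: "Y \<noteq> -\<infinity>" unfolding Y_def by (rule sum_ereal_not_MInf) (rule ninf2)
  obtain A B where AB: "X = ereal A" "Y = ereal B" "A + B \<le> - v"
    using v X Y unfolding obj by (cases X; cases Y) auto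
  have "\<exists>t. (\<forall>s\<in>S. perspective (cgain s) (fst (x s)) (\<alpha> (fst s) (snd s), snd (x s)) = ereal (t s)) \<and> (\<Sum>s\<in>S. t s) \<le> A"
    using AB ninf1 by (intro sum_ereal_le_split finite_S) (auto simp: X_def)
  then obtain t where t: "\<forall>s\<in>S. perspective (cgain s) (fst (x s)) (\<alpha> (fst s) (snd s), snd (x s)) = ereal (t s)"
    "(\<Sum>s\<in>S. t s) \<le> A" by blast
  have "\<exists>u. (\<forall>l\<in>{1..L}. perspective (conjugate (g l)) (\<nu> l) (\<beta> l) = ereal (u l)) \<and> (\<Sum>l\<in>{1..L}. u l) \<le> B"
    using AB ninf2 by (intro sum_ereal_le_split) (auto simp: Y_def)
  then obtain u where u: "\<forall>l\<in>{1..L}. perspective (conjugate (g l)) (\<nu> l) (\<beta> l) = ereal (u l)"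
    "(\<Sum>l\<in>{1..L}. u l) \<le> B" by blast
  have "G \<theta> x \<le> ereal (- v)" if \<theta>: "\<theta> \<in> \<Theta>" for \<theta>
  proof -
    have "perspective (gain \<theta> s) (fst (x s)) (snd (x s)) \<le> ereal (t s - \<alpha> (fst s) (snd s) \<bullet> \<theta>)" if s: "s \<in> S" for s
      using perspective_cgain_le_iff[OF x s, of "\<alpha> (fst s) (snd s)" "t s"] t s by auto
    then have "G \<theta> x \<le> ereal (\<Sum>s\<in>S. t s - \<alpha> (fst s) (snd s) \<bullet> \<theta>)"
      unfolding G_def perspective_sum_def by (rule sum_ereal_mono_real)
    also have "(\<Sum>s\<in>S. t s - \<alpha> (fst s) (snd s) \<bullet> \<theta>) = (\<Sum>s\<in>S. t s) - (\<Sum>s\<in>S. \<alpha> (fst s) (snd s)) \<bullet> \<theta>"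
      by (simp add: sum_subtractf inner_sum_left)
    also have "(\<Sum>s\<in>S. \<alpha> (fst s) (snd s)) = - (\<Sum>l=1..L. \<beta> l)"
      using zero by (simp add: eq_neg_iff_add_eq_0)
    also have "(\<Sum>s\<in>S. t s) - (- (\<Sum>l=1..L. \<beta> l)) \<bullet> \<theta> = (\<Sum>s\<in>S. t s) + (\<Sum>l=1..L. \<beta> l \<bullet> \<theta>)"
      by (simp add: inner_sum_left)
    also have "(\<Sum>l=1..L. \<beta> l \<bullet> \<theta>) \<le> (\<Sum>l=1..L. u l)"
    proof (rule sum_mono)
      fix l assume l: "l \<in> {1..L}"
      have "g l \<theta> \<le> ereal 0" using \<theta> l by (simp add: \<Theta>_eq zero_ereal_def)
      moreover have "\<forall>\<theta> t. g l \<theta> \<le> ereal t \<longrightarrow> \<theta> \<bullet> \<beta> l - \<nu> l * t \<le> u l"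
        using perspective_conjugate_le_iff[OF g_convex[OF l], of "\<nu> l" "\<beta> l" "u l"] u \<nu> l by simp
      ultimately have "\<theta> \<bullet> \<beta> l - \<nu> l * 0 \<le> u l" by blast
      then show "\<beta> l \<bullet> \<theta> \<le> u l" by (simp add: inner_commute)
    qed
    also have "(\<Sum>s\<in>S. t s) + (\<Sum>l=1..L. u l) \<le> - v" using t(2) u(2) AB(3) by linarith
    finally show ?thesis by simp
  qed
  then show ?thesis using x by blast
qed

text \<open>Strong duality: the Slater point yields multipliers \<nu> for which the Lagrangian is at
  least \<open>v\<close>. This constant minorant is split into affine minorants of the single terms;
  their slopes, which add up to 0, are the \<alpha> and \<beta>.\<close>

lemma program_ge:
  assumes x: "x \<in> D" and v: "\<And>\<theta>. \<theta> \<in> \<Theta> \<Longrightarrow> G \<theta> x \<le> ereal (- v)"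
  shows "\<exists>q \<nu> \<xi> \<alpha> \<beta>. program_feasible I J K L Z c \<epsilon> p zh f q \<nu> \<xi> \<alpha> \<beta> \<and>
    ereal v \<le> program_objective I J L zh li g q \<nu> \<xi> \<alpha> \<beta>"
proof -
  obtain \<theta>s where sl: "slater_point L g \<theta>s" using slater_\<Theta> by blast
  then have "\<theta>s \<in> \<Theta>" by (auto simp: slater_point_def \<Theta>_eq)
  then have "G \<theta>s x \<noteq> \<infinity>" using v by force
  \<comment> \<open>Finiteness at the Slater point spreads to every \<theta>, also outside \<Theta>,
    so each \<open>h s\<close> is a real convex function on the whole space.\<close>
  then have Gfin: "G \<theta> x \<noteq> \<infinity>" for \<theta> using G_PInf[OF x] by blast
  define h where "h = (\<lambda>s \<theta>. - real_of_ereal (perspective (gain \<theta> s) (fst (x s)) (snd (x s))))"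
  have h: "perspective (gain \<theta> s) (fst (x s)) (snd (x s)) = ereal (- h s \<theta>)" if s: "s \<in> S" for s \<theta>
  proof -
    have "perspective (gain \<theta> s) (fst (x s)) (snd (x s)) \<noteq> \<infinity>"
      using Gfin[of \<theta>] finite_S s unfolding G_def perspective_sum_def by (auto simp: sum_Pinfty)
    then show ?thesis
      using perspective_not_MInf[OF gain_pcl[OF s] D_nonneg[OF x s]] unfolding h_def
      by (metis add.inverse_inverse ereal_real' abs_neq_infinity_cases ereal_infinity_cases)
  qed
  have hconv: "convex_on UNIV (h s)" if s: "s \<in> S" for s
    unfolding convex_on_def
  proof (intro conjI ballI allI impI)
    fix \<theta> \<theta>' and u w :: real assume uw: "0 \<le> u" "0 \<le> w" "u + w = 1"
    show "h s (u *\<^sub>R \<theta> + w *\<^sub>R \<theta>') \<le> u * h s \<theta> + w * h s \<theta>'"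
    proof (rule field_le_epsilon)
      fix e :: real assume e: "0 < e"
      have "ereal (u * (- h s \<theta> - e) + w * (- h s \<theta>' - e)) \<le>
          perspective (gain (u *\<^sub>R \<theta> + w *\<^sub>R \<theta>') s) (fst (x s)) (snd (x s))"
        using e by (intro gain_perspective_concave[OF x s uw]) (simp_all add: h[OF s])
      then have "h s (u *\<^sub>R \<theta> + w *\<^sub>R \<theta>') \<le> u * h s \<theta> + w * h s \<theta>' + (u + w) * e"
        by (simp add: h[OF s] algebra_simps)
      then show "h s (u *\<^sub>R \<theta> + w *\<^sub>R \<theta>') \<le> u * h s \<theta> + w * h s \<theta>' + e" using uw by simp
    qed
  qed simp
  define gr where "gr = (\<lambda>l \<theta>. real_of_ereal (g l \<theta>))"
  define C where "C = (\<lambda>l. effective_dom (g l))"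
  have gr: "g l \<theta> = ereal (gr l \<theta>)" if "l \<in> {1..L}" "\<theta> \<in> C l" for l \<theta>
    using proper_convex_lsc_not_MInf[OF g_convex[OF that(1)], of \<theta>] that(2)
    by (cases "g l \<theta>") (auto simp: C_def effective_dom_def gr_def)
  have Cconv: "convex (C l)" if l: "l \<in> {1..L}" for l
    unfolding convex_def
  proof (intro ballI allI impI)
    fix \<theta> \<theta>' and u w :: real assume A: "\<theta> \<in> C l" "\<theta>' \<in> C l" "0 \<le> u" "0 \<le> w" "u + w = 1"
    have "g l (u *\<^sub>R \<theta> + w *\<^sub>R \<theta>') \<le> ereal (u * gr l \<theta> + w * gr l \<theta>')"
      using g_convex[OF l] A gr[OF l] by (intro convex_fun_ineq) (auto simp: proper_convex_lsc_def)
    then show "u *\<^sub>R \<theta> + w *\<^sub>R \<theta>' \<in> C l" by (auto simp: C_def effective_dom_def intro: le_less_trans)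
  qed
  have grconv: "convex_on (C l) (gr l)" if l: "l \<in> {1..L}" for l
    unfolding convex_on_def
  proof (intro conjI ballI allI impI Cconv l)
    fix \<theta> \<theta>' and u w :: real assume A: "\<theta> \<in> C l" "\<theta>' \<in> C l" "0 \<le> u" "0 \<le> w" "u + w = 1"
    have "g l (u *\<^sub>R \<theta> + w *\<^sub>R \<theta>') \<le> ereal (u * gr l \<theta> + w * gr l \<theta>')"
      using g_convex[OF l] A gr[OF l] by (intro convex_fun_ineq) (auto simp: proper_convex_lsc_def)
    moreover have "u *\<^sub>R \<theta> + w *\<^sub>R \<theta>' \<in> C l" using Cconv[OF l] A by (simp add: convexD)
    ultimately show "gr l (u *\<^sub>R \<theta> + w *\<^sub>R \<theta>') \<le> u * gr l \<theta> + w * gr l \<theta>'" using gr[OF l] by simp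
  qed
  have ri: "relint_point (C l) \<theta>s" if l: "l \<in> {1..L}" for l
    using sl l by (intro relint_point_rel_interior Cconv) (auto simp: slater_point_def C_def)
  define N where "N = {l\<in>{1..L}. \<not> linear_constraint (g l)}"
  define M where "M = {l\<in>{1..L}. linear_constraint (g l)}"
  have NM: "N \<union> M = {1..L}" "N \<inter> M = {}" "finite N" "finite M" by (auto simp: N_def M_def)
  define DC where "DC = (\<Inter>l\<in>{1..L}. C l)"
  have DC: "convex DC" unfolding DC_def using Cconv by (intro convex_INT) auto
  have riDC: "relint_point DC \<theta>s" unfolding DC_def using ri Cconv by (intro relint_point_INT) auto
  have sC: "\<theta>s \<in> C l" if "l \<in> {1..L}" for l using ri[OF that] by (simp add: relint_point_def)
  have grs: "gr l \<theta>s \<le> 0" "\<not> linear_constraint (g l) \<Longrightarrow> gr l \<theta>s < 0" if l: "l \<in> {1..L}" for l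
  proof -
    have "g l \<theta>s \<le> 0" "\<not> linear_constraint (g l) \<longrightarrow> g l \<theta>s < 0"
      using sl l unfolding slater_point_def by blast+
    then show "gr l \<theta>s \<le> 0" "\<not> linear_constraint (g l) \<Longrightarrow> gr l \<theta>s < 0"
      unfolding gr[OF l sC[OF l]] by simp_all
  qed
  have "\<exists>m. (\<forall>l\<in>N \<union> M. 0 \<le> m l) \<and> (\<forall>\<theta>\<in>DC. v \<le> (\<Sum>s\<in>S. h s \<theta>) + (\<Sum>l\<in>N \<union> M. m l * gr l \<theta>))"
  proof (rule slater_multipliers[OF NM(3,4,2) _ riDC])
    have "convex_on UNIV (\<lambda>\<theta>. 0 + (\<Sum>s\<in>S. 1 * h s \<theta>))"
      using hconv by (intro convex_on_combination) (auto simp: convex_on_def)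
    then show "convex_on DC (\<lambda>\<theta>. \<Sum>s\<in>S. h s \<theta>)" using DC convex_on_subset by auto
    show "convex_on DC (gr l) \<and> gr l \<theta>s < 0" if "l \<in> N" for l
    proof -
      have l: "l \<in> {1..L}" "\<not> linear_constraint (g l)" using that by (auto simp: N_def)
      have "DC \<subseteq> C l" using l(1) by (auto simp: DC_def)
      then show ?thesis using convex_on_subset[OF grconv[OF l(1)] _ DC] grs(2)[OF l] by blast
    qed
    show "affine_fun (gr l) \<and> gr l \<theta>s \<le> 0" if lM: "l \<in> M" for l
    proof -
      obtain a b where ab: "\<forall>\<theta>. g l \<theta> = ereal (a \<bullet> \<theta> + b)"
        using lM unfolding M_def linear_constraint_def by blast
      have "u * b + w * b = b" if "u + w = 1" for u w :: real
        using that by (simp add: distrib_right[symmetric])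
      then have "affine_fun (gr l)"
        using ab by (auto simp: gr_def affine_fun_def inner_add_right algebra_simps)
      then show ?thesis using lM grs(1)[of l] by (auto simp: M_def)
    qed
    fix \<theta> assume \<theta>: "\<theta> \<in> DC" "\<forall>l\<in>N \<union> M. gr l \<theta> \<le> 0"
    have "g l \<theta> \<le> 0" if l: "l \<in> {1..L}" for l
      using \<theta> gr[OF l] l unfolding NM(1) by (auto simp: DC_def zero_ereal_def)
    then have "G \<theta> x \<le> ereal (- v)" using v by (simp add: \<Theta>_eq)
    moreover have "G \<theta> x = ereal (\<Sum>s\<in>S. - h s \<theta>)"
      unfolding G_def perspective_sum_def sum_ereal[symmetric] by (intro sum.cong) (simp_all add: h)
    ultimately show "v \<le> (\<Sum>s\<in>S. h s \<theta>)" by (simp add: sum_negf)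
  qed
  then obtain m where m: "\<forall>l\<in>{1..L}. 0 \<le> m l"
    "\<forall>\<theta>\<in>DC. v \<le> (\<Sum>s\<in>S. h s \<theta>) + (\<Sum>l=1..L. m l * gr l \<theta>)" unfolding NM(1) by blast
  \<comment> \<open>Loss terms and weighted constraints form one family over a disjoint sum; the
    former are real everywhere, the latter on the domains of the \<open>g l\<close>.\<close>
  define T where "T = S <+> {1..L}"
  define F where "F = (\<lambda>k. case k of Inl s \<Rightarrow> h s | Inr l \<Rightarrow> (\<lambda>\<theta>. m l * gr l \<theta>))"
  define E :: "(nat \<times> nat) + nat \<Rightarrow> (real^'m) set" where "E = (\<lambda>k. case k of Inl s \<Rightarrow> UNIV | Inr l \<Rightarrow> C l)"
  have sumT: "(\<Sum>k\<in>T. H k) = (\<Sum>s\<in>S. H (Inl s)) + (\<Sum>l=1..L. H (Inr l))"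
    for H :: "(nat \<times> nat) + nat \<Rightarrow> 'z::comm_monoid_add"
    unfolding T_def by (simp add: sum.Plus finite_S)
  have "\<exists>y a. (\<forall>k\<in>T. \<forall>\<theta>\<in>E k. y k \<bullet> \<theta> + a k \<le> F k \<theta>) \<and> (\<Sum>k\<in>T. y k) = 0 \<and> v \<le> (\<Sum>k\<in>T. a k)"
  proof (rule convex_sum_decompose_finite)
    show "finite T" unfolding T_def by (simp add: finite_S)
    show "convex_on (E k) (F k) \<and> relint_point (E k) \<theta>s" if "k \<in> T" for k
    proof -
      have "relint_point UNIV \<theta>s" by (auto simp: relint_point_def intro: exI[of _ 1])
      then show ?thesis
        using that hconv grconv ri m(1) by (auto simp: T_def E_def F_def intro!: convex_on_cmul)
    qed
    fix \<theta> assume "\<forall>k\<in>T. \<theta> \<in> E k"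
    then have "\<theta> \<in> E (Inr l)" if "l \<in> {1..L}" for l using that unfolding T_def by blast
    then have "\<theta> \<in> DC" by (auto simp: E_def DC_def)
    then show "v + 0 \<bullet> \<theta> \<le> (\<Sum>k\<in>T. F k \<theta>)" using m(2) by (simp add: sumT F_def)
  qed
  then obtain y a where ya: "\<forall>k\<in>T. \<forall>\<theta>\<in>E k. y k \<bullet> \<theta> + a k \<le> F k \<theta>" "(\<Sum>k\<in>T. y k) = 0" "v \<le> (\<Sum>k\<in>T. a k)" by blast
  have 1: "perspective (cgain s) (fst (x s)) (y (Inl s), snd (x s)) \<le> ereal (- a (Inl s))" if s: "s \<in> S" for s
  proof -
    have "y (Inl s) \<bullet> \<theta> + a (Inl s) \<le> h s \<theta>" for \<theta>
      using ya(1)[rule_format, of "Inl s" \<theta>] s by (simp add: T_def E_def F_def InlI)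
    then have "- h s \<theta> \<le> - a (Inl s) - y (Inl s) \<bullet> \<theta>" for \<theta> by (smt (verit))
    then show ?thesis unfolding perspective_cgain_le_iff[OF x s] h[OF s] by simp
  qed
  have 2: "perspective (conjugate (g l)) (m l) (y (Inr l)) \<le> ereal (- a (Inr l))" if l: "l \<in> {1..L}" for l
  proof -
    have ml: "m l \<ge> 0" using m(1) l by blast
    have "u \<bullet> y (Inr l) - m l * t \<le> - a (Inr l)" if "g l u \<le> ereal t" for u t
    proof -
      have u: "u \<in> C l" using that by (auto simp: C_def effective_dom_def intro: le_less_trans)
      then have "y (Inr l) \<bullet> u + a (Inr l) \<le> m l * gr l u"
        using ya(1)[rule_format, of "Inr l" u] l by (simp add: T_def E_def F_def InrI)
      also have "\<dots> \<le> m l * t" using that gr[OF l u] ml by (intro mult_left_mono) auto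
      finally show ?thesis by (simp add: inner_commute)
    qed
    then show ?thesis unfolding perspective_conjugate_le_iff[OF g_convex[OF l] ml] by blast
  qed
  define q where "q = (\<lambda>i j. fst (x (i, j)))"
  define \<xi> where "\<xi> = (\<lambda>i j. snd (x (i, j)))"
  define \<alpha> where "\<alpha> = (\<lambda>i j. y (Inl (i, j)))"
  define \<beta> where "\<beta> = (\<lambda>l. y (Inr l))"
  have xeq: "(\<lambda>s. if s \<in> S then (q (fst s) (snd s), \<xi> (fst s) (snd s)) else 0) = x"
    using D_outside[OF x] by (auto simp: q_def \<xi>_def)
  have "program_feasible I J K L Z c \<epsilon> p zh f q m \<xi> \<alpha> \<beta>"
    unfolding program_feasible_iff xeq using x m(1) ya(2) by (simp add: sumT \<alpha>_def \<beta>_def)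
  moreover have "ereal v \<le> program_objective I J L zh li g q m \<xi> \<alpha> \<beta>"
  proof -
    have "(\<Sum>s\<in>S. perspective (cgain s) (q (fst s) (snd s)) (\<alpha> (fst s) (snd s), \<xi> (fst s) (snd s)))
        \<le> ereal (\<Sum>s\<in>S. - a (Inl s))"
      using 1 by (intro sum_ereal_mono_real) (simp add: q_def \<xi>_def \<alpha>_def)
    moreover have "(\<Sum>l=1..L. perspective (conjugate (g l)) (m l) (\<beta> l)) \<le> ereal (\<Sum>l=1..L. - a (Inr l))"
      using 2 by (intro sum_ereal_mono_real) (simp add: \<beta>_def)
    ultimately have "ereal (- (\<Sum>s\<in>S. - a (Inl s)) - (\<Sum>l=1..L. - a (Inr l))) \<le>
        program_objective I J L zh li g q m \<xi> \<alpha> \<beta>"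
      unfolding program_objective_eq by (rule ereal_le_uminus_diff)
    moreover have "v \<le> - (\<Sum>s\<in>S. - a (Inl s)) - (\<Sum>l=1..L. - a (Inr l))"
      using ya(3) by (simp add: sumT sum_negf)
    ultimately show ?thesis by (meson ereal_less_eq(3) order_trans)
  qed
  ultimately show ?thesis by blast
qed

section \<open>From couplings to the finite program\<close>

definition rl :: "real^'m \<Rightarrow> real^'d \<Rightarrow> real" where "rl \<theta> z = real_of_ereal (loss \<theta> z)"

lemma loss_attained:
  assumes "\<theta> \<in> \<Theta>" "z \<in> Z"
  shows "\<exists>i\<in>{1..I}. loss \<theta> z = li i \<theta> z"
proof -
  have "Max ((\<lambda>i. li i \<theta> z) ` {1..I}) \<in> (\<lambda>i. li i \<theta> z) ` {1..I}"
    using I by (intro Max_in) auto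
  then show ?thesis unfolding loss_max[OF assms] by blast
qed

lemma li_le_loss: "\<theta> \<in> \<Theta> \<Longrightarrow> z \<in> Z \<Longrightarrow> i \<in> {1..I} \<Longrightarrow> li i \<theta> z \<le> loss \<theta> z"
  by (simp add: loss_max)

lemma loss_eq_rl:
  assumes "\<theta> \<in> \<Theta>" "z \<in> Z"
  shows "loss \<theta> z = ereal (rl \<theta> z)"
proof -
  obtain i where "i \<in> {1..I}" "loss \<theta> z = li i \<theta> z" using loss_attained[OF assms] by blast
  then have "\<bar>loss \<theta> z\<bar> \<noteq> \<infinity>" using li_finite assms by metis
  then show ?thesis by (auto simp: rl_def)
qed

lemma space_MZ: "space (borel_on Z) = Z" by (simp add: space_restrict_space)

lemma li_measurable:
  assumes i: "i \<in> {1..I}"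
  shows "li i \<theta> \<in> borel_measurable borel"
proof -
  have "(\<lambda>z. - li i \<theta> z) \<in> borel_measurable borel"
  proof (rule borel_measurableI_le)
    fix w :: ereal
    have "closed {z. - li i \<theta> z \<le> w}"
      using loss_concave[OF i, of \<theta>] unfolding proper_convex_lsc_def lsc_on_UNIV_iff by blast
    then show "{z\<in>space borel. - li i \<theta> z \<le> w} \<in> sets borel" by simp
  qed
  then have "(\<lambda>z. - (- li i \<theta> z)) \<in> borel_measurable borel" by (rule borel_measurable_uminus_ereal)
  then show ?thesis by simp
qed

lemma li_measurable_MZ: "i \<in> {1..I} \<Longrightarrow> li i \<theta> \<in> borel_measurable (borel_on Z)"
  by (intro measurable_restrict_space1 li_measurable)

lemma loss_measurable:
  assumes \<theta>: "\<theta> \<in> \<Theta>"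
  shows "loss \<theta> \<in> borel_measurable (borel_on Z)"
proof -
  have "(\<lambda>z. Max ((\<lambda>i. li i \<theta> z) ` {1..I})) \<in> borel_measurable (borel_on Z)"
    by (rule borel_measurable_Max) (auto intro: li_measurable_MZ)
  moreover have "loss \<theta> z = Max ((\<lambda>i. li i \<theta> z) ` {1..I})" if "z \<in> space (borel_on Z)" for z
    using that \<theta> by (simp add: loss_max space_MZ)
  ultimately show ?thesis by (rule measurable_cong[THEN iffD2, rotated])
qed

lemma rl_measurable: "\<theta> \<in> \<Theta> \<Longrightarrow> rl \<theta> \<in> borel_measurable (borel_on Z)"
  unfolding rl_def using loss_measurable by (intro borel_measurable_real_of_ereal)

lemma distributionsD:
  assumes "Q \<in> distributions Z"
  shows "sets Q = sets (borel_on Z)" "prob_space Q" "space Q = Z"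
  using assms sets_eq_imp_space_eq[of Q "borel_on Z"]
  by (auto simp: distributions_def space_prob_algebra space_MZ)

text \<open>Uniform integrability gives a level beyond which the tail contributes less than 1; below
  it the integral is at most \<open>b\<close>, as \<open>Q\<close> has mass 1.\<close>

lemma negative_part_finite:
  assumes Q: "Q \<in> ambiguity_set Z c \<epsilon> P" and \<theta>: "\<theta> \<in> \<Theta>"
  shows "(\<integral>\<^sup>+ z. e2ennreal (- loss \<theta> z) \<partial>Q) < \<infinity>"
proof -
  have Qd: "Q \<in> distributions Z" using Q by (simp add: ambiguity_set_def)
  interpret prob_space Q using distributionsD[OF Qd] by blast
  obtain U where U: "\<theta> \<in> U" "uniformly_integrable_family Q (U \<inter> \<Theta>) (\<lambda>\<theta> z. e2ennreal (- min 0 (loss \<theta> z)))"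
    using unif_integrable[OF Q \<theta>] by blast
  have eq: "e2ennreal (- min 0 x) = e2ennreal (- x)" for x :: ereal
  proof (cases "x \<le> 0")
    case False
    then have "- x \<le> 0" by (simp add: ereal_uminus_le_reorder)
    then show ?thesis using False by (simp add: e2ennreal_neg)
  qed (simp add: min_absorb2)
  define \<phi> where "\<phi> = (\<lambda>t z. e2ennreal (- loss t z))"
  have lim: "((\<lambda>b::real. SUP t\<in>U \<inter> \<Theta>. \<integral>\<^sup>+ z. \<phi> t z * indicator {z. \<phi> t z > ennreal b} z \<partial>Q) \<longlongrightarrow> 0) at_top"
    using U(2) unfolding uniformly_integrable_family_def eq \<phi>_def .
  have "eventually (\<lambda>b::real. (SUP t\<in>U \<inter> \<Theta>. \<integral>\<^sup>+ z. \<phi> t z * indicator {z. \<phi> t z > ennreal b} z \<partial>Q) < 1) at_top"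
    by (rule order_tendstoD(2)[OF lim]) simp
  then obtain b :: real where b: "(SUP t\<in>U \<inter> \<Theta>. \<integral>\<^sup>+ z. \<phi> t z * indicator {z. \<phi> t z > ennreal b} z \<partial>Q) < 1"
    by (auto simp: eventually_at_top_linorder)
  have m: "\<phi> \<theta> \<in> borel_measurable Q"
    unfolding \<phi>_def using loss_measurable[OF \<theta>] distributionsD(1)[OF Qd]
    by (simp cong: measurable_cong_sets)
  have "(\<integral>\<^sup>+ z. \<phi> \<theta> z * indicator {z. \<phi> \<theta> z > ennreal b} z \<partial>Q) \<le>
      (SUP t\<in>U \<inter> \<Theta>. \<integral>\<^sup>+ z. \<phi> t z * indicator {z. \<phi> t z > ennreal b} z \<partial>Q)"
    using U(1) \<theta> by (intro SUP_upper) auto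
  then have le1: "(\<integral>\<^sup>+ z. \<phi> \<theta> z * indicator {z. \<phi> \<theta> z > ennreal b} z \<partial>Q) < 1" using b by (rule le_less_trans)
  have "(\<integral>\<^sup>+ z. \<phi> \<theta> z \<partial>Q) \<le> (\<integral>\<^sup>+ z. ennreal b + \<phi> \<theta> z * indicator {z\<in>space Q. \<phi> \<theta> z > ennreal b} z \<partial>Q)"
    by (intro nn_integral_mono) (auto simp: indicator_def not_less intro: add_increasing2)
  also have "\<dots> = ennreal b + (\<integral>\<^sup>+ z. \<phi> \<theta> z * indicator {z\<in>space Q. \<phi> \<theta> z > ennreal b} z \<partial>Q)"
  proof (subst nn_integral_add)
    have "{z\<in>space Q. \<phi> \<theta> z > ennreal b} \<in> sets Q" using m by measurable
    then show "(\<lambda>z. \<phi> \<theta> z * indicator {z\<in>space Q. \<phi> \<theta> z > ennreal b} z) \<in> borel_measurable Q"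
      using m by measurable
  qed (simp_all add: emeasure_space_1)
  also have "(\<integral>\<^sup>+ z. \<phi> \<theta> z * indicator {z\<in>space Q. \<phi> \<theta> z > ennreal b} z \<partial>Q) =
      (\<integral>\<^sup>+ z. \<phi> \<theta> z * indicator {z. \<phi> \<theta> z > ennreal b} z \<partial>Q)"
    by (intro nn_integral_cong) (simp add: indicator_def)
  also have "ennreal b + \<dots> < \<infinity>" using le1 by (auto simp: less_top[symmetric])
  finally show ?thesis by (simp add: \<phi>_def)
qed

section \<open>Shares of coinciding atoms\<close>

definition pw :: "real^'d \<Rightarrow> real" where
  "pw v = (\<Sum>j=1..J. if zh j = v then p j else 0)"

text \<open>The atoms \<open>zh j\<close> need not be distinct; \<open>\<kappa> j\<close> is the share of index \<open>j\<close> in the mass at \<open>v\<close>.\<close>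

definition \<kappa> :: "nat \<Rightarrow> real^'d \<Rightarrow> real" where
  "\<kappa> j v = p j / pw (zh j) * indicator {zh j} v"

lemma p_le_pw:
  assumes j: "j \<in> {1..J}"
  shows "p j \<le> pw (zh j)"
proof -
  have "(if zh j = zh j then p j else 0) \<le> (\<Sum>i=1..J. if zh i = zh j then p i else 0)"
    using j atoms by (intro member_le_sum) (auto simp: less_imp_le)
  then show ?thesis by (simp add: pw_def)
qed

lemma pw_pos: "j \<in> {1..J} \<Longrightarrow> 0 < pw (zh j)"
  using p_le_pw atoms by (meson less_le_trans)

lemma \<kappa>_bounds: "j \<in> {1..J} \<Longrightarrow> 0 \<le> \<kappa> j v \<and> \<kappa> j v \<le> 1"
  using p_le_pw[of j] pw_pos[of j] atoms[of j] by (auto simp: \<kappa>_def indicator_def)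

lemma \<kappa>_sum:
  assumes "v \<in> zh ` {1..J}"
  shows "(\<Sum>j=1..J. \<kappa> j v) = 1"
proof -
  obtain j0 where j0: "j0 \<in> {1..J}" "v = zh j0" using assms by blast
  have "(\<Sum>j=1..J. \<kappa> j v) = (\<Sum>j=1..J. (if zh j = v then p j else 0) / pw v)"
    by (intro sum.cong) (auto simp: \<kappa>_def indicator_def)
  also have "\<dots> = pw v / pw v" unfolding pw_def sum_divide_distrib ..
  finally show ?thesis using pw_pos[OF j0(1)] j0(2) by simp
qed

lemma singleton_MZ: "v \<in> Z \<Longrightarrow> {v} \<in> sets (borel_on Z)"
  using closed_Z by (auto simp: sets_restrict_space_iff)

lemma emeasure_P:
  assumes "A \<in> sets (borel_on Z)"
  shows "emeasure P A = ennreal (\<Sum>j=1..J. if zh j \<in> A then p j else 0)"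
proof -
  have "emeasure P A = (\<Sum>j=1..J. ennreal (if zh j \<in> A then p j else 0))"
    unfolding P_discrete[OF assms] using assms by (intro sum.cong) (auto simp: indicator_def)
  also have "\<dots> = ennreal (\<Sum>j=1..J. if zh j \<in> A then p j else 0)"
    using atoms by (intro sum_ennreal) (auto simp: less_imp_le)
  finally show ?thesis .
qed

lemma sum_p: "(\<Sum>j=1..J. p j) = 1"
proof -
  interpret prob_space P using distributionsD[OF P_distribution] by blast
  have "Z \<in> sets (borel_on Z)" using sets.top[of "borel_on Z"] by (simp add: space_MZ)
  then have "ennreal (\<Sum>j=1..J. if zh j \<in> Z then p j else 0) = 1"
    using emeasure_P emeasure_space_1 distributionsD[OF P_distribution] by simp
  moreover have "(\<Sum>j=1..J. if zh j \<in> Z then p j else 0) = (\<Sum>j=1..J. p j)"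
    using atoms by (intro sum.cong) auto
  ultimately show ?thesis by simp
qed

lemma AE_P_atom: "AE v in P. v \<in> zh ` {1..J}"
proof -
  have "finite (zh ` {1..J})" by simp
  then have "zh ` {1..J} \<in> sets borel" by (rule borel_closed[OF finite_imp_closed])
  then have N: "Z - zh ` {1..J} \<in> sets (borel_on Z)"
    using closed_Z by (auto simp: sets_restrict_space_iff)
  have "emeasure P (Z - zh ` {1..J}) = ennreal (\<Sum>j=1..J. 0)"
    unfolding emeasure_P[OF N] by (intro arg_cong[where f=ennreal] sum.cong) auto
  then show ?thesis
    using N distributionsD[OF P_distribution] by (intro AE_I[of _ _ "Z - zh ` {1..J}"]) auto
qed

lemma \<kappa>_measurable: "\<kappa> j \<in> borel_measurable borel"
  unfolding \<kappa>_def by measurable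

lemma \<kappa>_integral:
  assumes j: "j \<in> {1..J}"
  shows "(\<integral>v. \<kappa> j v \<partial>P) = p j"
proof -
  interpret prob_space P using distributionsD[OF P_distribution] by blast
  have s: "{zh j} \<in> sets (borel_on Z)" using singleton_MZ atoms[OF j] by blast
  have "emeasure P {zh j} = ennreal (pw (zh j))"
    unfolding emeasure_P[OF s] pw_def by simp
  then have m: "measure P {zh j} = pw (zh j)" using pw_pos[OF j] by (simp add: measure_def)
  have "(\<integral>v. \<kappa> j v \<partial>P) = p j / pw (zh j) * measure P ({zh j} \<inter> space P)"
    unfolding \<kappa>_def by simp
  also have "{zh j} \<inter> space P = {zh j}" using atoms[OF j] distributionsD[OF P_distribution] by auto
  finally show ?thesis using m pw_pos[OF j] by simp
qed

lemma couplingD: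
  assumes "\<pi> \<in> couplings Z Q P"
  shows "sets \<pi> = sets (borel_on Z \<Otimes>\<^sub>M borel_on Z)" "prob_space \<pi>" "space \<pi> = Z \<times> Z"
    "distr \<pi> (borel_on Z) fst = Q" "distr \<pi> (borel_on Z) snd = P"
  using assms sets_eq_imp_space_eq[of \<pi> "borel_on Z \<Otimes>\<^sub>M borel_on Z"]
  by (auto simp: couplings_def space_prob_algebra space_pair_measure space_MZ)

text \<open>
  Conditioning a coupling on the pair (index attaining the loss, atom of \<open>P\<close>) gives a point of
  the finite program; Jensen's inequality controls all perspectives.
\<close>

lemma coupling_point:
  assumes \<theta>: "\<theta> \<in> \<Theta>" and \<pi>: "\<pi> \<in> couplings Z Q P"
    and neg: "(\<integral>\<^sup>+ z. e2ennreal (- loss \<theta> z) \<partial>Q) < \<infinity>"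
    and e: "0 \<le> e" "(\<integral>\<^sup>+ (z, z'). c z z' \<partial>\<pi>) \<le> ennreal e"
  shows "integrable Q (rl \<theta>) \<and> (\<exists>x\<in>DD e. G \<theta> x \<le> ereal (- (\<integral>z. rl \<theta> z \<partial>Q)))"
proof -
  note sets_\<pi>[measurable_cong] = couplingD(1)[OF \<pi>]
  note space_\<pi> = couplingD(3)[OF \<pi>]
  interpret prob_space \<pi> by (rule couplingD(2)[OF \<pi>])
  have fstm[measurable]: "fst \<in> \<pi> \<rightarrow>\<^sub>M borel_on Z" and sndm[measurable]: "snd \<in> \<pi> \<rightarrow>\<^sub>M borel_on Z"
    by measurable
  have fstb[measurable]: "(\<lambda>w. fst w) \<in> borel_measurable \<pi>" and sndb[measurable]: "(\<lambda>w. snd w) \<in> borel_measurable \<pi>"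
    using measurable_compose[OF fstm measurable_restrict_space1[OF measurable_ident]]
      measurable_compose[OF sndm measurable_restrict_space1[OF measurable_ident]] by simp_all
  have fst_Z: "fst w \<in> Z" if "w \<in> space \<pi>" for w
    using that unfolding space_\<pi> by (simp add: mem_Times_iff)
  have "AE v in distr \<pi> (borel_on Z) snd. v \<in> zh ` {1..J}"
    unfolding couplingD(5)[OF \<pi>] by (rule AE_P_atom)
  then have atom: "AE w in \<pi>. snd w \<in> zh ` {1..J}" by (rule AE_distrD[OF sndm])
  define cr where "cr = (\<lambda>w. enn2real (c (fst w) (snd w)))"
  have cm: "(\<lambda>w. c (fst w) (snd w)) \<in> borel_measurable \<pi>"
    using lsc_borel_measurable[OF cost_lsc] by (simp add: case_prod_beta' cong: measurable_cong_sets)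
  have crm[measurable]: "cr \<in> borel_measurable \<pi>"
    unfolding cr_def using cm by measurable
  have ce: "(\<integral>\<^sup>+ w. c (fst w) (snd w) \<partial>\<pi>) \<le> ennreal e"
    using e(2) by (simp add: case_prod_beta')
  have cfin: "AE w in \<pi>. c (fst w) (snd w) \<noteq> \<infinity>"
    using cm le_less_trans[OF ce ennreal_less_top] by (intro nn_integral_noteq_infinite) auto
  have "(\<integral>\<^sup>+ w. ennreal (cr w) \<partial>\<pi>) \<le> (\<integral>\<^sup>+ w. c (fst w) (snd w) \<partial>\<pi>)"
    unfolding cr_def by (intro nn_integral_mono) (simp add: ennreal_enn2real_if)
  then have cre: "(\<integral>\<^sup>+ w. ennreal (cr w) \<partial>\<pi>) \<le> ennreal e" using ce by simp
  have cr_nonneg: "0 \<le> cr w" for w by (simp add: cr_def)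
  have cri: "integrable \<pi> cr"
    using le_less_trans[OF cre ennreal_less_top] cr_nonneg by (intro integrableI_nonneg crm) auto
  have cr_int: "(\<integral>w. cr w \<partial>\<pi>) \<le> e"
    using cre e(1) cr_nonneg nn_integral_eq_integral[OF cri] by simp
  \<comment> \<open>Selects the smallest index attaining the loss, which breaks ties measurably; the
    sets \<open>A i\<close> partition \<open>Z\<close>.\<close>
  define A where "A = (\<lambda>i. {z\<in>space (borel_on Z). li i \<theta> z = loss \<theta> z \<and> (\<forall>i'\<in>{1..<i}. li i' \<theta> z \<noteq> loss \<theta> z)})"
  have eqm: "{z\<in>space (borel_on Z). li i \<theta> z = loss \<theta> z} \<in> sets (borel_on Z)" if "i \<in> {1..I}" for i
    using borel_measurable_eq[OF li_measurable_MZ[OF that] loss_measurable[OF \<theta>]] .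
  have Am: "A i \<in> sets (borel_on Z)" if i: "i \<in> {1..I}" for i
  proof -
    have "A i = {z\<in>space (borel_on Z). li i \<theta> z = loss \<theta> z} -
        (\<Union>i'\<in>{1..<i}. {z\<in>space (borel_on Z). li i' \<theta> z = loss \<theta> z})"
      unfolding A_def by auto
    moreover have "(\<Union>i'\<in>{1..<i}. {z\<in>space (borel_on Z). li i' \<theta> z = loss \<theta> z}) \<in> sets (borel_on Z)"
      using i by (intro sets.finite_UN eqm) auto
    ultimately show ?thesis using eqm[OF i] by (simp add: sets.Diff)
  qed
  have A_sum: "(\<Sum>i=1..I. indicator (A i) z) = (1::real)" if z: "z \<in> Z" for z
  proof -
    define i0 where "i0 = (LEAST i. i \<in> {1..I} \<and> li i \<theta> z = loss \<theta> z)"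
    have ex: "\<exists>i. i \<in> {1..I} \<and> li i \<theta> z = loss \<theta> z" using loss_attained[OF \<theta> z] by metis
    have i0: "i0 \<in> {1..I}" "li i0 \<theta> z = loss \<theta> z"
      using LeastI_ex[OF ex] by (auto simp: i0_def)
    have least: "i0 \<le> i" if "i \<in> {1..I}" "li i \<theta> z = loss \<theta> z" for i
      unfolding i0_def by (rule Least_le) (use that in blast)
    have "indicator (A i) z = (if i = i0 then 1 else (0::real))" if i: "i \<in> {1..I}" for i
    proof (cases "i = i0")
      case True
      have "li i' \<theta> z \<noteq> loss \<theta> z" if "i' \<in> {1..<i0}" for i'
        using least[of i'] that i0(1) by auto
      then show ?thesis using True i0 z by (simp add: A_def space_MZ)
    next
      case False
      have "z \<notin> A i"
      proof
        assume zA: "z \<in> A i"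
        then have "i0 < i" using least[OF i] False by (auto simp: A_def)
        then show False using zA i0 by (auto simp: A_def)
      qed
      then show ?thesis using False by simp
    qed
    then have "(\<Sum>i=1..I. indicator (A i) z) = (\<Sum>i=1..I. if i = i0 then 1 else (0::real))"
      by (intro sum.cong) auto
    then show ?thesis using i0(1) by simp
  qed
  \<comment> \<open>The share of a coupled pair that is assigned to \<open>s\<close>. Almost
    everywhere these shares add up to 1, and a nonzero share determines both the selected index and
    the atom.\<close>
  define W :: "nat \<times> nat \<Rightarrow> (real^'d) \<times> (real^'d) \<Rightarrow> real" where "W = (\<lambda>s w. indicator (A (fst s)) (fst w) * \<kappa> (snd s) (snd w))"
  have Wm[measurable]: "W s \<in> borel_measurable \<pi>" if "s \<in> S" for s
  proof -
    have "(\<lambda>w. indicator (A (fst s)) (fst w) :: real) \<in> borel_measurable \<pi>"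
      using Am S_D[OF that] by (intro measurable_compose[OF fstm] borel_measurable_indicator) auto
    moreover have "(\<lambda>w. \<kappa> (snd s) (snd w)) \<in> borel_measurable \<pi>"
      by (rule measurable_compose[OF sndb \<kappa>_measurable])
    ultimately show ?thesis unfolding W_def by measurable
  qed
  have Wb: "0 \<le> W s w" "W s w \<le> 1" if "s \<in> S" for s w
    using \<kappa>_bounds[of "snd s" "snd w"] S_D[OF that] by (auto simp: W_def indicator_def)
  have Wi: "integrable \<pi> (W s)" if "s \<in> S" for s
    using Wb[OF that] by (intro integrable_const_bound[of _ 1] Wm that) auto
  have W_nz: "snd w = zh (snd s)" "fst w \<in> A (fst s)" if "W s w \<noteq> 0" for s w
    using that by (auto simp: W_def \<kappa>_def indicator_def split: if_splits)
  have W_sum: "AE w in \<pi>. (\<Sum>s\<in>S. W s w) = 1"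
  proof -
    have "AE w in \<pi>. w \<in> space \<pi>" by (rule AE_space)
    then show ?thesis using atom
    proof eventually_elim
      case (elim w)
      have "(\<Sum>s\<in>S. W s w) = (\<Sum>i=1..I. indicator (A i) (fst w)) * (\<Sum>j=1..J. \<kappa> j (snd w))"
        unfolding W_def sum_product sum_S ..
      then show ?case using A_sum[OF fst_Z[OF elim(1)]] \<kappa>_sum[OF elim(2)] by simp
    qed
  qed
  define X :: "nat \<times> nat \<Rightarrow> (real^'d) \<times> (real^'d) \<Rightarrow> real^'d" where "X = (\<lambda>s w. fst w - zh (snd s))"
  have cost_eq: "AE w in \<pi>. W s w \<noteq> 0 \<longrightarrow> cost s (X s w) \<le> ereal (cr w)" if "s \<in> S" for s
    using cfin AE_space[of \<pi>]
  proof eventually_elim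
    case (elim w)
    show ?case
    proof
      assume "W s w \<noteq> 0"
      then have "cost s (X s w) = enn2ereal (c (fst w) (snd w))"
        using W_nz(1)[of s w] fst_Z[OF elim(2)] by (simp add: cost_def X_def cost_section_def)
      then show "cost s (X s w) \<le> ereal (cr w)"
        using elim(1) by (cases "c (fst w) (snd w)") (auto simp: cr_def enn2ereal_ennreal)
    qed
  qed
  have WXi: "integrable \<pi> (\<lambda>w. W s w *\<^sub>R X s w)" if s: "s \<in> S" for s
  proof -
    \<comment> \<open>Linear growth of the cost makes the displacement integrable:
      \<open>norm (X s w) \<le> 1 + cr w / a\<close> almost everywhere that the weight is
      nonzero.\<close>
    obtain a where a: "a > 0" "\<forall>x. ereal (a * norm x - a) \<le> cost s x"
      using linear_growth[OF cost_pcl[OF s] cost_0[OF s]] cost_pos[OF s] by blast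
    show ?thesis
    proof (rule Bochner_Integration.integrable_bound)
      show "integrable \<pi> (\<lambda>w. 1 + cr w / a)" using cri by simp
      show "(\<lambda>w. W s w *\<^sub>R X s w) \<in> borel_measurable \<pi>"
        unfolding X_def using Wm[OF s] by measurable
      show "AE w in \<pi>. norm (W s w *\<^sub>R X s w) \<le> norm (1 + cr w / a)"
        using cost_eq[OF s]
      proof eventually_elim
        case (elim w)
        have nn: "0 \<le> cr w / a" using cr_nonneg a by simp
        show ?case
        proof (cases "W s w = 0")
          case False
          then have "a * norm (X s w) - a \<le> cr w" using elim a(2) ereal_le_real_trans by blast
          then have "norm (X s w) \<le> 1 + cr w / a" using a(1) by (simp add: field_simps)
          moreover have "norm (W s w *\<^sub>R X s w) \<le> 1 * norm (X s w)"
            using Wb[OF s] by (simp add: mult_left_le_one_le)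
          ultimately show ?thesis using nn by simp
        qed simp
      qed
    qed
  qed
  have rlm[measurable]: "(\<lambda>w. rl \<theta> (fst w)) \<in> borel_measurable \<pi>"
    by (rule measurable_compose[OF fstm rl_measurable[OF \<theta>]])
  have gain_eq: "W s w \<noteq> 0 \<longrightarrow> gain \<theta> s (X s w) = ereal (- rl \<theta> (fst w))" if "w \<in> space \<pi>" for s w
  proof
    assume "W s w \<noteq> 0"
    then have "li (fst s) \<theta> (fst w) = loss \<theta> (fst w)" using W_nz(2)[of s w] by (simp add: A_def)
    then show "gain \<theta> s (X s w) = ereal (- rl \<theta> (fst w))"
      using loss_eq_rl[OF \<theta> fst_Z[OF that]] by (simp add: gain_def X_def)
  qed
  \<comment> \<open>So far only the negative part of the loss has a finite integral. Affine
    minorants of the gains bound the loss from above by the integrable \<open>V\<close>, which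
    settles the positive part.\<close>
  have "\<exists>y b. affine_minorant (gain \<theta> s) y b" if "s \<in> S" for s
    using proper_convex_lsc_has_minorant[OF gain_pcl[OF that]] by metis
  then obtain y b where yb: "\<And>s. s \<in> S \<Longrightarrow> affine_minorant (gain \<theta> s) (y s) (b s)" by metis
  define V where "V = (\<lambda>w. \<Sum>s\<in>S. W s w * b s - y s \<bullet> (W s w *\<^sub>R X s w))"
  have Vi: "integrable \<pi> V"
    unfolding V_def
    by (intro Bochner_Integration.integrable_sum Bochner_Integration.integrable_diff
        integrable_mult_left integrable_inner_right Wi WXi)
  have rl_V: "AE w in \<pi>. rl \<theta> (fst w) \<le> V w"
    using W_sum AE_space[of \<pi>]
  proof eventually_elim
    case (elim w)
    have "W s w * rl \<theta> (fst w) \<le> W s w * b s - y s \<bullet> (W s w *\<^sub>R X s w)" if s: "s \<in> S" for s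
    proof (cases "W s w = 0")
      case False
      have "ereal (y s \<bullet> X s w - b s) \<le> gain \<theta> s (X s w)"
        using yb[OF s] by (simp add: affine_minorant_def)
      then have "rl \<theta> (fst w) \<le> b s - y s \<bullet> X s w" using gain_eq[OF elim(2)] False by simp
      then have "W s w * rl \<theta> (fst w) \<le> W s w * (b s - y s \<bullet> X s w)"
        using Wb[OF s] by (intro mult_left_mono)
      then show ?thesis by (simp add: algebra_simps)
    qed simp
    then have "(\<Sum>s\<in>S. W s w * rl \<theta> (fst w)) \<le> V w" unfolding V_def by (rule sum_mono)
    then show ?case using elim(1) by (simp add: sum_distrib_right[symmetric])
  qed
  have "(\<integral>\<^sup>+ w. ennreal (rl \<theta> (fst w)) \<partial>\<pi>) \<le> (\<integral>\<^sup>+ w. ennreal (V w) \<partial>\<pi>)"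
    using rl_V by (intro nn_integral_mono_AE) (auto simp: ennreal_leI)
  also have "\<dots> < \<infinity>" using Vi unfolding real_integrable_def by (auto simp: less_top[symmetric])
  finally have pos: "(\<integral>\<^sup>+ w. ennreal (rl \<theta> (fst w)) \<partial>\<pi>) < \<infinity>" .
  have "(\<integral>\<^sup>+ w. ennreal (- rl \<theta> (fst w)) \<partial>\<pi>) = (\<integral>\<^sup>+ z. ennreal (- rl \<theta> z) \<partial>Q)"
    unfolding couplingD(4)[OF \<pi>, symmetric]
    using rl_measurable[OF \<theta>] by (subst nn_integral_distr[OF fstm]) auto
  also have "\<dots> = (\<integral>\<^sup>+ z. e2ennreal (- loss \<theta> z) \<partial>Q)"
  proof (rule nn_integral_cong)
    fix z assume "z \<in> space Q"
    then have "z \<in> Z" unfolding couplingD(4)[OF \<pi>, symmetric] by (simp add: space_MZ)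
    then show "ennreal (- rl \<theta> z) = e2ennreal (- loss \<theta> z)"
      using loss_eq_rl[OF \<theta>] by (simp add: e2ennreal_eq_real)
  qed
  finally have rli: "integrable \<pi> (\<lambda>w. rl \<theta> (fst w))"
    using pos neg unfolding real_integrable_def by auto
  have Qi: "integrable Q (rl \<theta>)"
    unfolding couplingD(4)[OF \<pi>, symmetric] by (subst integrable_distr_eq[OF fstm rl_measurable[OF \<theta>]]) (rule rli)
  have Qint: "(\<integral>z. rl \<theta> z \<partial>Q) = (\<integral>w. rl \<theta> (fst w) \<partial>\<pi>)"
    unfolding couplingD(4)[OF \<pi>, symmetric] by (rule integral_distr[OF fstm rl_measurable[OF \<theta>]])
  define x where "x = (\<lambda>s. if s \<in> S then ((\<integral>w. W s w \<partial>\<pi>), (\<integral>w. W s w *\<^sub>R X s w \<partial>\<pi>)) else 0)"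
  have W_mult: "integrable \<pi> (\<lambda>w. W s w * h w)" if "s \<in> S" "integrable \<pi> h" for s and h :: "_ \<Rightarrow> real"
  proof (rule Bochner_Integration.integrable_bound[OF that(2)])
    show "(\<lambda>w. W s w * h w) \<in> borel_measurable \<pi>"
      using Wm[OF that(1)] borel_measurable_integrable[OF that(2)] by measurable
    show "AE w in \<pi>. norm (W s w * h w) \<le> norm (h w)"
      using Wb[OF that(1)] by (auto simp: abs_mult intro!: mult_left_le_one_le)
  qed
  have sum_W: "(\<Sum>s\<in>S. \<integral>w. W s w * h w \<partial>\<pi>) = (\<integral>w. h w \<partial>\<pi>)" if h: "integrable \<pi> h" for h :: "_ \<Rightarrow> real"
  proof -
    have "(\<Sum>s\<in>S. \<integral>w. W s w * h w \<partial>\<pi>) = (\<integral>w. (\<Sum>s\<in>S. W s w * h w) \<partial>\<pi>)"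
      using W_mult[OF _ h] by (intro Bochner_Integration.integral_sum[symmetric]) auto
    also have "\<dots> = (\<integral>w. h w \<partial>\<pi>)"
    proof (rule integral_cong_AE)
      show "(\<lambda>w. \<Sum>s\<in>S. W s w * h w) \<in> borel_measurable \<pi>"
        using W_mult[OF _ h] by (intro borel_measurable_integrable Bochner_Integration.integrable_sum) auto
      show "h \<in> borel_measurable \<pi>" using h by (rule borel_measurable_integrable)
      show "AE w in \<pi>. (\<Sum>s\<in>S. W s w * h w) = h w"
        using W_sum by eventually_elim (simp add: sum_distrib_right[symmetric])
    qed
    finally show ?thesis .
  qed
  have "x \<in> DD e"
    unfolding DD_def
  proof (intro CollectI conjI ballI allI impI)
    fix s assume s: "s \<in> S"
    show "0 \<le> fst (x s)" using s Wb(1)[OF s] by (simp add: x_def)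
    fix k assume k: "k \<in> {1..K}"
    have "perspective (constr k s) (\<integral>w. W s w \<partial>\<pi>) (\<integral>w. W s w *\<^sub>R X s w \<partial>\<pi>) \<le> ereal (\<integral>w. W s w * 0 \<partial>\<pi>)"
    proof (rule perspective_integral_le[OF constr_pcl[OF k] Wi[OF s] WXi[OF s]])
      show "AE w in \<pi>. W s w \<noteq> 0 \<longrightarrow> constr k s (X s w) \<le> ereal 0"
        using fst_Z k by (intro AE_I2) (auto simp: constr_def X_def Z_eq zero_ereal_def)
    qed (use Wb(1)[OF s] in auto)
    then show "perspective (constr k s) (fst (x s)) (snd (x s)) \<le> ereal 0"
      using s by (simp add: x_def)
  next
    fix j assume j: "j \<in> {1..J}"
    have "(\<Sum>i=1..I. fst (x (i, j))) = (\<Sum>i=1..I. \<integral>w. W (i, j) w \<partial>\<pi>)"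
      using j by (intro sum.cong) (auto simp: x_def S_def)
    also have "\<dots> = (\<integral>w. (\<Sum>i=1..I. W (i, j) w) \<partial>\<pi>)"
      using j by (intro Bochner_Integration.integral_sum[symmetric] Wi) (auto simp: S_def)
    also have "\<dots> = (\<integral>w. \<kappa> j (snd w) \<partial>\<pi>)"
    proof (rule Bochner_Integration.integral_cong)
      fix w assume "w \<in> space \<pi>"
      have "(\<Sum>i=1..I. W (i, j) w) = (\<Sum>i=1..I. indicator (A i) (fst w)) * \<kappa> j (snd w)"
        by (simp add: W_def sum_distrib_right)
      then show "(\<Sum>i=1..I. W (i, j) w) = \<kappa> j (snd w)" using A_sum[OF fst_Z[OF \<open>w \<in> space \<pi>\<close>]] by simp
    qed simp
    also have "\<dots> = (\<integral>v. \<kappa> j v \<partial>P)"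
      unfolding couplingD(5)[OF \<pi>, symmetric]
      by (rule integral_distr[OF sndm, symmetric]) (intro measurable_restrict_space1 \<kappa>_measurable)
    also have "\<dots> = p j" by (rule \<kappa>_integral[OF j])
    finally show "(\<Sum>i=1..I. fst (x (i, j))) = p j" .
  next
    have "perspective_sum S cost x \<le> ereal (\<Sum>s\<in>S. \<integral>w. W s w * cr w \<partial>\<pi>)"
      unfolding perspective_sum_def
    proof (rule sum_ereal_mono_real)
      fix s assume s: "s \<in> S"
      have "perspective (cost s) (\<integral>w. W s w \<partial>\<pi>) (\<integral>w. W s w *\<^sub>R X s w \<partial>\<pi>) \<le> ereal (\<integral>w. W s w * cr w \<partial>\<pi>)"
        using Wb(1)[OF s]
        by (intro perspective_integral_le cost_pcl Wi WXi W_mult cri cost_eq s AE_I2)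
      then show "perspective (cost s) (fst (x s)) (snd (x s)) \<le> ereal (\<integral>w. W s w * cr w \<partial>\<pi>)"
        using s by (simp add: x_def)
    qed
    also have "(\<Sum>s\<in>S. \<integral>w. W s w * cr w \<partial>\<pi>) = (\<integral>w. cr w \<partial>\<pi>)" by (rule sum_W[OF cri])
    also have "ereal (\<integral>w. cr w \<partial>\<pi>) \<le> ereal e" using cr_int by simp
    finally show "perspective_sum S cost x \<le> ereal e" .
  qed (simp add: x_def)
  moreover have "G \<theta> x \<le> ereal (- (\<integral>z. rl \<theta> z \<partial>Q))"
  proof -
    have ni: "integrable \<pi> (\<lambda>w. - rl \<theta> (fst w))" using rli by simp
    have "G \<theta> x \<le> ereal (\<Sum>s\<in>S. \<integral>w. W s w * (- rl \<theta> (fst w)) \<partial>\<pi>)"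
      unfolding G_def perspective_sum_def
    proof (rule sum_ereal_mono_real)
      fix s assume s: "s \<in> S"
      have "perspective (gain \<theta> s) (\<integral>w. W s w \<partial>\<pi>) (\<integral>w. W s w *\<^sub>R X s w \<partial>\<pi>) \<le> ereal (\<integral>w. W s w * (- rl \<theta> (fst w)) \<partial>\<pi>)"
      proof (rule perspective_integral_le[OF gain_pcl[OF s] Wi[OF s] WXi[OF s] W_mult[OF s ni]])
        show "AE w in \<pi>. 0 \<le> W s w" using Wb(1)[OF s] by simp
        show "AE w in \<pi>. W s w \<noteq> 0 \<longrightarrow> gain \<theta> s (X s w) \<le> ereal (- rl \<theta> (fst w))"
          using gain_eq by (intro AE_I2) auto
      qed
      then show "perspective (gain \<theta> s) (fst (x s)) (snd (x s)) \<le> ereal (\<integral>w. W s w * (- rl \<theta> (fst w)) \<partial>\<pi>)"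
        using s by (simp add: x_def)
    qed
    also have "(\<Sum>s\<in>S. \<integral>w. W s w * (- rl \<theta> (fst w)) \<partial>\<pi>) = (\<integral>w. - rl \<theta> (fst w) \<partial>\<pi>)"
      by (rule sum_W[OF ni])
    finally show ?thesis unfolding Qint by simp
  qed
  ultimately show ?thesis using Qi by blast
qed

section \<open>From the finite program to distributions\<close>

lemma coupling_marginal:
  assumes "\<pi> \<in> space (prob_algebra (borel_on Z \<Otimes>\<^sub>M borel_on Z))" "distr \<pi> (borel_on Z) snd = P"
    and "(\<integral>\<^sup>+ (z, z'). c z z' \<partial>\<pi>) \<le> ennreal \<epsilon>"
  shows "distr \<pi> (borel_on Z) fst \<in> ambiguity_set Z c \<epsilon> P"
proof -
  have \<pi>: "sets \<pi> = sets (borel_on Z \<Otimes>\<^sub>M borel_on Z)" "prob_space \<pi>"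
    using assms(1) by (auto simp: space_prob_algebra)
  have "fst \<in> \<pi> \<rightarrow>\<^sub>M borel_on Z" using measurable_fst by (simp add: \<pi>(1) cong: measurable_cong_sets)
  then have "distr \<pi> (borel_on Z) fst \<in> distributions Z"
    using prob_space.prob_space_distr[OF \<pi>(2)] by (simp add: distributions_def space_prob_algebra)
  moreover have "\<pi> \<in> couplings Z (distr \<pi> (borel_on Z) fst) P" using assms by (simp add: couplings_def)
  then have "transport_discrepancy Z c (distr \<pi> (borel_on Z) fst) P \<le> (\<integral>\<^sup>+ (z, z'). c z z' \<partial>\<pi>)"
    unfolding transport_discrepancy_def by (rule INF_lower)
  ultimately show ?thesis using assms(3) by (simp add: ambiguity_set_def)
qed

text \<open>An index with \<open>q i j = 0\<close> contributes a massless atom at \<open>zh j\<close>, since \<open>\<xi> / 0 = 0\<close>.\<close>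

lemma discrete_coupling:
  assumes x: "x \<in> DD e" and degenerate: "\<And>s. s \<in> S \<Longrightarrow> fst (x s) = 0 \<Longrightarrow> snd (x s) = 0"
  shows "\<exists>\<pi>\<in>space (prob_algebra (borel_on Z \<Otimes>\<^sub>M borel_on Z)).
    distr \<pi> (borel_on Z) snd = P \<and> (\<integral>\<^sup>+ (z, z'). c z z' \<partial>\<pi>) \<le> ennreal e \<and>
    (\<forall>\<theta>\<in>\<Theta>. (\<integral>\<^sup>+ z. e2ennreal (- loss \<theta> z) \<partial>(distr \<pi> (borel_on Z) fst)) < \<infinity> \<and>
      (\<forall>v. G \<theta> x \<le> ereal (- v) \<longrightarrow> ereal v \<le> expect (distr \<pi> (borel_on Z) fst) (loss \<theta>)))"
proof -
  define r where "r = (\<lambda>s. fst (x s))"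
  define z where "z = (\<lambda>s. zh (snd s) + snd (x s) /\<^sub>R r s)"
  \<comment> \<open>The measure lives on the index set, where masses stay separate even if atoms or
    target points coincide; the coupling is its image under \<open>T\<close>.\<close>
  define M where "M = point_measure S (\<lambda>s. ennreal (r s))"
  define T where "T = (\<lambda>s. (z s, zh (snd s)))"
  define \<pi> where "\<pi> = distr M (borel_on Z \<Otimes>\<^sub>M borel_on Z) T"
  have r: "0 \<le> r s" if "s \<in> S" for s using D_nonneg[OF x that] by (simp add: r_def)
  have zZ: "z s \<in> Z" if s: "s \<in> S" for s
  proof (cases "r s > 0")
    case True
    then show ?thesis using D_point[OF x s] by (simp add: z_def r_def)
  next
    case False
    then show ?thesis using r[OF s] zh_Z[OF s] by (simp add: z_def)
  qed
  have spM: "space M = S" by (simp add: M_def space_point_measure)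
  have Tm: "T \<in> M \<rightarrow>\<^sub>M borel_on Z \<Otimes>\<^sub>M borel_on Z"
    unfolding M_def using zZ zh_Z by (auto simp: T_def space_pair_measure space_MZ)
  have sum_r: "(\<Sum>s\<in>S. r s * h (snd s)) = (\<Sum>j=1..J. p j * h j)" for h :: "nat \<Rightarrow> real"
  proof -
    have "(\<Sum>s\<in>S. r s * h (snd s)) = (\<Sum>i=1..I. \<Sum>j=1..J. r (i, j) * h j)"
      using sum_S[of "\<lambda>i j. r (i, j) * h j"] by simp
    also have "\<dots> = (\<Sum>j=1..J. \<Sum>i=1..I. r (i, j) * h j)" by (rule sum.swap)
    also have "\<dots> = (\<Sum>j=1..J. p j * h j)"
      using D_mass[OF x] by (intro sum.cong) (simp_all add: sum_distrib_right[symmetric] r_def)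
    finally show ?thesis .
  qed
  have pM: "prob_space M"
  proof
    have "emeasure M (space M) = (\<Sum>s\<in>S. ennreal (r s))"
      unfolding spM by (simp add: M_def emeasure_point_measure_finite finite_S)
    also have "\<dots> = ennreal (\<Sum>s\<in>S. r s)" using r by (rule sum_ennreal)
    also have "(\<Sum>s\<in>S. r s) = 1" using sum_r[of "\<lambda>_. 1"] sum_p by simp
    finally show "emeasure M (space M) = 1" by simp
  qed
  have \<pi>: "\<pi> \<in> space (prob_algebra (borel_on Z \<Otimes>\<^sub>M borel_on Z))"
    using prob_space.prob_space_distr[OF pM Tm] by (simp add: \<pi>_def space_prob_algebra)
  have "distr \<pi> (borel_on Z) snd = P"
  proof (rule measure_eqI)
    show "sets (distr \<pi> (borel_on Z) snd) = sets P" using distributionsD(1)[OF P_distribution] by simp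
    fix A assume "A \<in> sets (distr \<pi> (borel_on Z) snd)"
    then have A: "A \<in> sets (borel_on Z)" by simp
    have "distr \<pi> (borel_on Z) snd = distr M (borel_on Z) (\<lambda>s. zh (snd s))"
      unfolding \<pi>_def by (subst distr_distr[OF measurable_snd Tm]) (simp add: T_def comp_def)
    moreover have zm: "(\<lambda>s. zh (snd s)) \<in> M \<rightarrow>\<^sub>M borel_on Z"
      unfolding M_def using zh_Z by (auto simp: space_MZ)
    ultimately have "emeasure (distr \<pi> (borel_on Z) snd) A = (\<integral>\<^sup>+ s. indicator A (zh (snd s)) \<partial>M)"
      using nn_integral_distr[OF zm, of "indicator A"] A by simp
    also have "\<dots> = (\<Sum>s\<in>S. ennreal (r s * indicator A (zh (snd s))))"
      unfolding M_def using finite_S by (simp add: nn_integral_point_measure_finite ennreal_mult'' ennreal_indicator)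
    also have "\<dots> = ennreal (\<Sum>s\<in>S. r s * indicator A (zh (snd s)))"
      using r by (intro sum_ennreal) simp
    also have "(\<Sum>s\<in>S. r s * indicator A (zh (snd s))) = (\<Sum>j=1..J. if zh j \<in> A then p j else 0)"
      unfolding sum_r[of "\<lambda>j. indicator A (zh j)"] by (intro sum.cong) auto
    finally show "emeasure (distr \<pi> (borel_on Z) snd) A = emeasure P A" using emeasure_P[OF A] by simp
  qed
  moreover have "(\<integral>\<^sup>+ (z, z'). c z z' \<partial>\<pi>) \<le> ennreal e"
  proof -
    have "(\<integral>\<^sup>+ (z, z'). c z z' \<partial>\<pi>) = (\<integral>\<^sup>+ s. c (z s) (zh (snd s)) \<partial>M)"
      unfolding \<pi>_def using lsc_borel_measurable[OF cost_lsc]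
      by (subst nn_integral_distr[OF Tm]) (simp_all add: T_def)
    also have "\<dots> = (\<Sum>s\<in>S. ennreal (r s) * c (z s) (zh (snd s)))"
      unfolding M_def by (simp add: nn_integral_point_measure_finite finite_S)
    also have "\<dots> \<le> ennreal e"
    proof -
      have "\<exists>t. (\<forall>s\<in>S. perspective (cost s) (fst (x s)) (snd (x s)) = ereal (t s)) \<and> (\<Sum>s\<in>S. t s) \<le> e"
        using D_cost[OF x] perspective_not_MInf[OF cost_pcl D_nonneg[OF x]]
        by (intro sum_ereal_le_split finite_S) (auto simp: perspective_sum_def)
      then obtain t where t: "\<forall>s\<in>S. perspective (cost s) (fst (x s)) (snd (x s)) = ereal (t s)" "(\<Sum>s\<in>S. t s) \<le> e" by blast
      have t0: "0 \<le> t s" if "s \<in> S" for s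
        using perspective_cost_nonneg[OF that D_nonneg[OF x that], of "snd (x s)"] t(1) that by simp
      have "ennreal (r s) * c (z s) (zh (snd s)) \<le> ennreal (t s)" if s: "s \<in> S" for s
      proof (cases "r s > 0")
        case True
        have "ereal (r s) * enn2ereal (c (z s) (zh (snd s))) = ereal (t s)"
          using t(1)[rule_format, OF s] True zZ[OF s] by (simp add: perspective_def r_def z_def cost_def cost_section_def)
        then show ?thesis using True
          by (cases "c (z s) (zh (snd s))") (auto simp: enn2ereal_ennreal ennreal_mult[symmetric])
      qed (use r[OF s] in simp)
      then have "(\<Sum>s\<in>S. ennreal (r s) * c (z s) (zh (snd s))) \<le> (\<Sum>s\<in>S. ennreal (t s))" by (rule sum_mono)
      also have "\<dots> = ennreal (\<Sum>s\<in>S. t s)" using t0 by (rule sum_ennreal)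
      finally show ?thesis using t(2) ennreal_leI order_trans by blast
    qed
    finally show ?thesis .
  qed
  moreover have "(\<integral>\<^sup>+ y. e2ennreal (- loss \<theta> y) \<partial>(distr \<pi> (borel_on Z) fst)) < \<infinity> \<and>
      (\<forall>v. G \<theta> x \<le> ereal (- v) \<longrightarrow> ereal v \<le> expect (distr \<pi> (borel_on Z) fst) (loss \<theta>))"
    if \<theta>: "\<theta> \<in> \<Theta>" for \<theta>
  proof -
    define Q where "Q = distr M (borel_on Z) z"
    have Q: "distr \<pi> (borel_on Z) fst = Q"
      unfolding \<pi>_def Q_def by (subst distr_distr[OF measurable_fst Tm]) (simp add: T_def comp_def)
    have zm: "z \<in> M \<rightarrow>\<^sub>M borel_on Z"
      unfolding M_def using zZ by (auto simp: space_MZ)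
    have "integrable M (\<lambda>s. rl \<theta> (z s))" unfolding M_def by (rule integrable_point_measure_finite[OF finite_S])
    then have Qi: "integrable Q (rl \<theta>)"
      unfolding Q_def by (subst integrable_distr_eq[OF zm rl_measurable[OF \<theta>]])
    have eq: "loss \<theta> y = ereal (rl \<theta> y)" if "y \<in> space Q" for y
      using that loss_eq_rl[OF \<theta>] by (simp add: Q_def space_MZ)
    have "(\<integral>\<^sup>+ y. e2ennreal (- loss \<theta> y) \<partial>Q) = (\<integral>\<^sup>+ y. ennreal (- rl \<theta> y) \<partial>Q)"
      using eq by (intro nn_integral_cong) (simp add: e2ennreal_eq_real)
    also have "\<dots> < \<infinity>" using Qi unfolding real_integrable_def by (auto simp: less_top[symmetric])
    finally have neg: "(\<integral>\<^sup>+ y. e2ennreal (- loss \<theta> y) \<partial>Q) < \<infinity>" .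
    have "expect Q (loss \<theta>) = ereal (\<integral>y. rl \<theta> y \<partial>Q)" by (rule expect_eq_integral[OF Qi eq])
    also have "(\<integral>y. rl \<theta> y \<partial>Q) = (\<integral>s. rl \<theta> (z s) \<partial>M)"
      unfolding Q_def by (rule integral_distr[OF zm rl_measurable[OF \<theta>]])
    also have "\<dots> = (\<Sum>s\<in>S. r s * rl \<theta> (z s))"
      unfolding M_def using r by (subst lebesgue_integral_point_measure_finite[OF finite_S]) auto
    finally have E: "expect Q (loss \<theta>) = ereal (\<Sum>s\<in>S. r s * rl \<theta> (z s))" .
    have "ereal v \<le> expect Q (loss \<theta>)" if v: "G \<theta> x \<le> ereal (- v)" for v
    proof -
      have "\<exists>t. (\<forall>s\<in>S. perspective (gain \<theta> s) (fst (x s)) (snd (x s)) = ereal (t s)) \<and> (\<Sum>s\<in>S. t s) \<le> - v"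
        using v perspective_not_MInf[OF gain_pcl D_nonneg[OF x]]
        by (intro sum_ereal_le_split finite_S) (auto simp: G_def perspective_sum_def)
      then obtain t where t: "\<forall>s\<in>S. perspective (gain \<theta> s) (fst (x s)) (snd (x s)) = ereal (t s)" "(\<Sum>s\<in>S. t s) \<le> - v" by blast
      \<comment> \<open>At positive weight the target point incurs at least the loss of index
        \<open>fst s\<close>, since the maximum dominates it. At weight 0 the displacement vanishes
        by \<open>degenerate\<close>, so no recession term remains without a matching atom.\<close>
      have "- t s \<le> r s * rl \<theta> (z s)" if s: "s \<in> S" for s
      proof (cases "r s > 0")
        case True
        obtain l where l: "li (fst s) \<theta> (z s) = ereal l" using li_finite zZ[OF s] S_D[OF s] by blast
        have "l \<le> rl \<theta> (z s)"
          using li_le_loss[OF \<theta> zZ[OF s], of "fst s"] S_D[OF s] l loss_eq_rl[OF \<theta> zZ[OF s]] by simp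
        then have "r s * l \<le> r s * rl \<theta> (z s)" using True by simp
        moreover have "t s = - (r s * l)"
          using t(1)[rule_format, OF s] True l by (simp add: perspective_def gain_def r_def z_def)
        ultimately show ?thesis by simp
      next
        case False
        then have r0: "r s = 0" using r[OF s] by simp
        then have "perspective (gain \<theta> s) (fst (x s)) (snd (x s)) = 0"
          using degenerate[OF s] perspective_zero_zero[OF gain_pcl[OF s]] by (simp add: r_def)
        then show ?thesis using t(1) s r0 by simp
      qed
      then have "(\<Sum>s\<in>S. - t s) \<le> (\<Sum>s\<in>S. r s * rl \<theta> (z s))" by (rule sum_mono)
      then show ?thesis unfolding E using t(2) by (simp add: sum_negf)
    qed
    then show ?thesis using neg unfolding Q by blast
  qed
  ultimately show ?thesis using \<pi> by blast
qed

text \<open>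
  Mixing a point with \<open>center\<close> frees transport budget and makes all weights positive.
\<close>

definition center :: "nat \<times> nat \<Rightarrow> real \<times> (real^'d)" where
  "center s = (if s \<in> S then (p (snd s) / real I, 0) else 0)"

lemma center_weight: "s \<in> S \<Longrightarrow> 0 < p (snd s) / real I"
  using atoms S_D I by (intro divide_pos_pos) auto

lemma center_D: "center \<in> DD 0"
  unfolding DD_def
proof (intro CollectI conjI ballI allI impI)
  fix s assume s: "s \<in> S"
  show "0 \<le> fst (center s)" using center_weight[OF s] s by (simp add: center_def)
  fix k assume k: "k \<in> {1..K}"
  have "perspective (constr k s) 1 0 \<le> ereal 0"
    using zh_Z[OF s] k by (simp add: perspective_one constr_def Z_eq zero_ereal_def)
  then have "perspective (constr k s) (p (snd s) / real I * 1) ((p (snd s) / real I) *\<^sub>R 0) \<le> ereal (p (snd s) / real I * 0)"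
    using center_weight[OF s] by (intro perspective_scale_le constr_pcl k) auto
  then show "perspective (constr k s) (fst (center s)) (snd (center s)) \<le> ereal 0"
    using s by (simp add: center_def)
next
  fix j assume j: "j \<in> {1..J}"
  have "(\<Sum>i=1..I. fst (center (i, j))) = (\<Sum>i=1..I. p j / real I)"
    using j by (intro sum.cong) (auto simp: center_def S_def)
  then show "(\<Sum>i=1..I. fst (center (i, j))) = p j" using I by simp
next
  have "perspective_sum S cost center \<le> ereal (\<Sum>s\<in>S. 0)"
    unfolding perspective_sum_def
  proof (rule sum_ereal_mono_real)
    fix s assume s: "s \<in> S"
    have "perspective (cost s) 1 0 \<le> ereal 0"
      using cost_0[OF s] by (simp add: perspective_one zero_ereal_def)
    then have "perspective (cost s) (p (snd s) / real I * 1) ((p (snd s) / real I) *\<^sub>R 0) \<le> ereal (p (snd s) / real I * 0)"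
      using center_weight[OF s] by (intro perspective_scale_le cost_pcl s) auto
    then show "perspective (cost s) (fst (center s)) (snd (center s)) \<le> ereal 0"
      using s by (simp add: center_def)
  qed
  then show "perspective_sum S cost center \<le> ereal 0" by simp
qed (simp add: center_def)

text \<open>Affine minorants of the losses at the atoms, averaged with the weights of
  \<open>center\<close>. Affine dependence on \<theta> is what a linearly growing expectation can
  compensate.\<close>

lemma center_G: "\<exists>b1 b2. \<forall>\<theta>. G \<theta> center \<le> ereal (b2 - b1 \<bullet> \<theta>)"
proof -
  have "\<exists>a b. affine_minorant (\<lambda>\<theta>. li (fst s) \<theta> (zh (snd s))) a b" if "s \<in> S" for s
    using proper_convex_lsc_has_minorant[OF loss_convex[OF _ zh_Z[OF that], of "fst s"]] S_D[OF that] by metis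
  then obtain a b where ab: "\<And>s. s \<in> S \<Longrightarrow> affine_minorant (\<lambda>\<theta>. li (fst s) \<theta> (zh (snd s))) (a s) (b s)" by metis
  define r where "r = (\<lambda>s::nat \<times> nat. p (snd s) / real I)"
  have "G \<theta> center \<le> ereal ((\<Sum>s\<in>S. r s * b s) - (\<Sum>s\<in>S. r s *\<^sub>R a s) \<bullet> \<theta>)" for \<theta>
  proof -
    have "G \<theta> center \<le> ereal (\<Sum>s\<in>S. r s * (b s - a s \<bullet> \<theta>))"
      unfolding G_def perspective_sum_def
    proof (rule sum_ereal_mono_real)
      fix s assume s: "s \<in> S"
      have "ereal (a s \<bullet> \<theta> - b s) \<le> li (fst s) \<theta> (zh (snd s))"
        using ab[OF s] by (simp add: affine_minorant_def)
      then have "gain \<theta> s 0 \<le> ereal (b s - a s \<bullet> \<theta>)"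
        by (cases "li (fst s) \<theta> (zh (snd s))") (auto simp: gain_def)
      then have "perspective (gain \<theta> s) (r s * 1) (r s *\<^sub>R 0) \<le> ereal (r s * (b s - a s \<bullet> \<theta>))"
        using center_weight[OF s] by (intro perspective_scale_le gain_pcl s) (auto simp: perspective_one r_def)
      then show "perspective (gain \<theta> s) (fst (center s)) (snd (center s)) \<le> ereal (r s * (b s - a s \<bullet> \<theta>))"
        using s by (simp add: center_def r_def)
    qed
    also have "(\<Sum>s\<in>S. r s * (b s - a s \<bullet> \<theta>)) = (\<Sum>s\<in>S. r s * b s) - (\<Sum>s\<in>S. r s *\<^sub>R a s) \<bullet> \<theta>"
      by (simp add: inner_sum_left right_diff_distrib sum_subtractf)
    finally show ?thesis .
  qed
  then show ?thesis by blast
qed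

text \<open>A budget strictly above \<open>\<epsilon>\<close> is granted because only the infimum
  over couplings is bounded.\<close>

lemma ambiguity_coupling:
  assumes Q: "Q \<in> ambiguity_set Z c \<epsilon> P" and e: "\<epsilon> < e"
  shows "\<exists>\<pi>\<in>couplings Z Q P. (\<integral>\<^sup>+ (z, z'). c z z' \<partial>\<pi>) \<le> ennreal e"
proof -
  have "transport_discrepancy Z c Q P \<le> ennreal \<epsilon>" using Q by (simp add: ambiguity_set_def)
  also have "\<dots> < ennreal e" using e eps by (simp add: ennreal_less_iff)
  finally show ?thesis unfolding transport_discrepancy_def INF_less_iff by (auto intro: less_imp_le)
qed

section \<open>The dual value is at most the program value\<close>

abbreviation program_value :: ereal where
  "program_value \<equiv> Sup {program_objective I J L zh li g q \<nu> \<xi> \<alpha> \<beta> | q \<nu> \<xi> \<alpha> \<beta>.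
     program_feasible I J K L Z c \<epsilon> p zh f q \<nu> \<xi> \<alpha> \<beta>}"

abbreviation dual_value :: ereal where
  "dual_value \<equiv> (SUP Q\<in>ambiguity_set Z c \<epsilon> P. INF \<theta>\<in>\<Theta>. expect Q (loss \<theta>))"

lemma program_ge_value:
  assumes "x \<in> D" "\<And>\<theta>. \<theta> \<in> \<Theta> \<Longrightarrow> G \<theta> x \<le> ereal (- v)"
  shows "ereal v \<le> program_value"
proof -
  obtain q \<nu> \<xi> \<alpha> \<beta> where feas: "program_feasible I J K L Z c \<epsilon> p zh f q \<nu> \<xi> \<alpha> \<beta>"
    and v: "ereal v \<le> program_objective I J L zh li g q \<nu> \<xi> \<alpha> \<beta>"
    using program_ge[OF assms] by blast
  have "program_objective I J L zh li g q \<nu> \<xi> \<alpha> \<beta> \<le> program_value"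
    using feas by (intro Sup_upper) blast
  with v show ?thesis by (rule order_trans)
qed

text \<open>If no point of \<open>D\<close> worked for all \<theta> at level \<open>w\<close>,
  minimax would give one \<theta> with \<open>G \<theta> x \<ge> - w\<close> throughout
  \<open>D\<close>. Conditioning a coupling of \<open>Q\<close> for this \<theta> and returning to
  the budget yields points of \<open>D\<close> whose value is arbitrarily close to, or below,
  \<open>- R\<close>, although \<open>w < R\<close>.\<close>

lemma dual_le_program: "dual_value \<le> program_value"
proof (rule SUP_least)
  fix Q assume Q: "Q \<in> ambiguity_set Z c \<epsilon> P"
  show "(INF \<theta>\<in>\<Theta>. expect Q (loss \<theta>)) \<le> program_value"
  proof (rule ccontr)
    assume "\<not> ?thesis"
    then have "program_value < (INF \<theta>\<in>\<Theta>. expect Q (loss \<theta>))" by (simp only: not_le)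
    from ereal_dense2[OF this] obtain w where
      w: "program_value < ereal w" "ereal w < (INF \<theta>\<in>\<Theta>. expect Q (loss \<theta>))" by (elim exE conjE)
    have "\<exists>x\<in>D. \<forall>\<theta>\<in>\<Theta>. G \<theta> x \<le> ereal (- w)"
    proof (rule ccontr)
      assume "\<not> ?thesis"
      then have "\<And>x. x \<in> D \<Longrightarrow> \<exists>\<theta>\<in>\<Theta>. ereal (- w) < G \<theta> x" by (metis not_le)
      from minimax_D[OF this] obtain \<theta> where \<theta>: "\<theta> \<in> \<Theta>" "\<forall>x\<in>D. ereal (- w) \<le> G \<theta> x" by blast
      define R where "R = (\<integral>z. rl \<theta> z \<partial>Q)"
      obtain b1 b2 where "\<forall>\<theta>. G \<theta> center \<le> ereal (b2 - b1 \<bullet> \<theta>)" using center_G by blast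
      then obtain g0 where g0: "G \<theta> center \<le> ereal g0" by blast
      have key: "integrable Q (rl \<theta>) \<and> - w \<le> (1 - t) * (- R) + t * g0" if t: "0 < t" "t < 1" for t
      proof -
        \<comment> \<open>The budget is enlarged exactly so that mixing with \<open>center\<close>,
          of cost 0 and weight \<open>t\<close>, restores \<open>\<epsilon>\<close>.\<close>
        have "\<epsilon> < \<epsilon> / (1 - t)" using t eps by (simp add: pos_less_divide_eq)
        then obtain \<pi> where \<pi>: "\<pi> \<in> couplings Z Q P" "(\<integral>\<^sup>+ (z, z'). c z z' \<partial>\<pi>) \<le> ennreal (\<epsilon> / (1 - t))"
          using ambiguity_coupling[OF Q] by blast
        have "0 \<le> \<epsilon> / (1 - t)" using t eps by simp
        from coupling_point[OF \<theta>(1) \<pi>(1) negative_part_finite[OF Q \<theta>(1)] this \<pi>(2)]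
        obtain x where x: "integrable Q (rl \<theta>)" "x \<in> DD (\<epsilon> / (1 - t))" "G \<theta> x \<le> ereal (- R)"
          unfolding R_def by blast
        define y where "y = (\<lambda>s. (1 - t) *\<^sub>R x s + t *\<^sub>R center s)"
        have "y \<in> DD ((1 - t) * (\<epsilon> / (1 - t)) + t * 0)"
          unfolding y_def using t by (intro convex_DD x(2) center_D) auto
        then have "y \<in> D" using t by simp
        moreover have "G \<theta> y \<le> ereal ((1 - t) * (- R) + t * g0)"
          unfolding y_def using t by (intro G_convex[OF x(2) center_D] x(3) g0) auto
        ultimately have "- w \<le> (1 - t) * (- R) + t * g0" using \<theta>(2) ereal_le_real_trans by blast
        then show ?thesis using x(1) by blast
      qed
      have "integrable Q (rl \<theta>)" using key[of "1/2"] by simp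
      moreover have "space Q = Z" using Q distributionsD by (auto simp: ambiguity_set_def)
      ultimately have "expect Q (loss \<theta>) = ereal R"
        unfolding R_def using loss_eq_rl[OF \<theta>(1)] by (intro expect_eq_integral) auto
      moreover have "ereal w < expect Q (loss \<theta>)" using w(2) \<theta>(1) by (meson INF_lower less_le_trans)
      ultimately have "w < R" by simp
      \<comment> \<open>With these choices the mixing error \<open>t * (R + g0)\<close> is at most
        half of the gap \<open>R - w\<close>.\<close>
      define k where "k = \<bar>R + g0\<bar> + 1"
      define t where "t = min (1/2) ((R - w) / (2 * k))"
      have k: "k > 0" by (simp add: k_def)
      have t: "0 < t" "t < 1" using \<open>w < R\<close> k by (auto simp: t_def min_def)
      have "t * (R + g0) \<le> t * k" using t by (intro mult_left_mono) (auto simp: k_def)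
      also have "t * k \<le> (R - w) / (2 * k) * k" using k by (intro mult_right_mono) (auto simp: t_def)
      also have "\<dots> = (R - w) / 2" using k by simp
      finally have "t * (R + g0) \<le> (R - w) / 2" .
      moreover have "- w \<le> - R + t * (R + g0)" using key[OF t] by (simp add: algebra_simps)
      ultimately show False using \<open>w < R\<close> by simp
    qed
    then obtain x where x: "x \<in> D" "\<And>\<theta>. \<theta> \<in> \<Theta> \<Longrightarrow> G \<theta> x \<le> ereal (- w)" by blast
    from x have "ereal w \<le> program_value" by (intro program_ge_value) auto
    then show False using w(1) leD by blast
  qed
qed

section \<open>The program value is at most the dual value\<close>

lemma dual_ge_degenerate:
  assumes x: "x \<in> D" and degenerate: "\<And>s. s \<in> S \<Longrightarrow> fst (x s) = 0 \<Longrightarrow> snd (x s) = 0"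
    and v: "\<And>\<theta>. \<theta> \<in> \<Theta> \<Longrightarrow> G \<theta> x \<le> ereal (- v)"
  shows "ereal v \<le> dual_value"
proof -
  obtain \<pi> where \<pi>: "\<pi> \<in> space (prob_algebra (borel_on Z \<Otimes>\<^sub>M borel_on Z))" "distr \<pi> (borel_on Z) snd = P"
    "(\<integral>\<^sup>+ (z, z'). c z z' \<partial>\<pi>) \<le> ennreal \<epsilon>"
    "\<forall>\<theta>\<in>\<Theta>. \<forall>v. G \<theta> x \<le> ereal (- v) \<longrightarrow> ereal v \<le> expect (distr \<pi> (borel_on Z) fst) (loss \<theta>)"
    using discrete_coupling[OF x degenerate] by blast
  have "ereal v \<le> (INF \<theta>\<in>\<Theta>. expect (distr \<pi> (borel_on Z) fst) (loss \<theta>))"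
    using \<pi>(4) v by (intro INF_greatest) blast
  then show ?thesis by (rule SUP_upper2[OF coupling_marginal[OF \<pi>(1,2,3)]])
qed

text \<open>A nonzero displacement at weight 0 spans a ray in \<open>Z\<close> along which the cost,
  being 0 at the atom, grows at most linearly. A compact \<open>Z\<close> contains no ray, and
  superlinear growth forbids the linear bound.\<close>

lemma recession_degenerate:
  assumes x: "x \<in> D" and s: "s \<in> S" and r: "fst (x s) = 0"
    and growth: "compact Z \<or> (\<forall>z'\<in>Z. ((\<lambda>z. cost_section Z c z' z / ereal (norm z)) \<longlongrightarrow> \<infinity>) at_infinity)"
  shows "snd (x s) = 0"
proof (rule ccontr)
  define d where "d = snd (x s)"
  assume "snd (x s) \<noteq> 0"
  then have d: "norm d > 0" by (simp add: d_def)
  define z where "z = zh (snd s)"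
  have ray: "z + t *\<^sub>R d \<in> Z" if "t \<ge> 0" for t
    unfolding z_def d_def by (rule D_ray[OF x s r that])
  have norm_ge: "norm (z + t *\<^sub>R d) \<ge> t * norm d - norm z" if "t \<ge> 0" for t
    using norm_triangle_ineq4[of "z + t *\<^sub>R d" z] that by simp
  show False
    using growth
  proof
    assume "compact Z"
    then obtain B where B: "\<forall>z\<in>Z. norm z \<le> B" using compact_imp_bounded bounded_iff by metis
    define t where "t = (\<bar>B\<bar> + norm z + 1) / norm d"
    have t: "t \<ge> 0" using d by (simp add: t_def)
    have "t * norm d = \<bar>B\<bar> + norm z + 1" using d by (simp add: t_def)
    then show False using B[rule_format, OF ray[OF t]] norm_ge[OF t] by linarith
  next
    assume "\<forall>z'\<in>Z. ((\<lambda>z. cost_section Z c z' z / ereal (norm z)) \<longlongrightarrow> \<infinity>) at_infinity"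
    then have lim: "((\<lambda>y. cost_section Z c z y / ereal (norm y)) \<longlongrightarrow> \<infinity>) at_infinity"
      using zh_Z[OF s] by (simp add: z_def)
    have "\<exists>t. (\<forall>s\<in>S. perspective (cost s) (fst (x s)) (snd (x s)) = ereal (t s)) \<and> (\<Sum>s\<in>S. t s) \<le> \<epsilon>"
      using D_cost[OF x] perspective_not_MInf[OF cost_pcl D_nonneg[OF x]]
      by (intro sum_ereal_le_split finite_S) (auto simp: perspective_sum_def)
    then obtain k where k: "perspective (cost s) 0 d \<le> ereal k"
      using s r unfolding d_def by (metis order_refl)
    have bound: "cost_section Z c z (z + t *\<^sub>R d) \<le> ereal (t * k)" if t: "t \<ge> 0" for t
    proof -
      have "cost s (0 + t *\<^sub>R d) \<le> ereal (0 + t * k)"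
        using cost_0[OF s] by (intro recession_le cost_pcl s k t) (simp add: zero_ereal_def)
      then show ?thesis by (simp add: cost_def z_def)
    qed
    \<comment> \<open>The factor 2 matches \<open>norm y \<ge> t * norm d / 2\<close> below: a cost
      ratio above \<open>C\<close> forces the cost above \<open>t * k\<close>.\<close>
    define C where "C = 2 * \<bar>k\<bar> / norm d + 1"
    have "eventually (\<lambda>y. cost_section Z c z y / ereal (norm y) > ereal C) at_infinity"
      using lim unfolding tendsto_PInfty by blast
    then obtain b where b: "\<And>y. norm y \<ge> b \<Longrightarrow> cost_section Z c z y / ereal (norm y) > ereal C"
      unfolding eventually_at_infinity by blast
    \<comment> \<open>Large enough that \<open>norm y\<close> exceeds the threshold \<open>b\<close>
      and that the atom \<open>z\<close> takes away at most half of
      \<open>t * norm d\<close>.\<close>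
    define t where "t = (\<bar>b\<bar> + 2 * norm z + 1) / norm d"
    have t: "t > 0" using d by (simp add: t_def add_nonneg_pos)
    have td: "t * norm d = \<bar>b\<bar> + 2 * norm z + 1" using d by (simp add: t_def)
    define y where "y = z + t *\<^sub>R d"
    have ny: "norm y \<ge> t * norm d - norm z" unfolding y_def by (rule norm_ge) (use t in simp)
    then have yb: "norm y \<ge> b" and y0: "norm y > 0" using td norm_ge_zero[of z] by linarith+
    have y2: "norm y \<ge> t * norm d / 2" using ny td norm_ge_zero[of z] by linarith
    have "ereal C < cost_section Z c z y / ereal (norm y)" by (rule b[OF yb])
    also have "\<dots> \<le> ereal (t * k) / ereal (norm y)"
      using bound[of t] t y0 unfolding y_def by (intro ereal_divide_right_mono) auto
    finally have "C * norm y < t * k" using y0 by (simp add: pos_less_divide_eq)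
    moreover have "t * \<bar>k\<bar> \<le> C * norm y"
    proof -
      have "t * \<bar>k\<bar> = 2 * \<bar>k\<bar> / norm d * (t * norm d / 2)" using d by simp
      also have "\<dots> \<le> C * (t * norm d / 2)" using t d by (intro mult_right_mono) (auto simp: C_def)
      also have "\<dots> \<le> C * norm y" using y2 by (intro mult_left_mono) (auto simp: C_def)
      finally show ?thesis .
    qed
    moreover have "t * k \<le> t * \<bar>k\<bar>" using t by (intro mult_left_mono) auto
    ultimately show False by linarith
  qed
qed

section \<open>Compensation by an inf-compact expectation\<close>

lemma ambiguity_distributions: "Q \<in> ambiguity_set Z c \<epsilon> P \<Longrightarrow> Q \<in> distributions Z"
  by (simp add: ambiguity_set_def)

lemma
  assumes Q: "Q \<in> ambiguity_set Z c \<epsilon> P" and \<theta>: "\<theta> \<in> \<Theta>"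
  shows expect_le_integrable: "expect Q (loss \<theta>) \<le> ereal a \<Longrightarrow> integrable Q (rl \<theta>)"
    and expect_integral: "integrable Q (rl \<theta>) \<Longrightarrow> expect Q (loss \<theta>) = ereal (\<integral>z. rl \<theta> z \<partial>Q)"
proof -
  note Qd = distributionsD[OF ambiguity_distributions[OF Q]]
  have m: "rl \<theta> \<in> borel_measurable Q"
    using rl_measurable[OF \<theta>] Qd(1) by (simp cong: measurable_cong_sets)
  have eq: "loss \<theta> z = ereal (rl \<theta> z)" if "z \<in> space Q" for z
    using that loss_eq_rl[OF \<theta>] Qd(3) by simp
  show "integrable Q (rl \<theta>)" if "expect Q (loss \<theta>) \<le> ereal a"
    using that by (intro integrable_of_expect[OF m eq negative_part_finite[OF Q \<theta>]]) (auto intro: le_less_trans)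
  show "expect Q (loss \<theta>) = ereal (\<integral>z. rl \<theta> z \<partial>Q)" if "integrable Q (rl \<theta>)"
    by (rule expect_eq_integral[OF that eq])
qed

lemma rl_convex:
  assumes z: "z \<in> Z" and \<theta>: "\<theta> \<in> \<Theta>" "\<theta>' \<in> \<Theta>" and uv: "0 \<le> u" "0 \<le> v" "u + v = 1"
  shows "rl (u *\<^sub>R \<theta> + v *\<^sub>R \<theta>') z \<le> u * rl \<theta> z + v * rl \<theta>' z"
proof -
  let ?t = "u *\<^sub>R \<theta> + v *\<^sub>R \<theta>'"
  have t: "?t \<in> \<Theta>" using convexD[OF convex_\<Theta> \<theta> uv] .
  obtain i where i: "i \<in> {1..I}" "loss ?t z = li i ?t z" using loss_attained[OF t z] by blast
  have "li i ?t z \<le> ereal (u * rl \<theta> z + v * rl \<theta>' z)"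
    using loss_convex[OF i(1) z] li_le_loss[OF \<theta>(1) z i(1)] li_le_loss[OF \<theta>(2) z i(1)] uv
    unfolding loss_eq_rl[OF \<theta>(1) z] loss_eq_rl[OF \<theta>(2) z]
    by (intro convex_fun_ineq[of "\<lambda>\<theta>. li i \<theta> z"]) (auto simp: proper_convex_lsc_def)
  then show ?thesis unfolding i(2)[symmetric] loss_eq_rl[OF t z] by simp
qed

text \<open>Integrability at the combined parameter has to be derived: the positive part is
  dominated by integrable losses, and the negative part is finite on the ambiguity set.\<close>

lemma expect_convex:
  assumes Q: "Q \<in> ambiguity_set Z c \<epsilon> P" and \<theta>: "\<theta> \<in> \<Theta>" "\<theta>' \<in> \<Theta>" and uv: "0 \<le> u" "0 \<le> v" "u + v = 1"
    and a: "expect Q (loss \<theta>) \<le> ereal a" and b: "expect Q (loss \<theta>') \<le> ereal b"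
  shows "expect Q (loss (u *\<^sub>R \<theta> + v *\<^sub>R \<theta>')) \<le> ereal (u * a + v * b)"
proof -
  let ?t = "u *\<^sub>R \<theta> + v *\<^sub>R \<theta>'"
  have t: "?t \<in> \<Theta>" using convexD[OF convex_\<Theta> \<theta> uv] .
  note Qd = distributionsD[OF ambiguity_distributions[OF Q]]
  have i1: "integrable Q (rl \<theta>)" and i2: "integrable Q (rl \<theta>')"
    using expect_le_integrable[OF Q] \<theta> a b by blast+
  have ab: "(\<integral>z. rl \<theta> z \<partial>Q) \<le> a" "(\<integral>z. rl \<theta>' z \<partial>Q) \<le> b"
    using a b expect_integral[OF Q \<theta>(1) i1] expect_integral[OF Q \<theta>(2) i2] by simp_all
  have ii: "integrable Q (\<lambda>z. u * rl \<theta> z + v * rl \<theta>' z)" using i1 i2 by simp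
  have le: "rl ?t z \<le> u * rl \<theta> z + v * rl \<theta>' z" if "z \<in> space Q" for z
    using rl_convex[OF _ \<theta> uv] that Qd(3) by simp
  have m: "rl ?t \<in> borel_measurable Q"
    using rl_measurable[OF t] Qd(1) by (simp cong: measurable_cong_sets)
  have "(\<integral>\<^sup>+ z. ennreal (rl ?t z) \<partial>Q) \<le> (\<integral>\<^sup>+ z. ennreal (u * rl \<theta> z + v * rl \<theta>' z) \<partial>Q)"
    using le by (intro nn_integral_mono ennreal_leI)
  also have "\<dots> < \<infinity>" using ii unfolding real_integrable_def by (auto simp: less_top[symmetric])
  finally have pos: "(\<integral>\<^sup>+ z. ennreal (rl ?t z) \<partial>Q) < \<infinity>" .
  have "(\<integral>\<^sup>+ z. ennreal (- rl ?t z) \<partial>Q) = (\<integral>\<^sup>+ z. e2ennreal (- loss ?t z) \<partial>Q)"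
    using loss_eq_rl[OF t] Qd(3) by (intro nn_integral_cong) (simp add: e2ennreal_eq_real)
  then have it: "integrable Q (rl ?t)"
    using m pos negative_part_finite[OF Q t] unfolding real_integrable_def by auto
  have "expect Q (loss ?t) = ereal (\<integral>z. rl ?t z \<partial>Q)" by (rule expect_integral[OF Q t it])
  also have "(\<integral>z. rl ?t z \<partial>Q) \<le> (\<integral>z. u * rl \<theta> z + v * rl \<theta>' z \<partial>Q)"
    using le by (intro integral_mono it ii)
  also have "\<dots> = u * (\<integral>z. rl \<theta> z \<partial>Q) + v * (\<integral>z. rl \<theta>' z \<partial>Q)" using i1 i2 by simp
  also have "\<dots> \<le> u * a + v * b" using ab uv by (intro add_mono mult_left_mono)
  finally show ?thesis by simp
qed

text \<open>Couplings are mixed rather than distributions: the second marginal stays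
  \<open>P\<close>, the costs average, and the first marginals mix along. One \<open>Q\<close>
  serves all \<theta>.\<close>

lemma mixture_coupling:
  assumes A: "A \<in> space (prob_algebra (borel_on Z \<Otimes>\<^sub>M borel_on Z))" "distr A (borel_on Z) snd = P"
    and B: "B \<in> space (prob_algebra (borel_on Z \<Otimes>\<^sub>M borel_on Z))" "distr B (borel_on Z) snd = P"
    and u: "0 < u" "u < 1" and a: "(\<integral>\<^sup>+ (z, z'). c z z' \<partial>A) \<le> ennreal a" and b: "(\<integral>\<^sup>+ (z, z'). c z z' \<partial>B) \<le> ennreal b"
    and ab: "0 \<le> a" "0 \<le> b" "(1 - u) * a + u * b \<le> \<epsilon>"
  shows "\<exists>Q\<in>ambiguity_set Z c \<epsilon> P. \<forall>\<theta>\<in>\<Theta>. \<forall>r1 r2.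
    (\<integral>\<^sup>+ z. e2ennreal (- loss \<theta> z) \<partial>(distr A (borel_on Z) fst)) < \<infinity> \<longrightarrow>
    (\<integral>\<^sup>+ z. e2ennreal (- loss \<theta> z) \<partial>(distr B (borel_on Z) fst)) < \<infinity> \<longrightarrow>
    ereal r1 \<le> expect (distr A (borel_on Z) fst) (loss \<theta>) \<longrightarrow>
    ereal r2 \<le> expect (distr B (borel_on Z) fst) (loss \<theta>) \<longrightarrow>
    ereal ((1 - u) * r1 + u * r2) \<le> expect Q (loss \<theta>)"
proof -
  obtain M where M: "M \<in> space (prob_algebra (borel_on Z \<Otimes>\<^sub>M borel_on Z))"
    and mix: "\<And>h. h \<in> borel_measurable (borel_on Z \<Otimes>\<^sub>M borel_on Z) \<Longrightarrow>
      (\<integral>\<^sup>+ x. h x \<partial>M) = ennreal (1 - u) * (\<integral>\<^sup>+ x. h x \<partial>A) + ennreal u * (\<integral>\<^sup>+ x. h x \<partial>B)"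
    using prob_mixture[OF A(1) B(1), of u] u by auto
  have sM: "sets N = sets (borel_on Z \<Otimes>\<^sub>M borel_on Z)" if "N \<in> {M, A, B}" for N
    using M A B that by (auto simp: space_prob_algebra)
  have meas: "fst \<in> N \<rightarrow>\<^sub>M borel_on Z" "snd \<in> N \<rightarrow>\<^sub>M borel_on Z" if "N \<in> {M, A, B}" for N
    using measurable_fst measurable_snd by (simp_all add: sM[OF that] cong: measurable_cong_sets)
  have "distr M (borel_on Z) snd = P"
  proof (rule measure_eqI)
    show "sets (distr M (borel_on Z) snd) = sets P" using distributionsD(1)[OF P_distribution] by simp
    fix X assume "X \<in> sets (distr M (borel_on Z) snd)"
    then have X: "X \<in> sets (borel_on Z)" by simp
    have em: "emeasure (distr N (borel_on Z) snd) X = (\<integral>\<^sup>+ w. indicator X (snd w) \<partial>N)" if "N \<in> {M, A, B}" for N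
      using nn_integral_distr[OF meas(2)[OF that], of "indicator X"] X by simp
    have "(\<lambda>w. indicator X (snd w) :: ennreal) \<in> borel_measurable (borel_on Z \<Otimes>\<^sub>M borel_on Z)"
      using X by (intro measurable_compose[OF measurable_snd] borel_measurable_indicator)
    from mix[OF this] have "emeasure (distr M (borel_on Z) snd) X = ennreal (1 - u) * emeasure P X + ennreal u * emeasure P X"
      using em[of M] em[of A] em[of B] A(2) B(2) by simp
    also have "\<dots> = ennreal ((1 - u) + u) * emeasure P X"
      using u by (subst ennreal_plus) (auto simp: distrib_right)
    finally show "emeasure (distr M (borel_on Z) snd) X = emeasure P X" by simp
  qed
  moreover have "(\<integral>\<^sup>+ (z, z'). c z z' \<partial>M) \<le> ennreal \<epsilon>"
  proof -
    have "(\<integral>\<^sup>+ (z, z'). c z z' \<partial>M) \<le> ennreal (1 - u) * ennreal a + ennreal u * ennreal b"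
      unfolding mix[OF lsc_borel_measurable[OF cost_lsc]] using a b by (intro add_mono mult_left_mono) auto
    also have "\<dots> = ennreal ((1 - u) * a + u * b)"
      using u ab by (simp add: ennreal_mult[symmetric] ennreal_plus[symmetric] del: ennreal_plus)
    also have "\<dots> \<le> ennreal \<epsilon>" using ab by (intro ennreal_leI)
    finally show ?thesis .
  qed
  ultimately have "distr M (borel_on Z) fst \<in> ambiguity_set Z c \<epsilon> P" by (rule coupling_marginal[OF M])
  moreover have "ereal ((1 - u) * r1 + u * r2) \<le> expect (distr M (borel_on Z) fst) (loss \<theta>)"
    if \<theta>: "\<theta> \<in> \<Theta>" and fin: "(\<integral>\<^sup>+ z. e2ennreal (- loss \<theta> z) \<partial>(distr A (borel_on Z) fst)) < \<infinity>"
      "(\<integral>\<^sup>+ z. e2ennreal (- loss \<theta> z) \<partial>(distr B (borel_on Z) fst)) < \<infinity>"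
      and r: "ereal r1 \<le> expect (distr A (borel_on Z) fst) (loss \<theta>)"
      "ereal r2 \<le> expect (distr B (borel_on Z) fst) (loss \<theta>)" for \<theta> r1 r2
  proof -
    have mixd: "(\<integral>\<^sup>+ z. h z \<partial>(distr M (borel_on Z) fst)) =
        ennreal (1 - u) * (\<integral>\<^sup>+ z. h z \<partial>(distr A (borel_on Z) fst)) + ennreal u * (\<integral>\<^sup>+ z. h z \<partial>(distr B (borel_on Z) fst))"
      if h: "h \<in> borel_measurable (borel_on Z)" for h
    proof -
      have "(\<integral>\<^sup>+ z. h z \<partial>(distr N (borel_on Z) fst)) = (\<integral>\<^sup>+ w. h (fst w) \<partial>N)" if "N \<in> {M, A, B}" for N
        using h by (intro nn_integral_distr meas(1)[OF that]) simp
      then show ?thesis using mix[OF measurable_compose[OF measurable_fst h]] by simp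
    qed
    have m1: "(\<lambda>z. e2ennreal (loss \<theta> z)) \<in> borel_measurable (borel_on Z)"
      "(\<lambda>z. e2ennreal (- loss \<theta> z)) \<in> borel_measurable (borel_on Z)"
      using loss_measurable[OF \<theta>] by measurable
    show ?thesis
      unfolding expect_def mixd[OF m1(1)] mixd[OF m1(2)]
      using r by (intro mixture_difference_ge u fin) (simp_all add: expect_def)
  qed
  ultimately show ?thesis by blast
qed

text \<open>The move towards \<open>center\<close> adds a term in
  \<open>b1 \<bullet> \<theta>\<close> that may be unbounded below. A share \<open>u\<close> of
  \<open>Q\<close> contributes linear growth in \<open>norm \<theta>\<close>, of which an exactly
  opposite affine term is used, so the total error is independent of \<theta> and of order
  \<open>u\<close>.\<close>

lemma dual_ge_inf_compact:
  assumes Q: "Q \<in> ambiguity_set Z c \<epsilon> P"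
    and comp: "\<And>a::real. compact {\<theta>\<in>\<Theta>. expect Q (loss \<theta>) \<le> ereal a}"
    and fin: "\<theta>0 \<in> \<Theta>" "expect Q (loss \<theta>0) < \<infinity>"
    and x: "x \<in> D" and v: "\<And>\<theta>. \<theta> \<in> \<Theta> \<Longrightarrow> G \<theta> x \<le> ereal (- v)"
  shows "ereal v \<le> dual_value"
proof -
  have "\<exists>a>0. \<exists>b. \<forall>\<theta>\<in>\<Theta>. ereal (a * norm \<theta> - b) \<le> expect Q (loss \<theta>)"
  proof (rule inf_compact_coercive[OF convex_\<Theta> _ fin comp])
    show "expect Q (loss \<theta>) \<noteq> -\<infinity>" if "\<theta> \<in> \<Theta>" for \<theta>
      by (rule expect_not_MInf[OF negative_part_finite[OF Q that]])
  qed (rule expect_convex[OF Q])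
  then obtain a b where a: "a > 0" and ab: "\<And>\<theta>. \<theta> \<in> \<Theta> \<Longrightarrow> ereal (a * norm \<theta> - b) \<le> expect Q (loss \<theta>)" by blast
  obtain b1 b2 where center: "\<And>\<theta>. G \<theta> center \<le> ereal (b2 - b1 \<bullet> \<theta>)" using center_G by blast
  \<comment> \<open>Chosen so that \<open>\<eta> * \<bar>b1 \<bullet> \<theta>\<bar>\<close> stays
    below the guaranteed growth \<open>a * norm \<theta>\<close>.\<close>
  define \<eta> where "\<eta> = a / (norm b1 + 1)"
  have \<eta>: "\<eta> > 0" using a by (simp add: \<eta>_def add_nonneg_pos)
  have \<eta>b: "\<eta> * (b1 \<bullet> \<theta>) \<le> a * norm \<theta>" "- (\<eta> * (b1 \<bullet> \<theta>)) \<le> a * norm \<theta>" for \<theta>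
  proof -
    have "\<bar>b1 \<bullet> \<theta>\<bar> \<le> norm b1 * norm \<theta>" by (rule Cauchy_Schwarz_ineq2)
    also have "\<dots> \<le> (norm b1 + 1) * norm \<theta>" by (intro mult_right_mono) auto
    finally have "\<eta> * \<bar>b1 \<bullet> \<theta>\<bar> \<le> \<eta> * ((norm b1 + 1) * norm \<theta>)" using \<eta> by (intro mult_left_mono) auto
    also have "\<eta> * ((norm b1 + 1) * norm \<theta>) = a * norm \<theta>" by (simp add: \<eta>_def add_nonneg_eq_0_iff)
    finally have "\<bar>\<eta> * (b1 \<bullet> \<theta>)\<bar> \<le> a * norm \<theta>" using \<eta> by (simp add: abs_mult)
    then show "\<eta> * (b1 \<bullet> \<theta>) \<le> a * norm \<theta>" "- (\<eta> * (b1 \<bullet> \<theta>)) \<le> a * norm \<theta>" by linarith+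
  qed
  have "\<epsilon> < \<epsilon> + \<eta> * \<epsilon>" using \<eta> eps by simp
  then obtain B where B: "B \<in> couplings Z Q P" "(\<integral>\<^sup>+ (z, z'). c z z' \<partial>B) \<le> ennreal (\<epsilon> + \<eta> * \<epsilon>)"
    using ambiguity_coupling[OF Q] by blast
  have BM: "B \<in> space (prob_algebra (borel_on Z \<Otimes>\<^sub>M borel_on Z))" using B(1) by (simp add: couplings_def)
  define m where "m = b + \<eta> * b2"
  have key: "ereal (v - u * (v + \<eta> * v + m)) \<le> dual_value" if u: "0 < u" "u < 1" "u * \<eta> < 1 - u" for u
  proof -
    \<comment> \<open>The identity \<open>(1 - u) * s = u * \<eta>\<close> serves twice: the cost
      saved by moving towards \<open>center\<close> pays for the excess of \<open>B\<close>, and the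
      terms in \<open>b1 \<bullet> \<theta>\<close> cancel.\<close>
    define s where "s = u * \<eta> / (1 - u)"
    have s: "0 < s" "s < 1" "(1 - u) * s = u * \<eta>"
      using u \<eta> by (simp_all add: s_def)
    define y where "y = (\<lambda>k. (1 - s) *\<^sub>R x k + s *\<^sub>R center k)"
    have "y \<in> DD ((1 - s) * \<epsilon> + s * 0)"
      unfolding y_def using s by (intro convex_DD x center_D) auto
    then have y: "y \<in> DD ((1 - s) * \<epsilon>)" by simp
    have ypos: "fst (y k) > 0" if k: "k \<in> S" for k
    proof -
      have "0 \<le> (1 - s) * fst (x k)" using D_nonneg[OF x k] s by simp
      moreover have "0 < s * fst (center k)" using mult_pos_pos[OF s(1) center_weight[OF k]] k by (simp add: center_def)
      ultimately show ?thesis by (simp add: y_def)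
    qed
    have yG: "G \<theta> y \<le> ereal (- ((1 - s) * v + s * (b1 \<bullet> \<theta> - b2)))" if \<theta>: "\<theta> \<in> \<Theta>" for \<theta>
    proof -
      have "G \<theta> y \<le> ereal ((1 - s) * (- v) + s * (b2 - b1 \<bullet> \<theta>))"
        unfolding y_def using s by (intro G_convex[OF x center_D] v[OF \<theta>] center) auto
      also have "(1 - s) * (- v) + s * (b2 - b1 \<bullet> \<theta>) = - ((1 - s) * v + s * (b1 \<bullet> \<theta> - b2))"
        by (simp add: algebra_simps)
      finally show ?thesis .
    qed
    obtain A where A: "A \<in> space (prob_algebra (borel_on Z \<Otimes>\<^sub>M borel_on Z))" "distr A (borel_on Z) snd = P"
      "(\<integral>\<^sup>+ (z, z'). c z z' \<partial>A) \<le> ennreal ((1 - s) * \<epsilon>)"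
      and AE: "\<forall>\<theta>\<in>\<Theta>. (\<integral>\<^sup>+ z. e2ennreal (- loss \<theta> z) \<partial>(distr A (borel_on Z) fst)) < \<infinity> \<and>
        (\<forall>v. G \<theta> y \<le> ereal (- v) \<longrightarrow> ereal v \<le> expect (distr A (borel_on Z) fst) (loss \<theta>))"
      using discrete_coupling[OF y] ypos by (metis less_irrefl)
    have "(1 - u) * ((1 - s) * \<epsilon>) + u * (\<epsilon> + \<eta> * \<epsilon>) = \<epsilon> - ((1 - u) * s - u * \<eta>) * \<epsilon>"
      by (simp add: algebra_simps)
    then have cost: "(1 - u) * ((1 - s) * \<epsilon>) + u * (\<epsilon> + \<eta> * \<epsilon>) \<le> \<epsilon>" using s(3) by simp
    obtain Q' where Q': "Q' \<in> ambiguity_set Z c \<epsilon> P"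
      and mix: "\<forall>\<theta>\<in>\<Theta>. \<forall>r1 r2.
        (\<integral>\<^sup>+ z. e2ennreal (- loss \<theta> z) \<partial>(distr A (borel_on Z) fst)) < \<infinity> \<longrightarrow>
        (\<integral>\<^sup>+ z. e2ennreal (- loss \<theta> z) \<partial>(distr B (borel_on Z) fst)) < \<infinity> \<longrightarrow>
        ereal r1 \<le> expect (distr A (borel_on Z) fst) (loss \<theta>) \<longrightarrow>
        ereal r2 \<le> expect (distr B (borel_on Z) fst) (loss \<theta>) \<longrightarrow>
        ereal ((1 - u) * r1 + u * r2) \<le> expect Q' (loss \<theta>)"
      using mixture_coupling[OF A(1,2) BM couplingD(5)[OF B(1)] u(1,2) A(3) B(2) _ _ cost] s \<eta> eps by auto
    have "ereal (v - u * (v + \<eta> * v + m)) \<le> expect Q' (loss \<theta>)" if \<theta>: "\<theta> \<in> \<Theta>" for \<theta>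
    proof -
      define r1 where "r1 = (1 - s) * v + s * (b1 \<bullet> \<theta> - b2)"
      \<comment> \<open>A lower bound for the expectation under \<open>Q\<close>, shaped so that its
        \<theta>-dependent part cancels that of \<open>r1\<close> after weighting.\<close>
      define r2 where "r2 = - m - \<eta> * (b1 \<bullet> \<theta> - b2)"
      have "r2 \<le> a * norm \<theta> - b" using \<eta>b[of \<theta>] by (simp add: r2_def m_def algebra_simps)
      then have "ereal r2 \<le> ereal (a * norm \<theta> - b)" by simp
      then have "ereal r2 \<le> expect Q (loss \<theta>)" using ab[OF \<theta>] by (rule order_trans)
      moreover have "ereal r1 \<le> expect (distr A (borel_on Z) fst) (loss \<theta>)"
        using AE \<theta> yG[OF \<theta>] unfolding r1_def by blast
      ultimately have "ereal ((1 - u) * r1 + u * r2) \<le> expect Q' (loss \<theta>)"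
        using mix AE \<theta> negative_part_finite[OF Q \<theta>] unfolding couplingD(4)[OF B(1)] by blast
      moreover have "(1 - u) * r1 + u * r2 = v - u * (v + \<eta> * v + m)"
      proof -
        have "(1 - u) * r1 + u * r2 = (1 - u) * v - ((1 - u) * s) * v + ((1 - u) * s) * (b1 \<bullet> \<theta> - b2)
            - u * m - u * \<eta> * (b1 \<bullet> \<theta> - b2)"
          by (simp add: r1_def r2_def algebra_simps)
        then show ?thesis unfolding s(3) by (simp add: algebra_simps)
      qed
      ultimately show ?thesis by simp
    qed
    then have "ereal (v - u * (v + \<eta> * v + m)) \<le> (INF \<theta>\<in>\<Theta>. expect Q' (loss \<theta>))" by (intro INF_greatest)
    then show ?thesis by (rule SUP_upper2[OF Q'])
  qed
  show ?thesis
  proof (rule ereal_le_epsilon2)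
    fix e :: real assume e: "0 < e"
    define k where "k = \<bar>v + \<eta> * v + m\<bar> + 1"
    have k: "k > 0" by (simp add: k_def)
    \<comment> \<open>The first entry gives \<open>u * \<eta> < 1 - u\<close>, hence
      \<open>s < 1\<close>; the second keeps the total error below \<open>e\<close>.\<close>
    define u where "u = min (1 / (2 * (1 + \<eta>))) (e / k)"
    have u0: "0 < u" using e k \<eta> by (simp add: u_def)
    have "u * (1 + \<eta>) \<le> 1 / (2 * (1 + \<eta>)) * (1 + \<eta>)" using \<eta> by (intro mult_right_mono) (auto simp: u_def)
    also have "\<dots> = 1 / 2" using \<eta> by (simp add: field_simps)
    finally have "u * (1 + \<eta>) < 1" by simp
    then have u: "u * \<eta> < 1 - u" by (simp add: algebra_simps)
    moreover have "0 < u * \<eta>" using u0 \<eta> by simp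
    ultimately have u1: "u < 1" by simp
    have "u * (v + \<eta> * v + m) \<le> u * k" using u0 by (intro mult_left_mono) (auto simp: k_def)
    also have "\<dots> \<le> e / k * k" using k by (intro mult_right_mono) (auto simp: u_def)
    also have "\<dots> = e" using k by simp
    finally have "v \<le> v - u * (v + \<eta> * v + m) + e" by simp
    then have "ereal v \<le> ereal (v - u * (v + \<eta> * v + m)) + ereal e" by simp
    also have "\<dots> \<le> dual_value + ereal e" by (intro add_right_mono key u0 u1 u)
    finally show "ereal v \<le> dual_value + ereal e" .
  qed
qed

lemma dual_eq_program:
  assumes fin: "\<exists>\<theta>\<in>\<Theta>. (SUP Q\<in>ambiguity_set Z c \<epsilon> P. expect Q (loss \<theta>)) < \<infinity>"
    and reg: "(\<exists>Q\<in>ambiguity_set Z c \<epsilon> P. \<forall>a::real. compact {\<theta>\<in>\<Theta>. expect Q (loss \<theta>) \<le> ereal a})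
         \<or> compact Z
         \<or> (\<forall>z'\<in>Z. ((\<lambda>z. cost_section Z c z' z / ereal (norm z)) \<longlongrightarrow> \<infinity>) at_infinity)"
  shows "dual_value = program_value"
proof (rule antisym[OF dual_le_program])
  show "program_value \<le> dual_value"
  proof (rule Sup_least)
    fix r assume "r \<in> {program_objective I J L zh li g q \<nu> \<xi> \<alpha> \<beta> | q \<nu> \<xi> \<alpha> \<beta>.
       program_feasible I J K L Z c \<epsilon> p zh f q \<nu> \<xi> \<alpha> \<beta>}"
    then obtain q \<nu> \<xi> \<alpha> \<beta> where r: "r = program_objective I J L zh li g q \<nu> \<xi> \<alpha> \<beta>"
      and feas: "program_feasible I J K L Z c \<epsilon> p zh f q \<nu> \<xi> \<alpha> \<beta>" by blast
    \<comment> \<open>Only real levels \<open>v\<close> below \<open>r\<close> are compared, since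
      \<open>r\<close> itself may be infinite.\<close>
    have le: "ereal v \<le> dual_value" if vr: "ereal v \<le> r" for v
    proof -
      obtain x where x: "x \<in> D" and xv: "\<And>\<theta>. \<theta> \<in> \<Theta> \<Longrightarrow> G \<theta> x \<le> ereal (- v)"
        using program_point[OF feas] vr unfolding r by blast
      from reg consider (a) "\<exists>Q\<in>ambiguity_set Z c \<epsilon> P. \<forall>a::real. compact {\<theta>\<in>\<Theta>. expect Q (loss \<theta>) \<le> ereal a}"
        | (b) "compact Z \<or> (\<forall>z'\<in>Z. ((\<lambda>z. cost_section Z c z' z / ereal (norm z)) \<longlongrightarrow> \<infinity>) at_infinity)"
        by blast
      then show ?thesis
      proof cases
        case a
        then obtain Q where Q: "Q \<in> ambiguity_set Z c \<epsilon> P"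
          "\<And>a::real. compact {\<theta>\<in>\<Theta>. expect Q (loss \<theta>) \<le> ereal a}" by blast
        obtain \<theta>0 where \<theta>0: "\<theta>0 \<in> \<Theta>" "(SUP Q\<in>ambiguity_set Z c \<epsilon> P. expect Q (loss \<theta>0)) < \<infinity>"
          using fin by blast
        have "expect Q (loss \<theta>0) < \<infinity>"
          using SUP_upper[OF Q(1), of "\<lambda>Q. expect Q (loss \<theta>0)"] \<theta>0(2) by (rule le_less_trans)
        then show ?thesis by (rule dual_ge_inf_compact[OF Q \<theta>0(1) _ x xv])
      next
        case b
        show ?thesis by (rule dual_ge_degenerate[OF x recession_degenerate[OF x _ _ b] xv])
      qed
    qed
    show "r \<le> dual_value"
    proof (rule ccontr)
      assume "\<not> r \<le> dual_value"
      then have "dual_value < r" by (simp only: not_le)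
      from ereal_dense2[OF this] obtain v where v: "dual_value < ereal v" "ereal v < r" by (elim exE conjE)
      from le[OF less_imp_le[OF v(2)]] v(1) show False using leD by blast
    qed
  qed
qed

end

theorem proposition3:
  fixes \<Theta> :: "(real^'m) set" and Z :: "(real^'d) set"
    and P :: "(real^'d) measure"
    and c :: "real^'d \<Rightarrow> real^'d \<Rightarrow> ennreal"
    and loss :: "real^'m \<Rightarrow> real^'d \<Rightarrow> ereal"
    and li :: "nat \<Rightarrow> real^'m \<Rightarrow> real^'d \<Rightarrow> ereal"
    and f :: "nat \<Rightarrow> real^'d \<Rightarrow> ereal" and g :: "nat \<Rightarrow> real^'m \<Rightarrow> ereal"
    and p :: "nat \<Rightarrow> real" and zh :: "nat \<Rightarrow> real^'d"
    and \<epsilon> :: real and I J K L :: nat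
  assumes "\<epsilon> > 0"
    and "\<Theta> \<noteq> {}" and "closed \<Theta>" and "Z \<noteq> {}" and "closed Z"
    and cost_zero: "\<And>z z'. z \<in> Z \<Longrightarrow> z' \<in> Z \<Longrightarrow> c z z' = 0 \<longleftrightarrow> z = z'"
    and P_distribution: "P \<in> distributions Z"
    and P_discrete: "\<And>A. A \<in> sets (borel_on Z) \<Longrightarrow>
        emeasure P A = (\<Sum>j=1..J. ennreal (p j) * emeasure (return (borel_on Z) (zh j)) A)"
    and atoms: "\<And>j. j \<in> {1..J} \<Longrightarrow> p j > 0 \<and> zh j \<in> Z"
    and cost_lsc: "lsc_on (Z \<times> Z) (\<lambda>(z, z'). c z z')"
    and cost_convex: "\<And>z'. z' \<in> Z \<Longrightarrow> convex_fun (cost_section Z c z')"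
    and "I \<ge> 1"
    and loss_max: "\<And>\<theta> z. \<theta> \<in> \<Theta> \<Longrightarrow> z \<in> Z \<Longrightarrow> loss \<theta> z = Max ((\<lambda>i. li i \<theta> z) ` {1..I})"
    and loss_convex: "\<And>i z. i \<in> {1..I} \<Longrightarrow> z \<in> Z \<Longrightarrow> proper_convex_lsc (\<lambda>\<theta>. li i \<theta> z)"
    and loss_concave: "\<And>i \<theta>. i \<in> {1..I} \<Longrightarrow> proper_convex_lsc (\<lambda>z. - li i \<theta> z)"
    and f_convex: "\<And>k. k \<in> {1..K} \<Longrightarrow> proper_convex_lsc (f k)"
    and g_convex: "\<And>l. l \<in> {1..L} \<Longrightarrow> proper_convex_lsc (g l)"
    and Z_eq: "Z = {z. \<forall>k\<in>{1..K}. f k z \<le> 0}"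
    and \<Theta>_eq: "\<Theta> = {\<theta>. \<forall>l\<in>{1..L}. g l \<theta> \<le> 0}"
    and slater_Z: "\<And>j. j \<in> {1..J} \<Longrightarrow>
        zh j \<in> rel_interior (effective_dom (cost_section Z c (zh j))) \<and> slater_point K f (zh j)"
    and slater_\<Theta>: "\<exists>\<theta>. slater_point L g \<theta>"
    and unif_integrable: "\<And>Q \<theta>'. Q \<in> ambiguity_set Z c \<epsilon> P \<Longrightarrow> \<theta>' \<in> \<Theta> \<Longrightarrow>
        \<exists>U. open U \<and> \<theta>' \<in> U \<and>
          uniformly_integrable_family Q (U \<inter> \<Theta>) (\<lambda>\<theta> z. e2ennreal (- min 0 (loss \<theta> z)))"
    and finite_worst_case:
        "\<exists>\<theta>\<in>\<Theta>. (SUP Q\<in>ambiguity_set Z c \<epsilon> P. expect Q (loss \<theta>)) < \<infinity>"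
    and regularity:
        "(\<exists>Q\<in>ambiguity_set Z c \<epsilon> P. \<forall>a::real. compact {\<theta>\<in>\<Theta>. expect Q (loss \<theta>) \<le> ereal a})
         \<or> compact Z
         \<or> (\<forall>z'\<in>Z. ((\<lambda>z. cost_section Z c z' z / ereal (norm z)) \<longlongrightarrow> \<infinity>) at_infinity)"
  shows "(SUP Q\<in>ambiguity_set Z c \<epsilon> P. INF \<theta>\<in>\<Theta>. expect Q (loss \<theta>)) =
         Sup {program_objective I J L zh li g q \<nu> \<xi> \<alpha> \<beta> | q \<nu> \<xi> \<alpha> \<beta>.
                program_feasible I J K L Z c \<epsilon> p zh f q \<nu> \<xi> \<alpha> \<beta>}"
proof -
  interpret dro_program \<Theta> Z c loss li f g p zh \<epsilon> I J K L P
  proof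
    show "\<epsilon> > 0" "closed Z" "I \<ge> 1" by fact+
  qed (fact cost_zero atoms cost_lsc cost_convex loss_max loss_convex loss_concave f_convex g_convex
      Z_eq \<Theta>_eq slater_\<Theta> P_distribution P_discrete unif_integrable)+
  show ?thesis by (rule dual_eq_program[OF finite_worst_case regularity])
qed

end
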